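(* Assume that $g$ is convex and let $\bar\xi\in\mathbb{R}^n$ with $r(\bar\xi)=0$ be given. Then there exists $\delta>0$ such that for all $\xi_0\in\mathbb{R}^n$ with $|\xi_0-\bar\xi|\le\delta$ the sequence $(\xi_k)_{k\in\mathbb{N}_0}\subset\mathbb{R}^n$ generated by $$\xi_{k+1}:=\xi_k-Dr(\xi_k)^{-1}r(\xi_k),\qquad Dr(\xi):=\tfrac1\alpha\nabla^2g(\tilde u(\xi))\Theta(\xi)-I,$$ converges $q$-superlinearly towards $\bar\xi$.
   Context: $|\cdot|$ is the Euclidean norm. $F=\{a_1,\ldots,a_n\}\subset\mathbb{R}^2$ is a finite set of pairwise distinct points; $D\subset\mathbb{R}^2$ is a convex compact polygon with nonempty interior; $u_d$ is a nonnegative Borel measure on $D$, absolutely continuous w.r.t. the Lebesgue measure, with density $\varrho$ continuous on $D$; $\alpha>0$. $g\colon\mathbb{R}^n\to\mathbb{R}$ is twice continuously differentiable with gradient $\nabla g$ and Hessian $\nabla^2g$. For $\xi\in\mathbb{R}^n$: $D_i(\xi):=\{x\in\operatorname{int}(D): a_i^\top x-\xi_i>a_j^\top x-\xi_j\ \forall j\ne i\}$; $\tilde u(\xi):=(u_d(D_1(\xi)),\ldots,u_d(D_n(\xi)))^\top\in\mathbb{R}^n$; $A:=\frac12(|a_1|^2,\ldots,|a_n|^2)^\top$; $r(\xi):=A+\frac1\alpha\nabla g(\tilde u(\xi))-\xi$. The matrix $\Theta(\xi)\in\mathbb{R}^{n\times n}$: regions $D_i(\xi)$ and $D_k(\xi)$,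 $i\neq k$, are said to share an edge if both are nonempty and $\operatorname{cl}(D_i(\xi))\cap\operatorname{cl}(D_k(\xi))$ is a line segment of positive length. If $u_d(D_i(\xi))>0$, then for $k\ne i$, $\Theta_{ik}(\xi):=\frac{1}{|a_k-a_i|}\int_{\operatorname{cl}(D_i(\xi))\cap\operatorname{cl}(D_k(\xi))}\varrho\,\mathrm{d}\mathcal{H}^1$ if $D_i(\xi)$ and $D_k(\xi)$ share an edge and $\Theta_{ik}(\xi):=0$ otherwise, and $\Theta_{ii}(\xi):=-\sum_{k\ne i}\Theta_{ik}(\xi)$. If $u_d(D_i(\xi))=0$, then $\Theta_{ij}(\xi):=0$ for all $j$. Here $\mathcal{H}^1$ is the one-dimensional Hausdorff measure. Q-superlinear convergence of $\xi_k$ to $\bar\xi$ means $\xi_k\to\bar\xi$ and $|\xi_{k+1}-\bar\xi|=o(|\xi_k-\bar\xi|)$ as $k\to\infty$. *)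

theory Defs
  imports "HOL-Analysis.Analysis" "HOL-Library.Landau_Symbols"
begin

section \<open>One-dimensional Hausdorff measure\<close>

text \<open>
  \<open>hausdorff1_pre \<delta> A\<close> is the infimum of the sums of diameters over countable covers of \<open>A\<close> by sets
  of diameter at most \<open>\<delta>\<close>.  The library's \<open>diameter\<close> carries no information on unbounded sets, so
  boundedness of the covering sets is required explicitly; finite covers are included via
  \<open>diameter {} = 0\<close>.  No normalising constant is needed in dimension one.
\<close>

definition hausdorff1_pre :: "real \<Rightarrow> 'a::metric_space set \<Rightarrow> ennreal" where
  "hausdorff1_pre \<delta> A =
     (INF C\<in>{C :: nat \<Rightarrow> 'a set. A \<subseteq> (\<Union>i. C i) \<and> (\<forall>i. bounded (C i) \<and> diameter (C i) \<le> \<delta>)}.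
        \<Sum>i. ennreal (diameter (C i)))"

definition hausdorff1_outer :: "'a::metric_space set \<Rightarrow> ennreal" where
  "hausdorff1_outer A = (SUP \<delta>\<in>{0<..}. hausdorff1_pre \<delta> A)"

definition hausdorff1 :: "'a::metric_space measure" where
  "hausdorff1 = measure_of UNIV (sets borel) hausdorff1_outer"

text \<open>
  Since \<open>measure_of\<close> returns the null measure when its argument is not countably additive, we verify
  that this case does not occur: \<open>hausdorff1_outer\<close> is a metric outer measure, hence countably
  additive on the Borel sets.
\<close>

lemma hausdorff1_pre_le:
  assumes "A \<subseteq> (\<Union>i. C i)" "\<And>i. bounded (C i)" "\<And>i. diameter (C i) \<le> \<delta>"
  shows "hausdorff1_pre \<delta> A \<le> (\<Sum>i. ennreal (diameter (C i)))"
  unfolding hausdorff1_pre_def by (rule INF_lower) (use assms in auto)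

lemma hausdorff1_pre_mono: "A \<subseteq> B \<Longrightarrow> hausdorff1_pre \<delta> A \<le> hausdorff1_pre \<delta> B"
  unfolding hausdorff1_pre_def by (rule INF_superset_mono) auto

lemma hausdorff1_pre_antimono: "\<delta> \<le> \<delta>' \<Longrightarrow> hausdorff1_pre \<delta>' A \<le> hausdorff1_pre \<delta> A"
  unfolding hausdorff1_pre_def by (rule INF_superset_mono) (auto intro: order_trans)

lemma hausdorff1_pre_le_outer: "\<delta> > 0 \<Longrightarrow> hausdorff1_pre \<delta> A \<le> hausdorff1_outer A"
  unfolding hausdorff1_outer_def by (rule SUP_upper) simp

lemma hausdorff1_outer_mono: "A \<subseteq> B \<Longrightarrow> hausdorff1_outer A \<le> hausdorff1_outer B"
  unfolding hausdorff1_outer_def by (rule SUP_mono) (auto intro: hausdorff1_pre_mono)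

lemma hausdorff1_outer_empty [simp]: "hausdorff1_outer {} = 0"
proof -
  have "hausdorff1_pre \<delta> {} \<le> 0" if "\<delta> > 0" for \<delta>
    using hausdorff1_pre_le[of "{}" "\<lambda>_. {}" \<delta>] that by simp
  then have "hausdorff1_outer {} \<le> 0"
    unfolding hausdorff1_outer_def by (intro SUP_least) auto
  then show ?thesis by simp
qed

lemma hausdorff1_pre_UN_le: "hausdorff1_pre \<delta> (\<Union>n. A n) \<le> (\<Sum>n. hausdorff1_pre \<delta> (A n))"
proof (rule ennreal_le_epsilon)
  fix e :: real assume e: "0 < e" and fin: "(\<Sum>n. hausdorff1_pre \<delta> (A n)) < top"
  let ?P = "\<lambda>n C. A n \<subseteq> (\<Union>i. C i) \<and> (\<forall>i. bounded (C i) \<and> diameter (C i) \<le> \<delta>) \<and>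
      (\<Sum>i. ennreal (diameter (C i))) \<le> hausdorff1_pre \<delta> (A n) + e * (1/2)^Suc n"
  have "\<exists>C. ?P n C" for n
  proof -
    have "hausdorff1_pre \<delta> (A n) < hausdorff1_pre \<delta> (A n) + e * (1/2)^Suc n"
      using fin e by (auto simp add: less_top dest!: ennreal_suminf_lessD)
    then obtain C where "A n \<subseteq> (\<Union>i. C i)" "\<forall>i. bounded (C i) \<and> diameter (C i) \<le> \<delta>"
      "(\<Sum>i. ennreal (diameter (C i))) < hausdorff1_pre \<delta> (A n) + e * (1/2)^Suc n"
      unfolding hausdorff1_pre_def[of \<delta> "A n"] INF_less_iff by blast
    then show ?thesis by (intro exI[of _ C]) (auto intro: less_imp_le)
  qed
  then obtain B where B: "\<And>n. ?P n (B n)" by metis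
  define C where "C = case_prod B o prod_decode"
  have "(\<Union>n. A n) \<subseteq> (\<Union>i. C i)"
  proof
    fix x assume "x \<in> (\<Union>n. A n)"
    then obtain n i where "x \<in> B n i" using B by blast
    then have "x \<in> C (prod_encode (n, i))" by (simp add: C_def)
    then show "x \<in> (\<Union>i. C i)" by blast
  qed
  moreover have "bounded (C i)" "diameter (C i) \<le> \<delta>" for i
    using B by (auto simp: C_def split_def)
  ultimately have "hausdorff1_pre \<delta> (\<Union>n. A n) \<le> (\<Sum>i. ennreal (diameter (C i)))"
    by (intro hausdorff1_pre_le)
  also have "\<dots> = (\<Sum>i. (\<lambda>(n, i). ennreal (diameter (B n i))) (prod_decode i))"
    by (simp add: C_def split_def)
  also have "\<dots> = (\<Sum>n. \<Sum>i. ennreal (diameter (B n i)))"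
    by (rule suminf_ennreal_2dimen) simp
  also have "\<dots> \<le> (\<Sum>n. hausdorff1_pre \<delta> (A n) + e * (1/2) ^ Suc n)"
    using B by (intro suminf_le) auto
  also have "\<dots> = (\<Sum>n. hausdorff1_pre \<delta> (A n)) + (\<Sum>n. ennreal e * ennreal ((1/2) ^ Suc n))"
    using e by (subst suminf_add[symmetric])
      (auto simp del: ennreal_suminf_cmult simp add: ennreal_mult[symmetric])
  also have "\<dots> = (\<Sum>n. hausdorff1_pre \<delta> (A n)) + e"
    unfolding ennreal_suminf_cmult
    by (subst suminf_ennreal_eq[OF zero_le_power power_half_series]) auto
  finally show "hausdorff1_pre \<delta> (\<Union>n. A n) \<le> (\<Sum>n. hausdorff1_pre \<delta> (A n)) + e" .
qed

lemma hausdorff1_outer_UN_le: "hausdorff1_outer (\<Union>n. A n) \<le> (\<Sum>n. hausdorff1_outer (A n))"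
  unfolding hausdorff1_outer_def[of "\<Union>n. A n"]
proof (rule SUP_least)
  fix \<delta> :: real assume "\<delta> \<in> {0<..}"
  then show "hausdorff1_pre \<delta> (\<Union>n. A n) \<le> (\<Sum>n. hausdorff1_outer (A n))"
    by (intro order_trans[OF hausdorff1_pre_UN_le] suminf_le hausdorff1_pre_le_outer) auto
qed

lemma hausdorff1_outer_Un_le: "hausdorff1_outer (A \<union> B) \<le> hausdorff1_outer A + hausdorff1_outer B"
proof -
  let ?S = "\<lambda>n::nat. if n = 0 then A else if n = 1 then B else {}"
  have eq: "A \<union> B = (\<Union>n. ?S n)"
  proof
    show "A \<union> B \<subseteq> (\<Union>n. ?S n)"
    proof
      fix x assume "x \<in> A \<union> B"
      then have "x \<in> ?S 0 \<or> x \<in> ?S 1" by auto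
      then show "x \<in> (\<Union>n. ?S n)" by blast
    qed
  qed (auto split: if_splits)
  have "(\<Sum>n. hausdorff1_outer (?S n)) = (\<Sum>n\<in>{0,1}. hausdorff1_outer (?S n))"
    by (rule suminf_finite) auto
  then show ?thesis
    using hausdorff1_outer_UN_le[of ?S] unfolding eq by simp
qed

lemma hausdorff1_pre_separated:
  assumes sep: "\<And>x y. x \<in> P \<Longrightarrow> y \<in> Q \<Longrightarrow> \<delta> < dist x y"
  shows "hausdorff1_pre \<delta> P + hausdorff1_pre \<delta> Q \<le> hausdorff1_pre \<delta> (P \<union> Q)"
  unfolding hausdorff1_pre_def[of \<delta> "P \<union> Q"]
proof (rule INF_greatest, clarify)
  fix C :: "nat \<Rightarrow> 'a set"
  assume cov: "P \<union> Q \<subseteq> (\<Union>i. C i)" and C: "\<forall>i. bounded (C i) \<and> diameter (C i) \<le> \<delta>"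
  have \<delta>: "0 \<le> \<delta>" using C diameter_ge_0 order_trans by blast
  let ?C = "\<lambda>S i. if C i \<inter> S = {} then {} else C i"
  have le: "hausdorff1_pre \<delta> S \<le> (\<Sum>i. ennreal (diameter (?C S i)))" if S: "S \<subseteq> P \<union> Q" for S
  proof (rule hausdorff1_pre_le)
    show "S \<subseteq> (\<Union>i. ?C S i)"
    proof
      fix x assume x: "x \<in> S"
      then obtain i where "x \<in> C i" using cov S by blast
      with x have "x \<in> ?C S i" by auto
      then show "x \<in> (\<Union>i. ?C S i)" by blast
    qed
  qed (use C \<delta> in auto)
  have disj: "C i \<inter> P = {} \<or> C i \<inter> Q = {}" for i
  proof (rule ccontr)
    assume "\<not> ?thesis"
    then obtain x y where xy: "x \<in> C i" "x \<in> P" "y \<in> C i" "y \<in> Q" by blast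
    have "bounded (C i)" "diameter (C i) \<le> \<delta>" using C by auto
    then have "dist x y \<le> \<delta>" using diameter_bounded_bound[of "C i" x y] xy by linarith
    with sep[of x y] xy show False by simp
  qed
  have "hausdorff1_pre \<delta> P + hausdorff1_pre \<delta> Q \<le>
      (\<Sum>i. ennreal (diameter (?C P i))) + (\<Sum>i. ennreal (diameter (?C Q i)))"
    by (intro add_mono le) auto
  also have "\<dots> = (\<Sum>i. ennreal (diameter (?C P i)) + ennreal (diameter (?C Q i)))"
    by (rule suminf_add) auto
  also have "\<dots> \<le> (\<Sum>i. ennreal (diameter (C i)))"
    using disj by (intro suminf_le) auto
  finally show "hausdorff1_pre \<delta> P + hausdorff1_pre \<delta> Q \<le> (\<Sum>i. ennreal (diameter (C i)))" .
qed

lemma hausdorff1_outer_separated: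
  assumes d: "0 < d" and sep: "\<And>x y. x \<in> P \<Longrightarrow> y \<in> Q \<Longrightarrow> d \<le> dist x y"
  shows "hausdorff1_outer P + hausdorff1_outer Q \<le> hausdorff1_outer (P \<union> Q)"
proof -
  have "hausdorff1_outer P + hausdorff1_outer Q =
      (SUP \<delta>\<in>{0<..}. hausdorff1_pre \<delta> P + hausdorff1_pre \<delta> Q)"
    unfolding hausdorff1_outer_def
  proof (rule SUP_add_directed_ennreal[symmetric])
    fix i j :: real assume "i \<in> {0<..}" "j \<in> {0<..}"
    then show "\<exists>k\<in>{0<..}. hausdorff1_pre i P + hausdorff1_pre j Q \<le>
        hausdorff1_pre k P + hausdorff1_pre k Q"
      by (intro bexI[of _ "min i j"] add_mono hausdorff1_pre_antimono) auto
  qed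
  also have "\<dots> \<le> hausdorff1_outer (P \<union> Q)"
  proof (rule SUP_least)
    fix \<delta> :: real assume \<delta>: "\<delta> \<in> {0<..}"
    define \<gamma> where "\<gamma> = min \<delta> (d/2)"
    have \<gamma>: "0 < \<gamma>" "\<gamma> < d" "\<gamma> \<le> \<delta>" using \<delta> d by (auto simp: \<gamma>_def min_def)
    have "hausdorff1_pre \<delta> P + hausdorff1_pre \<delta> Q \<le> hausdorff1_pre \<gamma> P + hausdorff1_pre \<gamma> Q"
      using \<gamma> by (intro add_mono hausdorff1_pre_antimono)
    also have "\<dots> \<le> hausdorff1_pre \<gamma> (P \<union> Q)"
      using sep \<gamma> by (intro hausdorff1_pre_separated) (meson less_le_trans)
    also have "\<dots> \<le> hausdorff1_outer (P \<union> Q)"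
      using \<gamma> by (intro hausdorff1_pre_le_outer)
    finally show "hausdorff1_pre \<delta> P + hausdorff1_pre \<delta> Q \<le> hausdorff1_outer (P \<union> Q)" .
  qed
  finally show ?thesis .
qed

lemma hausdorff1_outer_closed_split:
  assumes F: "closed F"
  shows "hausdorff1_outer (A \<inter> F) + hausdorff1_outer (A - F) \<le> hausdorff1_outer A"
proof (cases "F = {} \<or> hausdorff1_outer A = top")
  case True
  then show ?thesis by auto
next
  case False
  then have ne: "F \<noteq> {}" and fin: "hausdorff1_outer A < top" by (auto simp: less_top)
  let ?\<mu> = hausdorff1_outer
  define S where "S n = {x\<in>A. 1 / real (Suc n) \<le> infdist x F}" for n :: nat
  define R where "R k = S (Suc k) - S k" for k
  have infd: "\<bar>infdist x F - infdist y F\<bar> \<le> dist x y" for x y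
    by (rule infdist_triangle_abs)
  have Rsep: "1 / real (k+2) - 1 / real (k+3) \<le> dist x y" if "x \<in> R k" "y \<in> R j" "k + 2 \<le> j" for k j x y
  proof -
    have "infdist y F < 1 / real (Suc j)" "1 / real (Suc (Suc k)) \<le> infdist x F"
      using that by (auto simp: R_def S_def)
    moreover have "1 / real (Suc j) \<le> 1 / real (k+3)" using that by (intro divide_left_mono) auto
    ultimately show ?thesis using infd[of x y] by simp
  qed
  have gap: "0 < 1 / real (k+2) - 1 / real (k+3)" for k
    by (intro iffD2[OF diff_gt_0_iff_gt] divide_strict_left_mono) auto
  have RA: "R k \<subseteq> A" for k by (auto simp: R_def S_def)
  have part: "(\<Sum>k<N. ?\<mu> (R (2*k+c))) \<le> ?\<mu> (\<Union>k<N. R (2*k+c))" for N c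
  proof (induction N)
    case (Suc N)
    show ?case
    proof (cases N)
      case 0 then show ?thesis by (simp add: lessThan_Suc)
    next
      case (Suc M)
      have "(\<Sum>k<Suc N. ?\<mu> (R (2*k+c))) \<le> ?\<mu> (\<Union>k<N. R (2*k+c)) + ?\<mu> (R (2*N+c))"
        using Suc.IH by (simp add: add_right_mono)
      also have "\<dots> \<le> ?\<mu> ((\<Union>k<N. R (2*k+c)) \<union> R (2*N+c))"
      proof (rule hausdorff1_outer_separated)
        let ?d = "1 / real (2*M+c+2) - 1 / real (2*M+c+3)"
        show "0 < ?d" by (rule gap)
        fix x y assume "x \<in> (\<Union>k<N. R (2*k+c))" and y: "y \<in> R (2*N+c)"
        then obtain k where k: "k < N" "x \<in> R (2*k+c)" by blast
        have "1 / real (2*k+c+2) - 1 / real (2*k+c+3) \<le> dist x y"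
          using Rsep[OF k(2) y] k(1) by simp
        moreover have "?d \<le> 1 / real (2*k+c+2) - 1 / real (2*k+c+3)"
        proof -
          have eq: "1 / real (m+2) - 1 / real (m+3) = 1 / (real (m+2) * real (m+3))" for m
            by (simp add: field_simps)
          have "2*k+c \<le> 2*M+c" using k Suc by simp
          then have "real (2*k+c+2) * real (2*k+c+3) \<le> real (2*M+c+2) * real (2*M+c+3)"
            by (intro mult_mono) auto
          then show ?thesis unfolding eq
            by (intro divide_left_mono) (auto intro!: mult_pos_pos)
        qed
        ultimately show "?d \<le> dist x y" by linarith
      qed
      also have "(\<Union>k<N. R (2*k+c)) \<union> R (2*N+c) = (\<Union>k<Suc N. R (2*k+c))"
        by (auto simp: lessThan_Suc)
      finally show ?thesis .
    qed
  qed simp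
  have part': "(\<Sum>k<N. ?\<mu> (R (2*k+c))) \<le> ?\<mu> A" for N c
    using RA by (intro order_trans[OF part] hausdorff1_outer_mono) blast
  have split2: "(\<Sum>k<2*N. f k) = (\<Sum>k<N. f (2*k+0)) + (\<Sum>k<N. f (2*k+1))" for f :: "nat \<Rightarrow> ennreal" and N
    by (induction N) (simp_all add: algebra_simps)
  have sumfin: "(\<Sum>k. ?\<mu> (R k)) \<noteq> top"
  proof -
    have "(\<Sum>k. ?\<mu> (R k)) \<le> ?\<mu> A + ?\<mu> A"
    proof (rule suminf_le_const)
      fix N :: nat
      have "(\<Sum>k<N. ?\<mu> (R k)) \<le> (\<Sum>k<2*N. ?\<mu> (R k))" by (rule sum_mono2) auto
      also have "\<dots> \<le> ?\<mu> A + ?\<mu> A" unfolding split2 by (intro add_mono part')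
      finally show "(\<Sum>k<N. ?\<mu> (R k)) \<le> ?\<mu> A + ?\<mu> A" .
    qed simp
    also have "\<dots> < top" using fin by simp
    finally show ?thesis by simp
  qed
  define T where "T n = (\<Sum>k. ?\<mu> (R (k + n)))" for n
  have T: "T \<longlonglongrightarrow> 0"
  proof -
    have fin': "(\<Sum>k<n. ?\<mu> (R k)) \<noteq> top" for n
      using sumfin sum_le_suminf[of "\<lambda>k. ?\<mu> (R k)" "{..<n}"] by (metis finite_lessThan summableI top_unique zero_le)
    have "T = (\<lambda>n. (\<Sum>k. ?\<mu> (R k)) - (\<Sum>k<n. ?\<mu> (R k)))"
    proof
      show "T n = (\<Sum>k. ?\<mu> (R k)) - (\<Sum>k<n. ?\<mu> (R k))" for n
        using suminf_offset[of "\<lambda>k. ?\<mu> (R k)" n] fin'[of n] by (simp add: T_def)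
    qed
    moreover have "(\<lambda>n. (\<Sum>k. ?\<mu> (R k)) - (\<Sum>k<n. ?\<mu> (R k))) \<longlonglongrightarrow> (\<Sum>k. ?\<mu> (R k)) - (\<Sum>k. ?\<mu> (R k))"
      using sumfin by (intro tendsto_diff_ennreal tendsto_const summable_LIMSEQ) auto
    ultimately show ?thesis using sumfin by simp
  qed
  have AF: "A - F \<subseteq> S n \<union> (\<Union>k. R (k + n))" for n
  proof
    fix x assume x: "x \<in> A - F"
    then have "0 < infdist x F" using F ne infdist_pos_not_in_closed by blast
    then obtain m where "inverse (real (Suc m)) < infdist x F"
      using reals_Archimedean by blast
    then have ex: "\<exists>m. x \<in> S m" using x by (auto simp: S_def inverse_eq_divide intro!: exI[of _ m])
    define m where "m = (LEAST m. x \<in> S m)"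
    have m: "x \<in> S m" unfolding m_def using ex by (rule LeastI_ex)
    have notm: "x \<notin> S k" if "k < m" for k using that not_less_Least unfolding m_def by blast
    have mono: "S i \<subseteq> S j" if "i \<le> j" for i j
    proof
      fix z assume z: "z \<in> S i"
      have "1 / real (Suc j) \<le> 1 / real (Suc i)" using that by (intro divide_left_mono) auto
      with z show "z \<in> S j" by (auto simp: S_def)
    qed
    show "x \<in> S n \<union> (\<Union>k. R (k + n))"
    proof (cases "m \<le> n")
      case True with mono m show ?thesis by blast
    next
      case False
      then have "x \<in> R ((m - 1 - n) + n)" using m notm[of "m - 1"] by (simp add: R_def)
      then show ?thesis by blast
    qed
  qed
  have bound: "?\<mu> (A \<inter> F) + ?\<mu> (A - F) \<le> ?\<mu> A + T n" for n
  proof -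
    have "?\<mu> (A - F) \<le> ?\<mu> (S n) + T n"
      unfolding T_def
      by (rule order_trans[OF hausdorff1_outer_mono[OF AF[of n]]
            order_trans[OF hausdorff1_outer_Un_le add_left_mono[OF hausdorff1_outer_UN_le]]])
    then have "?\<mu> (A \<inter> F) + ?\<mu> (A - F) \<le> (?\<mu> (A \<inter> F) + ?\<mu> (S n)) + T n"
      by (simp add: add.assoc add_left_mono)
    also have "?\<mu> (A \<inter> F) + ?\<mu> (S n) \<le> ?\<mu> (A \<inter> F \<union> S n)"
    proof (rule hausdorff1_outer_separated)
      show "0 < 1 / real (Suc n)" by simp
      fix x y assume "x \<in> A \<inter> F" "y \<in> S n"
      then show "1 / real (Suc n) \<le> dist x y" using infd[of x y] by (auto simp: S_def)
    qed
    also have "\<dots> \<le> ?\<mu> A" by (rule hausdorff1_outer_mono) (auto simp: S_def)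
    finally show ?thesis by (simp add: add_right_mono)
  qed
  have "(\<lambda>n. ?\<mu> A + T n) \<longlonglongrightarrow> ?\<mu> A + 0"
    using T by (intro tendsto_add tendsto_const)
  then show ?thesis
    using bound by (intro LIMSEQ_le_const[of "\<lambda>n. ?\<mu> A + T n"]) auto
qed

lemma sets_hausdorff1 [simp, measurable_cong]: "sets hausdorff1 = sets borel"
  unfolding hausdorff1_def by (simp add: sets.sigma_sets_eq[of borel, simplified])

lemma space_hausdorff1 [simp]: "space hausdorff1 = UNIV"
  unfolding hausdorff1_def by simp

theorem emeasure_hausdorff1:
  fixes A :: "'a::metric_space set"
  assumes "A \<in> sets borel"
  shows "emeasure hausdorff1 A = hausdorff1_outer A"
proof -
  let ?L = "lambda_system UNIV (Pow UNIV) (hausdorff1_outer :: 'a set \<Rightarrow> ennreal)"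
  have oms: "outer_measure_space (Pow UNIV) (hausdorff1_outer :: 'a set \<Rightarrow> ennreal)"
    by (auto simp: outer_measure_space_def positive_def increasing_def countably_subadditive_def
        intro: hausdorff1_outer_mono hausdorff1_outer_UN_le)
  have ms: "measure_space UNIV ?L hausdorff1_outer"
    using sigma_algebra.caratheodory_lemma[OF sigma_algebra_Pow oms] .
  then have sa: "sigma_algebra UNIV ?L" by (simp add: measure_space_def)
  have "F \<in> ?L" if F: "closed F" for F :: "'a set"
  proof -
    have "hausdorff1_outer (A \<inter> F) + hausdorff1_outer (A - F) = hausdorff1_outer A" for A
    proof (rule antisym[OF hausdorff1_outer_closed_split[OF F]])
      have "A = (A \<inter> F) \<union> (A - F)" by blast
      then show "hausdorff1_outer A \<le> hausdorff1_outer (A \<inter> F) + hausdorff1_outer (A - F)"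
        using hausdorff1_outer_Un_le[of "A \<inter> F" "A - F"] by simp
    qed
    then show ?thesis
      unfolding algebra.lambda_system_eq[OF algebra_Pow] by simp
  qed
  then have "sets borel \<subseteq> ?L"
    unfolding borel_eq_closed using sigma_algebra.sigma_sets_subset[OF sa, of "Collect closed"]
    by (auto simp: sets_measure_of_conv)
  then have "measure_space UNIV (sets borel) (hausdorff1_outer :: 'a set \<Rightarrow> ennreal)"
    using measure_down[OF ms] sets.sigma_algebra_axioms[of borel] by simp
  then have "positive (sets borel) (hausdorff1_outer :: 'a set \<Rightarrow> ennreal)"
    and "countably_additive (sets borel) (hausdorff1_outer :: 'a set \<Rightarrow> ennreal)"
    by (auto simp: measure_space_def)
  then show ?thesis
    using assms by (intro emeasure_measure_of[OF hausdorff1_def]) auto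
qed


section \<open>The regions and the semismooth Newton system\<close>

text \<open>
  The points $a_1,\ldots,a_n$ are a function on a finite index type \<open>'n\<close>, so \<open>n = CARD('n)\<close>.
\<close>

definition region :: "('n \<Rightarrow> real^2) \<Rightarrow> (real^2) set \<Rightarrow> real^'n \<Rightarrow> 'n \<Rightarrow> (real^2) set" where
  "region a D \<xi> i = {x \<in> interior D. \<forall>j. j \<noteq> i \<longrightarrow> a i \<bullet> x - \<xi> $ i > a j \<bullet> x - \<xi> $ j}"

definition u_tilde :: "(real^2) measure \<Rightarrow> ('n \<Rightarrow> real^2) \<Rightarrow> (real^2) set \<Rightarrow> real^'n \<Rightarrow> real^'n" where
  "u_tilde u\<^sub>d a D \<xi> = (\<chi> i. measure u\<^sub>d (region a D \<xi> i))"

definition residual ::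
  "real \<Rightarrow> (real^'n \<Rightarrow> real^'n) \<Rightarrow> (real^2) measure \<Rightarrow> ('n \<Rightarrow> real^2) \<Rightarrow> (real^2) set \<Rightarrow>
   real^'n \<Rightarrow> real^'n"
  where
  "residual \<alpha> gradg u\<^sub>d a D \<xi> =
     (\<chi> i. (norm (a i))\<^sup>2 / 2) + (1 / \<alpha>) *\<^sub>R gradg (u_tilde u\<^sub>d a D \<xi>) - \<xi>"

definition common_edge :: "('n \<Rightarrow> real^2) \<Rightarrow> (real^2) set \<Rightarrow> real^'n \<Rightarrow> 'n \<Rightarrow> 'n \<Rightarrow> (real^2) set" where
  "common_edge a D \<xi> i k = closure (region a D \<xi> i) \<inter> closure (region a D \<xi> k)"

definition share_edge :: "('n \<Rightarrow> real^2) \<Rightarrow> (real^2) set \<Rightarrow> real^'n \<Rightarrow> 'n \<Rightarrow> 'n \<Rightarrow> bool" where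
  "share_edge a D \<xi> i k \<longleftrightarrow>
     region a D \<xi> i \<noteq> {} \<and> region a D \<xi> k \<noteq> {} \<and>
     (\<exists>p q. p \<noteq> q \<and> common_edge a D \<xi> i k = closed_segment p q)"

definition edge_weight ::
  "(real^2 \<Rightarrow> real) \<Rightarrow> ('n \<Rightarrow> real^2) \<Rightarrow> (real^2) set \<Rightarrow> real^'n \<Rightarrow> 'n \<Rightarrow> 'n \<Rightarrow> real" where
  "edge_weight \<rho> a D \<xi> i k =
     (if share_edge a D \<xi> i k
      then 1 / norm (a k - a i) * (LINT x:common_edge a D \<xi> i k|hausdorff1. \<rho> x)
      else 0)"

definition Theta ::
  "(real^2) measure \<Rightarrow> (real^2 \<Rightarrow> real) \<Rightarrow> ('n::finite \<Rightarrow> real^2) \<Rightarrow> (real^2) set \<Rightarrow>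
   real^'n \<Rightarrow> real^'n^'n" where
  "Theta u\<^sub>d \<rho> a D \<xi> = (\<chi> i j.
     if measure u\<^sub>d (region a D \<xi> i) > 0
     then if j = i then - (\<Sum>k\<in>UNIV - {i}. edge_weight \<rho> a D \<xi> i k) else edge_weight \<rho> a D \<xi> i j
     else 0)"

definition Dresidual ::
  "real \<Rightarrow> (real^'n \<Rightarrow> real^'n^'n) \<Rightarrow> (real^2) measure \<Rightarrow> (real^2 \<Rightarrow> real) \<Rightarrow>
   ('n::finite \<Rightarrow> real^2) \<Rightarrow> (real^2) set \<Rightarrow> real^'n \<Rightarrow> real^'n^'n" where
  "Dresidual \<alpha> hessg u\<^sub>d \<rho> a D \<xi> =
     (1 / \<alpha>) *\<^sub>R (hessg (u_tilde u\<^sub>d a D \<xi>) ** Theta u\<^sub>d \<rho> a D \<xi>) - mat 1"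

definition twice_cont_differentiable ::
  "(real^'n \<Rightarrow> real) \<Rightarrow> (real^'n \<Rightarrow> real^'n) \<Rightarrow> (real^'n \<Rightarrow> real^'n^'n) \<Rightarrow> bool" where
  "twice_cont_differentiable g gradg hessg \<longleftrightarrow>
     (\<forall>v. GDERIV g v :> gradg v) \<and>
     (\<forall>v. (gradg has_derivative (\<lambda>h. hessg v *v h)) (at v)) \<and>
     continuous_on UNIV hessg"

definition q_superlinear :: "(nat \<Rightarrow> 'a::real_normed_vector) \<Rightarrow> 'a \<Rightarrow> bool" where
  "q_superlinear X l \<longleftrightarrow>
     X \<longlonglongrightarrow> l \<and> (\<lambda>k. norm (X (Suc k) - l)) \<in> o(\<lambda>k. norm (X k - l))"

end

theory Submission
  imports Defs
begin

text \<open>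
  Write \<open>u\<close> for the mass vector \<open>u_tilde\<close>, \<open>\<Theta>\<close> for its proposed derivative and \<open>r\<close> for the residual.
  Newton's method for \<open>r = 0\<close> converges \<open>q\<close>-superlinearly near a zero \<open>z\<close> as soon as two things hold:
  the matrices \<open>Dr(\<xi>)\<close> have uniformly bounded inverses, and \<open>r\<close> is Newton differentiable at \<open>z\<close>,
  that is, \<open>r(\<xi>) - r(z) - Dr(\<xi>)(\<xi> - z) = o(|\<xi> - z|)\<close> with the derivative taken at the moving
  point \<open>\<xi>\<close> (\<open>newton_q_superlinear\<close>).

  Uniform invertibility. \<open>-\<Theta>(\<xi>)\<close> is the Laplacian of a weighted graph with bounded weights, so it is
  positive semidefinite and \<open>|\<Theta>h|\<^sup>2 \<le> c (-\<Theta>h) \<bullet> h\<close> (\<open>laplacian_energy\<close>). The Hessian \<open>H\<close> of the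
  convex function \<open>g\<close> is positive semidefinite. If \<open>y = x + H l / \<alpha>\<close> with \<open>l = -\<Theta>x\<close>, then pairing
  with \<open>l\<close> controls \<open>|l|\<close>, hence \<open>|x|\<close>, by \<open>|y|\<close> (\<open>psd_perturbation_bound\<close>).

  Newton differentiability. By a chain rule for \<open>C\<^sup>1\<close> outer functions
  (\<open>newton_differentiable_compose\<close>) only \<open>u\<close> matters. The plane is cut into parallel lines, in a
  direction that is transversal to every line on which two of the scores \<open>a\<^sub>j \<bullet> p - \<xi>\<^sub>j\<close> agree. A region meets
  each line of the family in an open interval whose endpoints are a maximum and a minimum of finitely
  many affine functions of \<open>\<xi>\<close> (and of constants, from the boundary of \<open>D\<close>). So on each line the mass
  is a piecewise \<open>C\<^sup>1\<close> function of \<open>\<xi>\<close>, and for such a function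
  the Newton estimate holds with the derivative of \<^emph>\<open>any\<close> piece that is active at \<open>\<xi>\<close>: a piece
  active at points converging to \<open>z\<close> is active at \<open>z\<close> too (\<open>slice_semismooth\<close>). No case distinction
  on the combinatorial type of the diagram at \<open>z\<close> arises, however degenerate it is, and the remainders,
  being \<open>O(|\<xi> - z|)\<close> uniformly over the lines, integrate to \<open>o(|\<xi> - z|)\<close> by dominated convergence
  (\<open>u_tilde_newton_differentiable\<close>).

  It remains to see that integrating the derivatives of suitably chosen active pieces over the lines
  gives \<open>\<Theta>(\<xi>)\<close>. One-dimensional Hausdorff measure on a line is Lebesgue measure, so an edge weight is an
  integral over the lines that cross the edge (\<open>edge_weight_slices\<close>). For almost every line, an
  endpoint of its interval inside \<open>D\<close> lies on the edge shared with exactly one other nonempty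
  region: among the scores that tie there, the one that grows fastest beyond the endpoint belongs to
  that region (\<open>exists_neighbour_beyond\<close>, \<open>AE_not_exceptional\<close>).
\<close>

section \<open>Hausdorff measure on a line\<close>

text \<open>
  Upper bound: cut the segment into short pieces of equal length. Lower bound: orthogonal projection to
  the line does not increase diameters, so the projections of any cover lie in intervals covering
  \<open>(l, u)\<close> whose lengths are the diameters of the covering sets.
\<close>

lemma hausdorff1_unit_segment:
  fixes p v :: "'a::real_inner"
  assumes v: "norm v = 1" and lu: "l \<le> u"
  shows "hausdorff1_outer ((\<lambda>t. p + t *\<^sub>R v) ` {l<..<u}) = ennreal (u - l)"
proof (rule antisym)
  let ?\<phi> = "\<lambda>t. p + t *\<^sub>R v"
  have dist: "dist (?\<phi> s) (?\<phi> t) = \<bar>s - t\<bar>" for s t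
    using v by (simp add: dist_norm flip: scaleR_left_diff_distrib)
  show "hausdorff1_outer (?\<phi> ` {l<..<u}) \<le> ennreal (u - l)"
    unfolding hausdorff1_outer_def
  proof (rule SUP_least)
    fix \<delta> :: real assume "\<delta> \<in> {0<..}"
    then have \<delta>: "\<delta> > 0" by simp
    obtain N :: nat where N: "(u - l) / \<delta> < N" using reals_Archimedean2 by blast
    then have N0: "N > 0" using \<delta> lu by (cases N) (auto simp: field_simps)
    define w where "w = (u - l) / N"
    have w: "0 \<le> w" "w \<le> \<delta>" using N N0 \<delta> lu by (auto simp: w_def field_simps)
    \<comment> \<open>a finite cover, padded with empty sets\<close>
    define C where "C n = (if n < N then ?\<phi> ` {l + n * w .. l + (n+1) * w} else {})" for n :: nat
    have bd: "bounded (C n)" for n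
    proof -
      have "compact (?\<phi> ` {l + n * w .. l + (n+1) * w})"
        by (intro compact_continuous_image continuous_intros) auto
      then show ?thesis by (auto simp: C_def compact_imp_bounded)
    qed
    have dm: "diameter (C n) \<le> (if n < N then w else 0)" for n
    proof (cases "n < N")
      case True
      have "diameter (?\<phi> ` {l + n * w .. l + (1+n) * w}) \<le> w"
      proof (rule diameter_le)
        fix x y assume "x \<in> ?\<phi> ` {l + n * w .. l + (1+n) * w}" "y \<in> ?\<phi> ` {l + n * w .. l + (1+n) * w}"
        then obtain s t where *: "x = ?\<phi> s" "y = ?\<phi> t" and "s \<in> {l + n * w .. l + (1+n) * w}" "t \<in> {l + n * w .. l + (1+n) * w}"
          by blast
        then have "\<bar>s - t\<bar> \<le> w" by (simp add: algebra_simps abs_le_iff)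
        then show "norm (x - y) \<le> w" using dist[of s t] unfolding * dist_norm by simp
      qed (use w in auto)
      then show ?thesis unfolding C_def using True by (simp add: add.commute)
    qed (simp add: C_def)
    have "hausdorff1_pre \<delta> (?\<phi> ` {l<..<u}) \<le> (\<Sum>n. ennreal (diameter (C n)))"
    proof (rule hausdorff1_pre_le)
      show "?\<phi> ` {l<..<u} \<subseteq> (\<Union>n. C n)"
      proof clarify
        fix t assume t: "t \<in> {l<..<u}"
        then have wp: "w > 0" using N0 by (simp add: w_def)
        define n where "n = nat \<lfloor>(t - l) / w\<rfloor>"
        have q: "0 \<le> (t - l) / w" using t wp by simp
        then have n: "real n \<le> (t - l) / w" "(t - l) / w < real n + 1" unfolding n_def by linarith+
        have "(t - l) / w < N" using t wp N0 by (simp add: w_def field_simps)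
        with n have nN: "n < N" by linarith
        have "t \<in> {l + n * w .. l + (n+1) * w}" using n wp by (auto simp: field_simps)
        then have "?\<phi> t \<in> C n" unfolding C_def using nN by auto
        then show "?\<phi> t \<in> (\<Union>n. C n)" by blast
      qed
    next
      show "diameter (C n) \<le> \<delta>" for n using dm[of n] w \<delta> by (auto split: if_splits)
    qed (rule bd)
    also have "\<dots> = (\<Sum>n<N. ennreal (diameter (C n)))"
      by (rule suminf_finite) (auto simp: C_def)
    also have "\<dots> \<le> (\<Sum>n<N. ennreal w)"
      using dm by (intro sum_mono ennreal_leI) (metis lessThan_iff)
    also have "\<dots> = ennreal (u - l)"
      using w N0 lu by (simp add: w_def ennreal_of_nat_eq_real_of_nat flip: ennreal_mult)
    finally show "hausdorff1_pre \<delta> (?\<phi> ` {l<..<u}) \<le> ennreal (u - l)" .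
  qed
next
  let ?\<phi> = "\<lambda>t. p + t *\<^sub>R v"
  have vv: "v \<bullet> v = 1" using v by (simp add: dot_square_norm)
  have "ennreal (u - l) \<le> hausdorff1_pre 1 (?\<phi> ` {l<..<u})"
    unfolding hausdorff1_pre_def
  proof (rule INF_greatest, clarify)
    fix C :: "nat \<Rightarrow> 'a set"
    assume cov: "?\<phi> ` {l<..<u} \<subseteq> (\<Union>i. C i)" and C: "\<forall>i. bounded (C i) \<and> diameter (C i) \<le> 1"
    \<comment> \<open>the projection of each covering set fits into an interval as long as its diameter\<close>
    have "\<exists>c. \<forall>x\<in>C n. (x - p) \<bullet> v \<in> {c .. c + diameter (C n)}" for n
    proof (cases "C n = {}")
      case False
      let ?S = "(\<lambda>x. (x - p) \<bullet> v) ` C n"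
      have *: "\<bar>(x - p) \<bullet> v - (y - p) \<bullet> v\<bar> \<le> diameter (C n)" if "x \<in> C n" "y \<in> C n" for x y
      proof -
        have "\<bar>(x - p) \<bullet> v - (y - p) \<bullet> v\<bar> = \<bar>(x - y) \<bullet> v\<bar>" by (simp add: inner_diff_left)
        also have "\<dots> \<le> norm (x - y)" using Cauchy_Schwarz_ineq2[of "x - y" v] v by simp
        also have "\<dots> \<le> diameter (C n)" using diameter_bounded_bound[of "C n" x y] C that by (simp add: dist_norm)
        finally show ?thesis .
      qed
      obtain z where z: "z \<in> C n" using False by blast
      have below: "bdd_below ?S"
      proof (rule bdd_belowI)
        fix s assume "s \<in> ?S"
        then obtain y where "y \<in> C n" "s = (y - p) \<bullet> v" by blast
        then show "(z - p) \<bullet> v - diameter (C n) \<le> s" using *[OF z, of y] by (simp add: abs_le_iff)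
      qed
      have "(x - p) \<bullet> v \<le> Inf ?S + diameter (C n)" if "x \<in> C n" for x
      proof -
        have "(x - p) \<bullet> v - diameter (C n) \<le> Inf ?S"
        proof (rule cInf_greatest)
          show "?S \<noteq> {}" using False by blast
          fix s assume "s \<in> ?S"
          then obtain y where "y \<in> C n" "s = (y - p) \<bullet> v" by blast
          then show "(x - p) \<bullet> v - diameter (C n) \<le> s" using *[OF that, of y] by (simp add: abs_le_iff)
        qed
        then show ?thesis by simp
      qed
      moreover have "Inf ?S \<le> (x - p) \<bullet> v" if "x \<in> C n" for x
        using below that by (intro cInf_lower) auto
      ultimately show ?thesis by (intro exI[of _ "Inf ?S"]) auto
    qed auto
    then obtain c where c: "\<And>n x. x \<in> C n \<Longrightarrow> (x - p) \<bullet> v \<in> {c n .. c n + diameter (C n)}" by metis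
    have "ennreal (u - l) = emeasure lborel {l<..<u}" using lu by simp
    also have "\<dots> \<le> emeasure lborel (\<Union>n. {c n .. c n + diameter (C n)})"
    proof (rule emeasure_mono)
      show "{l<..<u} \<subseteq> (\<Union>n. {c n .. c n + diameter (C n)})"
      proof
        fix t assume "t \<in> {l<..<u}"
        then obtain n where "?\<phi> t \<in> C n" using cov by blast
        from c[OF this] have "t \<in> {c n .. c n + diameter (C n)}" using vv by simp
        then show "t \<in> (\<Union>n. {c n .. c n + diameter (C n)})" by blast
      qed
    qed auto
    also have "\<dots> \<le> (\<Sum>n. emeasure lborel {c n .. c n + diameter (C n)})"
      by (rule emeasure_subadditive_countably) auto
    also have "\<dots> = (\<Sum>n. ennreal (diameter (C n)))"
      using C by (intro suminf_cong) (simp add: diameter_ge_0)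
    finally show "ennreal (u - l) \<le> (\<Sum>n. ennreal (diameter (C n)))" .
  qed
  then show "ennreal (u - l) \<le> hausdorff1_outer (?\<phi> ` {l<..<u})"
    by (rule order_trans) (rule hausdorff1_pre_le_outer, simp)
qed

lemma closed_line: "closed (range (\<lambda>t::real. p + t *\<^sub>R v))" if v: "norm v = 1" for p v :: "'a::real_inner"
proof -
  have vv: "v \<bullet> v = 1" using v by (simp add: dot_square_norm)
  have "range (\<lambda>t. p + t *\<^sub>R v) = (\<lambda>x. x - p - ((x - p) \<bullet> v) *\<^sub>R v) -` {0}" (is "?L = ?R")
  proof (intro equalityI subsetI)
    fix x assume "x \<in> ?R"
    then have "x = p + ((x - p) \<bullet> v) *\<^sub>R v" by (simp add: algebra_simps)
    then show "x \<in> ?L" by (rule range_eqI)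
  qed (use vv in auto)
  then show ?thesis by (auto intro!: continuous_closed_vimage continuous_intros)
qed

text \<open>
  A measure on the reals that gives every open interval its length is Lebesgue measure. This turns
  integrals against Hausdorff measure along a line into ordinary ones.
\<close>

lemma distr_hausdorff1_unit_line:
  fixes p v :: "'a::euclidean_space"
  assumes v: "norm v = 1"
  shows "distr (restrict_space hausdorff1 (range (\<lambda>t. p + t *\<^sub>R v))) borel (\<lambda>x. (x - p) \<bullet> v) = lborel"
proof (rule lborel_eqI[symmetric])
  let ?\<phi> = "\<lambda>t. p + t *\<^sub>R v"
  have vv: "v \<bullet> v = 1" using v by (simp add: dot_square_norm)
  have hom: "?\<phi> ` S = {x \<in> range ?\<phi>. (x - p) \<bullet> v \<in> S}" for S
    using vv by (auto simp: image_iff)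
  have ran: "range ?\<phi> \<in> sets borel" using closed_line[OF v, of p] by auto
  have meas: "(\<lambda>x. (x - p) \<bullet> v) \<in> restrict_space hausdorff1 (range ?\<phi>) \<rightarrow>\<^sub>M borel"
    by (intro measurable_restrict_space1) (simp add: measurable_cong_sets[OF sets_hausdorff1 refl])
  fix l u :: real assume "\<And>b. b \<in> Basis \<Longrightarrow> l \<bullet> b \<le> u \<bullet> b"
  then have lu: "l \<le> u" by simp
  have pre: "(\<lambda>x. (x - p) \<bullet> v) -` box l u \<inter> space (restrict_space hausdorff1 (range ?\<phi>)) = ?\<phi> ` {l<..<u}"
    by (subst hom) (auto simp: space_restrict_space)
  have "emeasure (distr (restrict_space hausdorff1 (range ?\<phi>)) borel (\<lambda>x. (x - p) \<bullet> v)) (box l u)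
      = emeasure (restrict_space hausdorff1 (range ?\<phi>)) (?\<phi> ` {l<..<u})"
    unfolding pre[symmetric] by (rule emeasure_distr[OF meas]) simp
  also have "\<dots> = emeasure hausdorff1 (?\<phi> ` {l<..<u})"
    using ran by (intro emeasure_restrict_space) auto
  also have "\<dots> = hausdorff1_outer (?\<phi> ` {l<..<u})"
  proof (rule emeasure_hausdorff1)
    have "?\<phi> ` {l<..<u} = range ?\<phi> \<inter> (\<lambda>x. (x - p) \<bullet> v) -` {l<..<u}" by (subst hom) auto
    also have "\<dots> \<in> sets borel"
      by (intro sets.Int[OF ran] borel_open open_vimage continuous_intros open_greaterThanLessThan)
    finally show "?\<phi> ` {l<..<u} \<in> sets borel" .
  qed
  also have "\<dots> = (\<Prod>b\<in>Basis. (u - l) \<bullet> b)"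
    using hausdorff1_unit_segment[OF v lu, of p] by simp
  finally show "emeasure (distr (restrict_space hausdorff1 (range ?\<phi>)) borel (\<lambda>x. (x - p) \<bullet> v)) (box l u)
     = (\<Prod>b\<in>Basis. (u - l) \<bullet> b)" .
qed simp

lemma set_integral_hausdorff1_line:
  fixes p w :: "'a::euclidean_space" and f :: "'a \<Rightarrow> real"
  assumes w: "w \<noteq> 0" and S: "S \<subseteq> range (\<lambda>t. p + t *\<^sub>R w)"
    and Sb: "S \<in> sets borel" and f: "f \<in> borel_measurable borel"
  shows "(LINT x:S|hausdorff1. f x) = norm w * (LINT t|lborel. indicator S (p + t *\<^sub>R w) * f (p + t *\<^sub>R w))"
proof -
  define v where "v = w /\<^sub>R norm w"
  have v: "norm v = 1" and wv: "w = norm w *\<^sub>R v" using w by (auto simp: v_def)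
  have vv: "v \<bullet> v = 1" using v by (simp add: dot_square_norm)
  let ?\<phi> = "\<lambda>t. p + t *\<^sub>R v"
  let ?R = "restrict_space hausdorff1 (range ?\<phi>)"
  let ?h = "\<lambda>x. indicator S x * f x"
  have Sr: "S \<subseteq> range ?\<phi>" 
  proof
    fix x assume "x \<in> S"
    then obtain t where "x = p + t *\<^sub>R w" using S by blast
    then have "x = p + (t * norm w) *\<^sub>R v" using wv by (metis scaleR_scaleR)
    then show "x \<in> range ?\<phi>" by blast
  qed
  have ran: "range ?\<phi> \<in> sets borel" using closed_line[OF v, of p] by auto
  have hm: "?h \<in> borel_measurable borel" using Sb f by measurable
  have \<phi>m: "?\<phi> \<in> borel_measurable borel" by measurable
  have gm: "(\<lambda>t. ?h (?\<phi> t)) \<in> borel_measurable borel"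
    using measurable_compose[OF \<phi>m hm] .
  have meas: "(\<lambda>x. (x - p) \<bullet> v) \<in> ?R \<rightarrow>\<^sub>M borel"
    by (intro measurable_restrict_space1) (simp add: measurable_cong_sets[OF sets_hausdorff1 refl])
  have "(LINT x:S|hausdorff1. f x) = (LINT x|hausdorff1. indicator (range ?\<phi>) x *\<^sub>R ?h x)"
    unfolding set_lebesgue_integral_def using Sr
    by (intro Bochner_Integration.integral_cong) (auto simp: indicator_def)
  also have "\<dots> = integral\<^sup>L ?R ?h"
    using ran by (subst integral_restrict_space) auto
  also have "\<dots> = integral\<^sup>L ?R (\<lambda>x. ?h (?\<phi> ((x - p) \<bullet> v)))"
    using vv by (intro Bochner_Integration.integral_cong) (auto simp: space_restrict_space)
  also have "\<dots> = integral\<^sup>L (distr ?R borel (\<lambda>x. (x - p) \<bullet> v)) (\<lambda>t. ?h (?\<phi> t))"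
    using meas gm by (subst integral_distr) auto
  also have "\<dots> = (LINT t|lborel. ?h (?\<phi> t))"
    unfolding distr_hausdorff1_unit_line[OF v] ..
  also have "\<dots> = norm w * (LINT t|lborel. ?h (?\<phi> (norm w * t)))"
    using lborel_integral_real_affine[of "norm w" "\<lambda>t. ?h (?\<phi> t)" 0] w by simp
  also have "(\<lambda>t. ?h (?\<phi> (norm w * t))) = (\<lambda>t. ?h (p + t *\<^sub>R w))"
  proof
    fix t
    have "(norm w * t) *\<^sub>R v = t *\<^sub>R (norm w *\<^sub>R v)" by simp
    also have "\<dots> = t *\<^sub>R w" using wv by simp
    finally show "?h (?\<phi> (norm w * t)) = ?h (p + t *\<^sub>R w)" by simp
  qed
  finally show ?thesis .
qed

section \<open>Fubini along sheared slices\<close>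

text \<open>
  The shear \<open>(x, y) \<mapsto> (x + m y, y)\<close> has determinant one. Its fibres over fixed \<open>x\<close>, called slices
  below, are the lines with direction \<open>(m, 1)\<close>.
\<close>

definition pt :: "real \<Rightarrow> real \<Rightarrow> real \<Rightarrow> real^2" where
  "pt m x y = vector [x + m * y, y]"

lemma pt_nth [simp]: "pt m x y $ 1 = x + m * y" "pt m x y $ 2 = y"
  by (auto simp: pt_def)

lemma continuous_on_pt [continuous_intros]:
  "continuous_on S f \<Longrightarrow> continuous_on S g \<Longrightarrow> continuous_on S (\<lambda>z. pt m (f z) (g z))"
proof -
  have "pt m x y = x *\<^sub>R axis 1 1 + y *\<^sub>R (axis 2 1 + m *\<^sub>R axis 1 1)" for x y
    by (simp add: vec_eq_iff forall_2 axis_def)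
  then show "continuous_on S f \<Longrightarrow> continuous_on S g \<Longrightarrow> continuous_on S (\<lambda>z. pt m (f z) (g z))"
    by (auto intro!: continuous_intros)
qed

text \<open>
  For fixed \<open>y\<close> the shear is a translation in \<open>x\<close>, so it does not change the measure of a rectangle.
\<close>

lemma distr_shear_lborel:
  "distr (lborel \<Otimes>\<^sub>M lborel) borel (\<lambda>(x, y). pt m x y) = (lborel :: (real^2) measure)"
proof (rule lborel_eqI[symmetric])
  have meas: "(\<lambda>(x, y). pt m x y) \<in> borel_measurable (borel :: (real \<times> real) measure)"
    unfolding case_prod_unfold by (intro borel_measurable_continuous_onI continuous_intros)
  then have meas': "(\<lambda>(x, y). pt m x y) \<in> (lborel \<Otimes>\<^sub>M lborel) \<rightarrow>\<^sub>M (borel :: (real^2) measure)"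
    by (simp add: lborel_prod)
  fix l u :: "real^2" assume "\<And>b. b \<in> Basis \<Longrightarrow> l \<bullet> b \<le> u \<bullet> b"
  from this[of "axis i 1" for i] have lu: "l $ i \<le> u $ i" for i
    by (simp add: axis_in_Basis_iff inner_axis)
  let ?B = "(\<lambda>(x, y). pt m x y) -` box l u"
  have "emeasure (distr (lborel \<Otimes>\<^sub>M lborel) borel (\<lambda>(x, y). pt m x y)) (box l u)
      = emeasure (lborel \<Otimes>\<^sub>M lborel) ?B"
    using meas' by (subst emeasure_distr) (auto simp: space_pair_measure)
  also have "\<dots> = (\<integral>\<^sup>+ y. emeasure lborel ((\<lambda>x. (x, y)) -` ?B) \<partial>lborel)"
  proof (rule lborel_pair.emeasure_pair_measure_alt2)
    show "?B \<in> sets (lborel \<Otimes>\<^sub>M lborel)"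
      using measurable_sets[OF meas', of "box l u"] by (simp add: space_pair_measure)
  qed
  also have "\<dots> = (\<integral>\<^sup>+ y. ennreal (u$1 - l$1) * indicator {l$2<..<u$2} y \<partial>lborel)"
  proof (rule nn_integral_cong)
    fix y
    have "(\<lambda>x. (x, y)) -` ?B = (if y \<in> {l$2<..<u$2} then {l$1 - m*y <..< u$1 - m*y} else {})"
      by (auto simp: mem_box_cart forall_2)
    then show "emeasure lborel ((\<lambda>x. (x, y)) -` ?B) = ennreal (u$1 - l$1) * indicator {l$2<..<u$2} y"
      using lu[of 1] by simp
  qed
  also have "\<dots> = ennreal ((u$1 - l$1) * (u$2 - l$2))"
    using lu[of 1] lu[of 2] by (simp add: nn_integral_cmult ennreal_mult)
  also have "(u$1 - l$1) * (u$2 - l$2) = (\<Prod>b\<in>Basis. (u - l) \<bullet> b)"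
  proof -
    have "(\<Prod>b\<in>Basis. (u - l) \<bullet> b) = (\<Prod>i\<in>UNIV. (u - l) $ i)"
      by (simp add: Basis_vec_def UNION_singleton_eq_range prod.reindex axis_eq_axis inj_on_def inner_axis)
    then show ?thesis by (simp add: UNIV_2)
  qed
  finally show "emeasure (distr (lborel \<Otimes>\<^sub>M lborel) borel (\<lambda>(x, y). pt m x y)) (box l u)
    = (\<Prod>b\<in>Basis. (u - l) \<bullet> b)" by simp
qed simp

lemma integral_slices:
  fixes f :: "real^2 \<Rightarrow> real"
  assumes f: "integrable lborel f"
  shows "integrable lborel (\<lambda>x. LINT y|lborel. f (pt m x y))"
    and "(LINT x|lborel. LINT y|lborel. f (pt m x y)) = integral\<^sup>L lborel f"
proof -
  have "(\<lambda>(x, y). pt m x y) \<in> borel_measurable (borel :: (real \<times> real) measure)"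
    unfolding case_prod_unfold by (intro borel_measurable_continuous_onI continuous_intros)
  then have meas': "(\<lambda>(x, y). pt m x y) \<in> (lborel \<Otimes>\<^sub>M lborel) \<rightarrow>\<^sub>M (borel :: (real^2) measure)"
    by (simp add: lborel_prod)
  have "integrable (distr (lborel \<Otimes>\<^sub>M lborel) borel (\<lambda>(x, y). pt m x y)) f"
    using f by (simp add: distr_shear_lborel)
  then have *: "integrable (lborel \<Otimes>\<^sub>M lborel) (\<lambda>z. f (pt m (fst z) (snd z)))"
    using integrable_distr[OF meas'] by (auto simp: case_prod_unfold)
  show "integrable lborel (\<lambda>x. LINT y|lborel. f (pt m x y))"
    using lborel_pair.integrable_fst'[OF *] by simp
  have "(LINT x|lborel. LINT y|lborel. f (pt m x y)) = (LINT z|(lborel \<Otimes>\<^sub>M lborel). f (pt m (fst z) (snd z)))"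
    using lborel_pair.integral_fst'[OF *] by simp
  also have "\<dots> = integral\<^sup>L (distr (lborel \<Otimes>\<^sub>M lborel) borel (\<lambda>(x, y). pt m x y)) f"
    using f by (subst integral_distr[OF meas']) (auto simp: case_prod_unfold)
  finally show "(LINT x|lborel. LINT y|lborel. f (pt m x y)) = integral\<^sup>L lborel f"
    by (simp add: distr_shear_lborel)
qed

text \<open>
  The direction \<open>(m, 1)\<close> is to be transversal to every line \<open>a i \<bullet> p - a k \<bullet> p = const\<close>. Each pair of
  distinct points forbids at most one value of \<open>m\<close>.
\<close>

lemma ex_distinct_slopes:
  fixes a :: "'n::finite \<Rightarrow> real^2"
  assumes "inj a"
  obtains m :: real where "inj (\<lambda>j. m * a j $ 1 + a j $ 2)"
proof -
  let ?bad = "(\<lambda>(i, k). (a k $ 2 - a i $ 2) / (a i $ 1 - a k $ 1)) ` UNIV"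
  have "finite ?bad" by simp
  then obtain m where m: "m \<notin> ?bad" using ex_new_if_finite infinite_UNIV_char_0 by blast
  have "i = k" if "m * a i $ 1 + a i $ 2 = m * a k $ 1 + a k $ 2" for i k
  proof -
    have eq: "m * (a i $ 1 - a k $ 1) = a k $ 2 - a i $ 2" using that by (simp add: algebra_simps)
    have "a i $ 1 = a k $ 1"
    proof (rule ccontr)
      assume "a i $ 1 \<noteq> a k $ 1"
      then have "m = (a k $ 2 - a i $ 2) / (a i $ 1 - a k $ 1)" using eq by (simp add: field_simps)
      with m show False by force
    qed
    then have "a i = a k" using eq by (simp add: vec_eq_iff forall_2)
    with assms show ?thesis by (simp add: inj_eq)
  qed
  then show thesis by (intro that[of m] injI)
qed

section \<open>Newton's method for a Newton-differentiable equation\<close>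

text \<open>
  With \<open>e = z - zb\<close>, the next error is \<open>- (Dr z)\<^sup>-\<^sup>1 (r z - r zb - Dr z e)\<close>, so it is \<open>o(|e|)\<close>. Near \<open>zb\<close>
  the errors therefore at least halve, and the iteration never leaves the neighbourhood.
\<close>

lemma newton_q_superlinear:
  fixes r :: "real^'n \<Rightarrow> real^'n" and Dr :: "real^'n \<Rightarrow> real^'n^'n"
  assumes r0: "r zb = 0"
    and bound: "\<And>z x. norm x \<le> C * norm (Dr z *v x)"
    and semi: "((\<lambda>z. norm (r z - r zb - Dr z *v (z - zb)) / norm (z - zb)) \<longlongrightarrow> 0) (at zb)"
  shows "\<exists>\<delta>>0. \<forall>\<xi>. norm (\<xi> 0 - zb) \<le> \<delta> \<longrightarrow> (\<forall>k. \<xi> (Suc k) = \<xi> k - matrix_inv (Dr (\<xi> k)) *v r (\<xi> k)) \<longrightarrow>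
    (\<forall>k. invertible (Dr (\<xi> k))) \<and> q_superlinear \<xi> zb"
proof -
  have inv: "invertible (Dr z)" for z
  proof -
    have "x = 0" if "Dr z *v x = 0" for x using bound[of x z] that by simp
    then show ?thesis
      unfolding invertible_left_inverse matrix_left_invertible_ker by blast
  qed
  define C' where "C' = max C 1"
  have C': "C' > 0" "C \<le> C'" by (auto simp: C'_def)
  have step: "norm (z - matrix_inv (Dr z) *v r z - zb) \<le> C' * norm (r z - r zb - Dr z *v (z - zb))" for z
  proof -
    let ?x = "z - matrix_inv (Dr z) *v r z - zb"
    have "Dr z ** matrix_inv (Dr z) = mat 1" using inv[of z] 
      unfolding invertible_def matrix_inv_def by (rule someI2_ex) blast
    then have "Dr z *v ?x = Dr z *v (z - zb) - r z"
      by (simp add: matrix_vector_mult_diff_distrib matrix_vector_mul_assoc)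
    then have "norm (Dr z *v ?x) = norm (r z - r zb - Dr z *v (z - zb))"
      using r0 by (simp add: norm_minus_commute)
    with bound[of ?x z] have "norm ?x \<le> C * norm (r z - r zb - Dr z *v (z - zb))" by simp
    also have "\<dots> \<le> C' * norm (r z - r zb - Dr z *v (z - zb))" using C' by (intro mult_right_mono) auto
    finally show ?thesis .
  qed
  have small: "\<exists>d>0. \<forall>z. norm (z - zb) \<le> d \<longrightarrow>
      norm (z - matrix_inv (Dr z) *v r z - zb) \<le> e * norm (z - zb)" if e: "e > 0" for e
  proof -
    have "e / C' > 0" using e C' by simp
    from tendstoD[OF semi this]
    obtain d where d: "d > 0" and *: "\<And>z. z \<noteq> zb \<Longrightarrow> dist z zb < d \<Longrightarrow>
        norm (r z - r zb - Dr z *v (z - zb)) / norm (z - zb) < e / C'"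
      unfolding eventually_at by (auto simp: dist_norm)
    have "norm (z - matrix_inv (Dr z) *v r z - zb) \<le> e * norm (z - zb)" if z: "norm (z - zb) \<le> d / 2" for z
    proof (cases "z = zb")
      case True then show ?thesis using r0 by simp
    next
      case False
      then have "norm (r z - r zb - Dr z *v (z - zb)) / norm (z - zb) < e / C'"
        using z d by (intro *) (auto simp: dist_norm)
      then have "C' * norm (r z - r zb - Dr z *v (z - zb)) \<le> e * norm (z - zb)"
        using False C' by (simp add: field_simps)
      with step[of z] show ?thesis by linarith
    qed
    then show ?thesis using d by (intro exI[of _ "d/2"]) auto
  qed
  obtain \<delta> where \<delta>: "\<delta> > 0" and half: "\<And>z. norm (z - zb) \<le> \<delta> \<Longrightarrow>
      norm (z - matrix_inv (Dr z) *v r z - zb) \<le> 1/2 * norm (z - zb)"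
    using small[of "1/2"] by auto
  show ?thesis
  proof (intro exI[of _ \<delta>] conjI allI impI \<delta> inv)
    fix \<xi> :: "nat \<Rightarrow> real^'n"
    assume start: "norm (\<xi> 0 - zb) \<le> \<delta>" and it: "\<forall>k. \<xi> (Suc k) = \<xi> k - matrix_inv (Dr (\<xi> k)) *v r (\<xi> k)"
    have geo: "norm (\<xi> k - zb) \<le> \<delta> * (1/2)^k" for k
    proof (induction k)
      case (Suc k)
      have "(1/2::real)^k \<le> 1" by (rule power_le_one) auto
      then have "\<delta> * (1/2)^k \<le> \<delta>" using \<delta> by (simp add: mult_left_le)
      then have "norm (\<xi> (Suc k) - zb) \<le> 1/2 * norm (\<xi> k - zb)"
        using half[of "\<xi> k"] Suc it by simp
      with Suc show ?case by simp
    qed (use start in simp)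
    have "(\<lambda>k. \<delta> * (1/2)^k) \<longlonglongrightarrow> \<delta> * 0" by (intro tendsto_intros LIMSEQ_realpow_zero) auto
    then have "(\<lambda>k. norm (\<xi> k - zb)) \<longlonglongrightarrow> 0"
      by (intro tendsto_sandwich[of "\<lambda>_. 0" "\<lambda>k. norm (\<xi> k - zb)" sequentially "\<lambda>k. \<delta> * (1/2)^k"]
          always_eventually allI geo) auto
    then have lim: "\<xi> \<longlonglongrightarrow> zb" by (simp add: tendsto_norm_zero_iff LIM_zero_iff)
    have "(\<lambda>k. norm (\<xi> (Suc k) - zb)) \<in> o(\<lambda>k. norm (\<xi> k - zb))"
    proof (rule landau_o.smallI)
      fix e :: real assume "e > 0"
      from small[OF this] obtain d where d: "d > 0" and *: "\<And>z. norm (z - zb) \<le> d \<Longrightarrow>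
        norm (z - matrix_inv (Dr z) *v r z - zb) \<le> e * norm (z - zb)" by blast
      have "\<forall>\<^sub>F k in sequentially. dist (\<xi> k) zb < d" using tendstoD[OF lim d] .
      then show "\<forall>\<^sub>F k in sequentially. norm (norm (\<xi> (Suc k) - zb)) \<le> e * norm (norm (\<xi> k - zb))"
        by eventually_elim (use * it in \<open>auto simp: dist_norm\<close>)
    qed
    with lim show "q_superlinear \<xi> zb" by (simp add: q_superlinear_def)
  qed
qed

lemma norm_matrix_vector_mult_le:
  fixes A :: "real^'n^'m"
  shows "norm (A *v x) \<le> CARD('m) * norm A * norm x"
proof -
  have "norm (A *v x) \<le> (\<Sum>i\<in>UNIV. \<bar>(A *v x) $ i\<bar>)" by (rule norm_le_l1_cart)
  also have "\<dots> \<le> (\<Sum>i\<in>(UNIV::'m set). norm A * norm x)"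
  proof (rule sum_mono)
    fix i
    have "\<bar>(A *v x) $ i\<bar> \<le> norm (A $ i) * norm x"
      unfolding matrix_vector_mul_component by (rule Cauchy_Schwarz_ineq2)
    also have "\<dots> \<le> norm A * norm x"
      by (intro mult_right_mono Finite_Cartesian_Product.norm_nth_le) auto
    finally show "\<bar>(A *v x) $ i\<bar> \<le> norm A * norm x" .
  qed
  finally show ?thesis by simp
qed

text \<open>
  For a \<open>C\<^sup>1\<close> map the derivative at the base point may be replaced by the one at the moving point, since
  both differ by \<open>o(1)\<close>.
\<close>

lemma C1_newton_differentiable:
  fixes G :: "real^'n \<Rightarrow> real^'n" and H :: "real^'n \<Rightarrow> real^'n^'n"
  assumes G: "\<And>v. (G has_derivative (\<lambda>h. H v *v h)) (at v)" and H: "continuous_on UNIV H" and e: "0 < e"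
  shows "\<exists>d>0. \<forall>v. norm (v - w) < d \<longrightarrow> norm (G v - G w - H v *v (v - w)) \<le> e * norm (v - w)"
proof -
  let ?N = "real CARD('n)"
  obtain d1 where d1: "d1 > 0" "\<And>v. norm (v - w) < d1 \<Longrightarrow> norm (G v - G w - H w *v (v - w)) \<le> e/2 * norm (v - w)"
    using G[of w] e unfolding has_derivative_at_alt by (meson half_gt_zero)
  have "isCont H w" using H by (simp add: continuous_on_eq_continuous_at)
  moreover have "e / (2 * ?N) > 0" using e by simp
  ultimately obtain d2 where d2: "d2 > 0" "\<And>v. dist v w < d2 \<Longrightarrow> dist (H v) (H w) < e / (2 * ?N)"
    unfolding continuous_at_eps_delta by meson
  have "norm (G v - G w - H v *v (v - w)) \<le> e * norm (v - w)" if v: "norm (v - w) < min d1 d2" for v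
  proof -
    have "norm (G v - G w - H v *v (v - w)) = norm ((G v - G w - H w *v (v - w)) - (H v - H w) *v (v - w))"
      by (simp add: matrix_vector_mult_diff_rdistrib algebra_simps)
    also have "\<dots> \<le> norm (G v - G w - H w *v (v - w)) + norm ((H v - H w) *v (v - w))" by (rule norm_triangle_ineq4)
    also have "norm ((H v - H w) *v (v - w)) \<le> ?N * norm (H v - H w) * norm (v - w)" by (rule norm_matrix_vector_mult_le)
    also have "\<dots> \<le> ?N * (e / (2 * ?N)) * norm (v - w)"
      using d2(2)[of v] v by (intro mult_right_mono mult_left_mono) (auto simp: dist_norm)
    also have "?N * (e / (2 * ?N)) = e / 2" by simp
    finally show ?thesis using d1(2)[of v] v by simp
  qed
  with d1(1) d2(1) show ?thesis by (intro exI[of _ "min d1 d2"]) auto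
qed

text \<open>
  Chain rule: the remainder splits into that of \<open>G\<close>, which is \<open>o(|U x - U z|) = o(|x - z|)\<close>, and the
  image of the remainder of \<open>U\<close> under the locally bounded matrices \<open>H (U x)\<close>.
\<close>

lemma newton_differentiable_compose:
  fixes G U :: "real^'n \<Rightarrow> real^'n" and H T :: "real^'n \<Rightarrow> real^'n^'n"
  assumes G: "\<And>v. (G has_derivative (\<lambda>h. H v *v h)) (at v)" and H: "continuous_on UNIV H"
    and U: "\<And>x. norm (U x - U z) \<le> C * norm (x - z)"
    and T: "((\<lambda>x. norm (U x - U z - T x *v (x - z)) / norm (x - z)) \<longlongrightarrow> 0) (at z)"
  shows "((\<lambda>x. norm (G (U x) - G (U z) - (H (U x) ** T x) *v (x - z)) / norm (x - z)) \<longlongrightarrow> 0) (at z)"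
proof -
  let ?N = "real CARD('n)"
  define e where "e v = norm (G v - G (U z) - H v *v (v - U z))" for v
  define C' where "C' = max C 1"
  have C': "C' > 0" "norm (U x - U z) \<le> C' * norm (x - z)" for x
  proof -
    show "C' > 0" by (simp add: C'_def)
    have "C * norm (x - z) \<le> C' * norm (x - z)" by (rule mult_right_mono) (auto simp: C'_def)
    with U show "norm (U x - U z) \<le> C' * norm (x - z)" by (rule order_trans)
  qed
  have contU: "(U \<longlongrightarrow> U z) (at z)"
  proof (rule LIM_zero_cancel, rule Lim_null_comparison)
    show "\<forall>\<^sub>F x in at z. norm (U x - U z) \<le> C' * norm (x - z)" using C'(2) by (intro always_eventually) auto
    have "((\<lambda>x. C' * norm (x - z)) \<longlongrightarrow> C' * norm (z - z)) (at z)" by (intro tendsto_intros)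
    then show "((\<lambda>x. C' * norm (x - z)) \<longlongrightarrow> 0) (at z)" by simp
  qed
  have "isCont H (U z)" using H by (simp add: continuous_on_eq_continuous_at)
  then have contH: "((\<lambda>x. H (U x)) \<longlongrightarrow> H (U z)) (at z)" using contU by (rule isCont_tendsto_compose)
  have first: "((\<lambda>x. e (U x) / norm (x - z)) \<longlongrightarrow> 0) (at z)"
  proof (rule tendstoI)
    fix \<epsilon> :: real assume \<epsilon>: "\<epsilon> > 0"
    then have "\<epsilon> / (2 * C') > 0" using C' by simp
    from C1_newton_differentiable[OF G H this, of "U z"]
    obtain d where d: "d > 0" "\<And>v. norm (v - U z) < d \<Longrightarrow> e v \<le> \<epsilon> / (2 * C') * norm (v - U z)"
      unfolding e_def by blast
    show "\<forall>\<^sub>F x in at z. dist (e (U x) / norm (x - z)) 0 < \<epsilon>"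
      using tendstoD[OF contU d(1)] eventually_neq_at_within[of z z UNIV]
    proof eventually_elim
      case (elim x)
      have "e (U x) \<le> \<epsilon> / (2 * C') * norm (U x - U z)" using elim d(2) by (simp add: dist_norm)
      also have "\<dots> \<le> \<epsilon> / (2 * C') * (C' * norm (x - z))" using C' \<epsilon> by (intro mult_left_mono) auto
      also have "\<dots> = \<epsilon> / 2 * norm (x - z)" using C' by simp
      finally have "e (U x) / norm (x - z) \<le> \<epsilon> / 2" using elim by (simp add: divide_le_eq)
      moreover have "0 \<le> e (U x) / norm (x - z)" by (simp add: e_def)
      ultimately show ?case using \<epsilon> unfolding dist_real_def by linarith
    qed
  qed
  let ?s = "\<lambda>x. norm (U x - U z - T x *v (x - z)) / norm (x - z)"
  have "((\<lambda>x. e (U x) / norm (x - z) + ?N * norm (H (U x)) * ?s x) \<longlongrightarrow> 0 + ?N * norm (H (U z)) * 0) (at z)"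
    by (intro tendsto_intros first contH T)
  then have lim: "((\<lambda>x. e (U x) / norm (x - z) + ?N * norm (H (U x)) * ?s x) \<longlongrightarrow> 0) (at z)" by simp
  show ?thesis
  proof (rule Lim_null_comparison[OF always_eventually lim], rule allI)
    fix x
    have "G (U x) - G (U z) - (H (U x) ** T x) *v (x - z)
        = (G (U x) - G (U z) - H (U x) *v (U x - U z)) + H (U x) *v (U x - U z - T x *v (x - z))"
      by (simp add: matrix_vector_mult_diff_distrib matrix_vector_mul_assoc)
    then have "norm (G (U x) - G (U z) - (H (U x) ** T x) *v (x - z))
        \<le> e (U x) + norm (H (U x) *v (U x - U z - T x *v (x - z)))"
      unfolding e_def by (metis norm_triangle_ineq)
    also have "\<dots> \<le> e (U x) + ?N * norm (H (U x)) * norm (U x - U z - T x *v (x - z))"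
      using norm_matrix_vector_mult_le by (rule add_left_mono)
    finally have "norm (G (U x) - G (U z) - (H (U x) ** T x) *v (x - z)) / norm (x - z)
        \<le> (e (U x) + ?N * norm (H (U x)) * norm (U x - U z - T x *v (x - z))) / norm (x - z)"
      by (rule divide_right_mono) simp
    then show "norm (norm (G (U x) - G (U z) - (H (U x) ** T x) *v (x - z)) / norm (x - z))
        \<le> e (U x) / norm (x - z) + ?N * norm (H (U x)) * ?s x"
      by (simp add: add_divide_distrib)
  qed
qed

section \<open>Hessians, graph Laplacians and uniform invertibility\<close>

text \<open>
  A convex function lies above its tangents, hence its gradient is monotone; differentiating the
  monotonicity along a ray gives the sign of the Hessian.
\<close>

lemma convex_imp_Hessian_nonneg:
  fixes g :: "real^'n \<Rightarrow> real"
  assumes g: "twice_cont_differentiable g gradg hessg" and cv: "convex_on UNIV g"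
  shows "0 \<le> v \<bullet> (hessg z *v v)"
proof -
  have D: "(g has_derivative (\<lambda>h. h \<bullet> gradg x)) (at x)" for x
    using g by (auto simp: twice_cont_differentiable_def gderiv_def)
  have D2: "(gradg has_derivative (\<lambda>h. hessg z *v h)) (at z)"
    using g by (auto simp: twice_cont_differentiable_def)
  have tangent: "g y - g x \<ge> (y - x) \<bullet> gradg x" for x y
  proof -
    let ?\<phi> = "\<lambda>t. g (x + t *\<^sub>R (y - x))"
    have "((\<lambda>t. x + t *\<^sub>R (y - x)) has_derivative (\<lambda>t. t *\<^sub>R (y - x))) (at 0)"
      by (auto intro!: derivative_eq_intros)
    from has_derivative_compose[OF this, of g "\<lambda>h. h \<bullet> gradg x"] D[of x]
    have "(?\<phi> has_derivative (\<lambda>t. t * ((y - x) \<bullet> gradg x))) (at 0)" by simp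
    then have d: "(?\<phi> has_field_derivative ((y - x) \<bullet> gradg x)) (at 0 within UNIV)"
      by (simp add: has_field_derivative_def mult_commute_abs)
    have "convex_on UNIV ?\<phi>"
    proof (rule convex_onI)
      fix t a b :: real assume "0 < t" "t < 1"
      then have "g ((1 - t) *\<^sub>R (x + a *\<^sub>R (y - x)) + t *\<^sub>R (x + b *\<^sub>R (y - x))) \<le> (1 - t) * ?\<phi> a + t * ?\<phi> b"
        by (intro convex_onD[OF cv]) auto
      then show "?\<phi> ((1 - t) *\<^sub>R a + t *\<^sub>R b) \<le> (1 - t) * ?\<phi> a + t * ?\<phi> b"
        by (simp add: algebra_simps)
    qed auto
    from convex_on_imp_above_tangent[OF this _ _ _ d, of 1] show ?thesis by simp
  qed
  have mono: "0 \<le> (t *\<^sub>R v) \<bullet> (gradg (z + t *\<^sub>R v) - gradg z)" for t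
    using tangent[of z "z + t *\<^sub>R v"] tangent[of "z + t *\<^sub>R v" z] by (simp add: inner_diff_right)
  have "((\<lambda>t. z + t *\<^sub>R v) has_derivative (\<lambda>t. t *\<^sub>R v)) (at 0)"
    by (auto intro!: derivative_eq_intros)
  from has_derivative_compose[OF this, of gradg "\<lambda>h. hessg z *v h"] D2
  have "((\<lambda>t. gradg (z + t *\<^sub>R v)) has_derivative (\<lambda>t. hessg z *v (t *\<^sub>R v))) (at 0)" by simp
  then have "((\<lambda>t. v \<bullet> gradg (z + t *\<^sub>R v)) has_derivative (\<lambda>t. v \<bullet> (hessg z *v (t *\<^sub>R v)))) (at 0)"
    by (intro has_derivative_inner_right)
  then have "((\<lambda>t. v \<bullet> gradg (z + t *\<^sub>R v)) has_field_derivative (v \<bullet> (hessg z *v v))) (at 0)"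
    by (simp add: has_field_derivative_def matrix_vector_mult_scaleR mult_commute_abs)
  then have lim: "((\<lambda>t. (v \<bullet> gradg (z + t *\<^sub>R v) - v \<bullet> gradg z) / t) \<longlongrightarrow> v \<bullet> (hessg z *v v)) (at_right 0)"
    by (auto simp: has_field_derivative_iff intro: tendsto_mono[OF at_le])
  show ?thesis
  proof (rule tendsto_lowerbound[OF lim])
    show "\<forall>\<^sub>F t in at_right 0. 0 \<le> (v \<bullet> gradg (z + t *\<^sub>R v) - v \<bullet> gradg z) / t"
      unfolding eventually_at_filter
    proof (intro always_eventually allI impI)
      fix t :: real assume "t \<noteq> 0" "t \<in> {0<..}"
      then show "0 \<le> (v \<bullet> gradg (z + t *\<^sub>R v) - v \<bullet> gradg z) / t"
        using mono[of t] by (simp add: inner_diff_right zero_le_mult_iff)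
    qed
  qed auto
qed

text \<open>
  The pairing \<open>L \<bullet> z\<close> is the Dirichlet energy \<open>\<Sum> w i k (z i - z k)\<^sup>2 / 2\<close>, and by Cauchy-Schwarz the square of
  each component of \<open>L\<close> is bounded by a multiple of the energy as well.
\<close>

lemma laplacian_energy:
  fixes w :: "'n::finite \<Rightarrow> 'n \<Rightarrow> real" and z :: "real^'n" and K :: real
  assumes sym: "\<And>i k. w i k = w k i" and w: "\<And>i k. 0 \<le> w i k" "\<And>i k. w i k \<le> K"
  defines "L \<equiv> (\<chi> i. \<Sum>k\<in>UNIV. w i k * (z$i - z$k))"
  shows "(norm L)\<^sup>2 \<le> 2 * (CARD('n) * K) * (L \<bullet> z)"
proof -
  let ?E = "\<Sum>i\<in>UNIV. \<Sum>k\<in>UNIV. w i k * (z$i - z$k)\<^sup>2"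
  have "L \<bullet> z = (\<Sum>i\<in>UNIV. \<Sum>k\<in>UNIV. w i k * (z$i - z$k) * z$i)"
    by (simp add: L_def inner_vec_def sum_distrib_right)
  moreover have "(\<Sum>i\<in>UNIV. \<Sum>k\<in>UNIV. w i k * (z$i - z$k) * z$i) = (\<Sum>i\<in>UNIV. \<Sum>k\<in>UNIV. w k i * (z$k - z$i) * z$k)"
    by (rule sum.swap)
  ultimately have "2 * (L \<bullet> z) = (\<Sum>i\<in>UNIV. \<Sum>k\<in>UNIV. w i k * (z$i - z$k) * z$i) + (\<Sum>i\<in>UNIV. \<Sum>k\<in>UNIV. w k i * (z$k - z$i) * z$k)"
    by simp
  also have "\<dots> = ?E"
    unfolding sum.distrib[symmetric]
  proof (intro sum.cong refl)
    fix i k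
    show "w i k * (z$i - z$k) * z$i + w k i * (z$k - z$i) * z$k = w i k * (z$i - z$k)\<^sup>2"
      unfolding sym[of k i] by (simp add: power2_eq_square algebra_simps)
  qed
  finally have E: "2 * (L \<bullet> z) = ?E" .
  have "(norm L)\<^sup>2 = (\<Sum>i\<in>UNIV. (L$i)\<^sup>2)"
    unfolding power2_norm_eq_inner inner_vec_def by (simp add: power2_eq_square)
  also have "\<dots> \<le> (\<Sum>i\<in>UNIV. (CARD('n) * K) * (\<Sum>k\<in>UNIV. w i k * (z$i - z$k)\<^sup>2))"
  proof (rule sum_mono)
    fix i
    have "(L$i)\<^sup>2 \<le> (\<Sum>k\<in>(UNIV::'n set). 1\<^sup>2) * (\<Sum>k\<in>UNIV. (w i k * (z$i - z$k))\<^sup>2)"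
      using Cauchy_Schwarz_ineq_sum[of "\<lambda>_. 1" "\<lambda>k. w i k * (z$i - z$k)" UNIV] by (simp add: L_def)
    also have "\<dots> \<le> CARD('n) * (\<Sum>k\<in>UNIV. K * (w i k * (z$i - z$k)\<^sup>2))"
    proof (simp, rule sum_mono)
      fix k
      have "w i k * (w i k * (z$i - z$k)\<^sup>2) \<le> K * (w i k * (z$i - z$k)\<^sup>2)"
        using w by (intro mult_right_mono) auto
      then show "(w i k * (z$i - z$k))\<^sup>2 \<le> K * (w i k * (z$i - z$k)\<^sup>2)"
        by (simp add: power2_eq_square algebra_simps)
    qed
    finally show "(L$i)\<^sup>2 \<le> (CARD('n) * K) * (\<Sum>k\<in>UNIV. w i k * (z$i - z$k)\<^sup>2)"
      by (simp add: sum_distrib_left mult.assoc)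
  qed
  also have "\<dots> = 2 * (CARD('n) * K) * (L \<bullet> z)"
    using E by (simp add: sum_distrib_left[symmetric])
  finally show ?thesis .
qed

text \<open>
  For \<open>x + z = y\<close>, where \<open>l\<close> depends monotonically on \<open>x\<close> and \<open>z\<close> monotonically on \<open>l\<close>: pairing the
  equation with \<open>l\<close> drops the \<open>z\<close>-term and bounds \<open>|l|\<close> by \<open>c |y|\<close>, then \<open>z\<close> and \<open>x = y - z\<close> follow.
  It applies to \<open>x \<mapsto> x + H L x\<close> with \<open>H\<close>, \<open>L\<close> positive semidefinite, although
  the product \<open>H L\<close> itself need not be.
\<close>

lemma psd_perturbation_bound:
  fixes x y l z :: "'a::real_inner"
  assumes y: "y = x + z" and l: "(norm l)\<^sup>2 \<le> c * (l \<bullet> x)" and z: "0 \<le> l \<bullet> z" "norm z \<le> b * norm l"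
    and c: "0 \<le> c" and b: "0 \<le> b"
  shows "norm x \<le> (1 + b * c) * norm y"
proof -
  have "norm l * norm l \<le> c * (l \<bullet> y)"
    using l z c unfolding y by (simp add: power2_eq_square inner_add_right distrib_left add_increasing2)
  also have "\<dots> \<le> c * (norm l * norm y)"
    using c norm_cauchy_schwarz by (intro mult_left_mono) auto
  finally have "norm l \<le> c * norm y"
    by (cases "norm l = 0") (use c in \<open>auto simp: mult.left_commute\<close>)
  then have "norm z \<le> b * (c * norm y)" using z b mult_left_mono order_trans by blast
  moreover have "norm x \<le> norm y + norm z" using norm_triangle_ineq4[of y z] y by simp
  ultimately show ?thesis by (simp add: algebra_simps)
qed

section \<open>One-dimensional calculus of moving endpoints\<close>

lemma open_convex_bounded_real_interval:
  fixes S :: "real set"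
  assumes S: "open S" "convex S" "bounded S" "S \<noteq> {}"
  obtains A B where "A < B" "S = {A<..<B}"
proof -
  have bd: "bdd_below S" "bdd_above S" using S by (auto simp: bounded_imp_bdd_below bounded_imp_bdd_above)
  have sub: "S \<subseteq> {Inf S<..<Sup S}"
  proof
    fix y assume y: "y \<in> S"
    then obtain e where e: "e > 0" "ball y e \<subseteq> S" using S openE by blast
    then have "y - e/2 \<in> S" "y + e/2 \<in> S" by (auto simp: subset_iff dist_real_def)
    then have "Inf S \<le> y - e/2" "y + e/2 \<le> Sup S" using bd by (auto intro: cInf_lower cSup_upper)
    then show "y \<in> {Inf S<..<Sup S}" using e by auto
  qed
  have "{Inf S<..<Sup S} \<subseteq> S"
  proof
    fix y assume "y \<in> {Inf S<..<Sup S}"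
    then obtain l u where "l \<in> S" "l < y" "u \<in> S" "y < u"
      using S bd cInf_less_iff[of S y] less_cSup_iff[of S y] by auto
    then show "y \<in> S" 
      using closed_segment_subset[OF _ _ S(2), of l u] by (auto simp: closed_segment_eq_real_ivl)
  qed
  moreover have "Inf S < Sup S" using sub S(4) by (auto dest: less_trans)
  ultimately show thesis using that sub by blast
qed

lemma abs_Min_diff_le:
  fixes f g :: "'k \<Rightarrow> real"
  assumes "finite K" "K \<noteq> {}" and fg: "\<And>k. k \<in> K \<Longrightarrow> \<bar>f k - g k\<bar> \<le> e"
  shows "\<bar>Min (f ` K) - Min (g ` K)\<bar> \<le> e"
proof -
  have *: "Min (f ` K) \<le> Min (g ` K) + e" if fg: "\<And>k. k \<in> K \<Longrightarrow> \<bar>f k - g k\<bar> \<le> e" for f g :: "'k \<Rightarrow> real"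
  proof -
    have "Min (g ` K) \<in> g ` K" using assms by (intro Min_in) auto
    then obtain k where k: "k \<in> K" "Min (g ` K) = g k" by blast
    have "Min (f ` K) \<le> f k" using assms k by (intro Min_le) auto
    then show ?thesis using fg[OF k(1)] k(2) by simp
  qed
  have "Min (f ` K) \<le> Min (g ` K) + e" using * fg .
  moreover have "Min (g ` K) \<le> Min (f ` K) + e" using * fg by (simp add: abs_minus_commute)
  ultimately show ?thesis by simp
qed

lemma tendsto_eventually_less:
  fixes f g :: "'b \<Rightarrow> real"
  assumes "(f \<longlongrightarrow> a) F" "(g \<longlongrightarrow> b) F" "a < b"
  shows "\<forall>\<^sub>F n in F. f n < g n"
proof -
  have "((\<lambda>n. g n - f n) \<longlongrightarrow> b - a) F" using assms by (intro tendsto_diff)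
  from order_tendstoD(1)[OF this, of 0] show ?thesis using assms(3) by simp
qed

text \<open>
  The active index sets of a minimum are upper semicontinuous: an index that is inactive in the
  limit is eventually inactive. This is what makes every selection of active pieces admissible.
\<close>

lemma eventually_Min_active:
  fixes f :: "'k \<Rightarrow> 'b \<Rightarrow> real"
  assumes K: "finite K" "K \<noteq> {}" and lim: "\<And>k. k \<in> K \<Longrightarrow> ((\<lambda>n. f k n) \<longlongrightarrow> g k) F"
  shows "\<forall>\<^sub>F n in F. \<forall>k\<in>K. f k n = Min ((\<lambda>k. f k n) ` K) \<longrightarrow> g k = Min (g ` K)"
proof (rule eventually_ball_finite[OF K(1)], rule ballI)
  fix k assume k: "k \<in> K"
  have "Min (g ` K) \<in> g ` K" using K by (intro Min_in) auto
  then obtain l where l: "l \<in> K" "Min (g ` K) = g l" by blast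
  show "\<forall>\<^sub>F n in F. f k n = Min ((\<lambda>k. f k n) ` K) \<longrightarrow> g k = Min (g ` K)"
  proof (cases "g k = Min (g ` K)")
    case False
    then have "g l < g k" using K k l by (metis Min_le finite_imageI imageI less_le)
    then have "\<forall>\<^sub>F n in F. f l n < f k n"
      by (rule tendsto_eventually_less[OF lim[OF l(1)] lim[OF k]])
    then show ?thesis
    proof eventually_elim
      case (elim n)
      have "Min ((\<lambda>k. f k n) ` K) \<le> f l n" using K l by (intro Min_le) auto
      with elim show ?case by simp
    qed
  qed simp
qed

lemma Max_image_uminus: "finite K \<Longrightarrow> K \<noteq> {} \<Longrightarrow> Max (f ` K) = - Min ((\<lambda>k. - f k) ` K)" for f :: "'k \<Rightarrow> real"
  using minus_Max_eq_Min[of "f ` K"] by (simp add: image_image)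

text \<open>
  The mass of a moving interval \<open>(lo, hi)\<close> with density \<open>f = F'\<close>, read as zero when \<open>hi \<le> lo\<close>. The rate \<open>d\<close> is
  evaluated at the moving endpoints. If the limit interval is nondegenerate, or has length zero and
  the moving one is nonempty, the claim is Newton differentiability of \<open>F\<close> at both endpoints; in every
  other case all masses and the rate eventually vanish. The case \<open>hib = lob\<close>, where a region is just about to open up, is thus
  harmless.
\<close>

lemma clipped_primitive_increment:
  fixes F f :: "real \<Rightarrow> real" and hi lo d e :: "nat \<Rightarrow> real"
  assumes F: "\<And>y. (F has_real_derivative f y) (at y)" and f: "\<And>y. isCont f y"
    and hi: "hi \<longlonglongrightarrow> hib" "\<And>n. \<bar>hi n - hib\<bar> \<le> C * e n" and lo: "lo \<longlonglongrightarrow> lob" "\<And>n. \<bar>lo n - lob\<bar> \<le> C * e n"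
    and C: "0 \<le> C" and e: "\<And>n. 0 \<le> e n"
    and d: "\<forall>\<^sub>F n in sequentially. lo n < hi n \<longrightarrow> d n = f (hi n) * (hi n - hib) - f (lo n) * (lo n - lob)"
    and d0: "\<And>n. hi n \<le> lo n \<Longrightarrow> d n = 0"
  shows "(\<lambda>n. (F (max (lo n) (hi n)) - F (lo n) - (F (max lob hib) - F lob) - d n) / e n) \<longlonglongrightarrow> 0"
proof (rule tendstoI)
  fix \<epsilon>0 :: real assume \<epsilon>0: "0 < \<epsilon>0"
  \<comment> \<open>each of the two endpoints contributes an error of at most twice this number times \<open>C * e n\<close>\<close>
  define \<epsilon> where "\<epsilon> = \<epsilon>0 / (4 * C + 1)"
  have \<epsilon>: "\<epsilon> > 0" "4 * C * \<epsilon> < \<epsilon>0" using \<epsilon>0 C by (auto simp: \<epsilon>_def field_simps)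
  have lin: "\<forall>\<^sub>F n in sequentially. \<bar>F (h n) - F hb - f (h n) * (h n - hb)\<bar> \<le> 2 * \<epsilon> * \<bar>h n - hb\<bar>"
    if h: "h \<longlonglongrightarrow> hb" for h :: "nat \<Rightarrow> real" and hb
  proof -
    from f[of hb] \<epsilon> obtain s where s: "s > 0" "\<And>y. \<bar>y - hb\<bar> < s \<Longrightarrow> \<bar>f y - f hb\<bar> < \<epsilon>"
      unfolding continuous_at_eps_delta dist_real_def by meson
    from tendstoD[OF h s(1)] show ?thesis
    proof eventually_elim
      case (elim n)
      have "\<exists>z. \<bar>z - hb\<bar> \<le> \<bar>h n - hb\<bar> \<and> F (h n) - F hb = f z * (h n - hb)"
      proof (cases "h n" hb rule: linorder_cases)
        case less
        from MVT2[OF this F] obtain z where "h n < z" "z < hb" "F hb - F (h n) = (hb - h n) * f z" by blast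
        then show ?thesis by (intro exI[of _ z]) (auto simp: algebra_simps)
      next
        case greater
        from MVT2[OF this F] obtain z where "hb < z" "z < h n" "F (h n) - F hb = (h n - hb) * f z" by blast
        then show ?thesis by (intro exI[of _ z]) (auto simp: algebra_simps)
      qed (auto intro!: exI[of _ hb])
      then obtain z where z: "\<bar>z - hb\<bar> \<le> \<bar>h n - hb\<bar>" "F (h n) - F hb = f z * (h n - hb)" by blast
      have "\<bar>f z - f hb\<bar> < \<epsilon>" "\<bar>f (h n) - f hb\<bar> < \<epsilon>" using s(2) z(1) elim by (auto simp: dist_real_def)
      then have "\<bar>f z - f (h n)\<bar> \<le> 2 * \<epsilon>" by linarith
      moreover have "F (h n) - F hb - f (h n) * (h n - hb) = (f z - f (h n)) * (h n - hb)"
        using z by (simp add: algebra_simps)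
      ultimately show ?case by (simp add: abs_mult mult_right_mono)
    qed
  qed
  have ord: "\<forall>\<^sub>F n in sequentially. (lob < hib \<longrightarrow> lo n < hi n) \<and> (hib < lob \<longrightarrow> hi n < lo n)"
  proof (rule eventually_conj)
    show "\<forall>\<^sub>F n in sequentially. lob < hib \<longrightarrow> lo n < hi n"
      by (cases "lob < hib") (auto intro: tendsto_eventually_less hi(1) lo(1))
    show "\<forall>\<^sub>F n in sequentially. hib < lob \<longrightarrow> hi n < lo n"
      by (cases "hib < lob") (auto intro: tendsto_eventually_less hi(1) lo(1))
  qed
  show "\<forall>\<^sub>F n in sequentially. dist ((F (max (lo n) (hi n)) - F (lo n) - (F (max lob hib) - F lob) - d n) / e n) 0 < \<epsilon>0"
    using lin[OF hi(1)] lin[OF lo(1)] ord d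
  proof eventually_elim
    case (elim n)
    let ?x = "F (max (lo n) (hi n)) - F (lo n) - (F (max lob hib) - F lob) - d n"
    have b: "2 * \<epsilon> * \<bar>hi n - hib\<bar> \<le> 2 * \<epsilon> * (C * e n)" "2 * \<epsilon> * \<bar>lo n - lob\<bar> \<le> 2 * \<epsilon> * (C * e n)"
      using hi(2)[of n] lo(2)[of n] \<epsilon> by (auto intro!: mult_left_mono)
    have "\<bar>?x\<bar> \<le> 4 * C * \<epsilon> * e n"
    proof (cases "lo n < hi n")
      case True
      with elim(3) have "lob \<le> hib" by linarith
      then have "?x = (F (hi n) - F hib - f (hi n) * (hi n - hib)) - (F (lo n) - F lob - f (lo n) * (lo n - lob))"
      proof -
        have "max (lo n) (hi n) = hi n" "max lob hib = hib" using True \<open>lob \<le> hib\<close> by auto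
        moreover have "d n = f (hi n) * (hi n - hib) - f (lo n) * (lo n - lob)" using elim(4) True by blast
        ultimately show ?thesis by simp
      qed
      then have "\<bar>?x\<bar> \<le> 2 * \<epsilon> * \<bar>hi n - hib\<bar> + 2 * \<epsilon> * \<bar>lo n - lob\<bar>" using elim(1,2) by linarith
      also have "\<dots> \<le> 2 * \<epsilon> * (C * e n) + 2 * \<epsilon> * (C * e n)" using b by (rule add_mono)
      also have "\<dots> = 4 * C * \<epsilon> * e n" by simp
      finally show ?thesis .
    next
      case False
      with elim(3) have "hib \<le> lob" by linarith
      moreover have "d n = 0" using False d0 by simp
      ultimately have "?x = 0" using False by (simp add: max_absorb1)
      then show ?thesis using C \<epsilon> e[of n] by simp
    qed
    then have "\<bar>?x / e n\<bar> \<le> 4 * C * \<epsilon>"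
      using e[of n] C \<epsilon> by (cases "e n = 0") (auto simp: abs_divide divide_le_eq)
    then show ?case using \<epsilon> by (simp add: dist_real_def)
  qed
qed

lemma lborel_integral_open_interval_FTC:
  fixes F f :: "real \<Rightarrow> real"
  assumes F: "\<And>y. (F has_real_derivative f y) (at y)" and f: "\<And>y. isCont f y"
  shows "(LINT y|lborel. indicator {l<..<u} y * f y) = F (max l u) - F l"
proof (cases "l \<le> u")
  case True
  have "(LBINT y=ereal l..ereal u. f y) = F u - F l"
  proof (rule interval_integral_FTC_finite)
    show "continuous_on {min l u..max l u} f" using f by (simp add: continuous_at_imp_continuous_on)
    show "(F has_vector_derivative f y) (at y within {min l u..max l u})" for y
      using F[of y] by (simp add: has_real_derivative_iff_has_vector_derivative has_vector_derivative_at_within)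
  qed
  then show ?thesis using True by (simp add: interval_lebesgue_integral_def set_lebesgue_integral_def max_def)
qed (simp add: max_def)

section \<open>Cells of the diagram\<close>

definition score :: "('n \<Rightarrow> real^2) \<Rightarrow> real^'n \<Rightarrow> 'n \<Rightarrow> real^2 \<Rightarrow> real" where
  "score a \<xi> j p = a j \<bullet> p - \<xi> $ j"

text \<open>
  The closed counterpart of a region. It can be nonempty (a segment or a point) when the region is
  empty, so it is the closure only of nonempty regions.
\<close>

definition cell :: "('n \<Rightarrow> real^2) \<Rightarrow> (real^2) set \<Rightarrow> real^'n \<Rightarrow> 'n \<Rightarrow> (real^2) set" where
  "cell a D \<xi> i = {p \<in> D. \<forall>j. score a \<xi> j p \<le> score a \<xi> i p}"

lemma region_score: "region a D \<xi> i = {p \<in> interior D. \<forall>j. j \<noteq> i \<longrightarrow> score a \<xi> j p < score a \<xi> i p}"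
  by (auto simp: region_def score_def)

lemma continuous_on_score [continuous_intros]:
  "continuous_on S f \<Longrightarrow> continuous_on S (\<lambda>z. score a \<xi> j (f z))"
  unfolding score_def by (intro continuous_intros)

lemma score_affine: "score a \<xi> j ((1 - t) *\<^sub>R p + t *\<^sub>R q) = (1 - t) * score a \<xi> j p + t * score a \<xi> j q"
  by (simp add: score_def inner_add_right algebra_simps)

lemma open_region: "open (region a D \<xi> i)" for a :: "'n::finite \<Rightarrow> real^2"
proof -
  have "region a D \<xi> i = interior D \<inter> (\<Inter>j\<in>UNIV - {i}. {p. score a \<xi> j p < score a \<xi> i p})"
    by (auto simp: region_score)
  moreover have "open \<dots>"
    by (intro open_Int open_INT open_Collect_less continuous_intros ballI) auto
  ultimately show ?thesis by simp
qed

lemma convex_region: "convex D \<Longrightarrow> convex (region a D \<xi> i)"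
  unfolding convex_alt
proof (intro ballI allI impI)
  fix p q t assume D: "\<forall>x\<in>D. \<forall>y\<in>D. \<forall>u. 0 \<le> u \<and> u \<le> 1 \<longrightarrow> (1 - u) *\<^sub>R x + u *\<^sub>R y \<in> D"
    and pq: "p \<in> region a D \<xi> i" "q \<in> region a D \<xi> i" and t: "0 \<le> t \<and> t \<le> (1::real)"
  have "convex (interior D)" using D by (intro convex_interior) (simp add: convex_alt)
  then have "(1 - t) *\<^sub>R p + t *\<^sub>R q \<in> interior D" using pq t by (auto simp: convex_alt region_score)
  moreover have "score a \<xi> j ((1 - t) *\<^sub>R p + t *\<^sub>R q) < score a \<xi> i ((1 - t) *\<^sub>R p + t *\<^sub>R q)" if "j \<noteq> i" for j
  proof -
    have "score a \<xi> j p < score a \<xi> i p" "score a \<xi> j q < score a \<xi> i q" using pq that by (auto simp: region_score)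
    then show ?thesis unfolding score_affine
      using t by (cases "t = 0") (auto intro!: add_le_less_mono mult_left_mono)
  qed
  ultimately show "(1 - t) *\<^sub>R p + t *\<^sub>R q \<in> region a D \<xi> i" by (simp add: region_score)
qed

lemma closed_cell: "closed D \<Longrightarrow> closed (cell a D \<xi> i)"
proof -
  assume "closed D"
  moreover have "cell a D \<xi> i = D \<inter> (\<Inter>j. {p. score a \<xi> j p \<le> score a \<xi> i p})" by (auto simp: cell_def)
  ultimately show ?thesis
    by (auto intro!: closed_Int closed_INT closed_Collect_le continuous_intros)
qed

lemma convex_cell: "convex D \<Longrightarrow> convex (cell a D \<xi> i)"
  unfolding convex_alt cell_def by (auto simp: score_affine intro!: add_mono mult_left_mono)

lemma region_subset_cell: "region a D \<xi> i \<subseteq> cell a D \<xi> i"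
proof
  fix p assume "p \<in> region a D \<xi> i"
  then show "p \<in> cell a D \<xi> i" using interior_subset by (force simp: region_score cell_def intro: less_imp_le)
qed

text \<open>
  Moving a point of the cell towards a point of the region makes all inequalities strict at once.
\<close>

lemma closure_region:
  assumes D: "convex D" "closed D" and ne: "region a D \<xi> i \<noteq> {}"
  shows "closure (region a D \<xi> i) = cell a D \<xi> i"
proof
  show "closure (region a D \<xi> i) \<subseteq> cell a D \<xi> i"
    by (intro closure_minimal region_subset_cell closed_cell D)
  show "cell a D \<xi> i \<subseteq> closure (region a D \<xi> i)"
  proof
    fix p assume p: "p \<in> cell a D \<xi> i"
    obtain w where w: "w \<in> region a D \<xi> i" using ne by blast
    have in_reg: "(1 - t) *\<^sub>R p + t *\<^sub>R w \<in> region a D \<xi> i" if t: "0 < t" "t \<le> 1" for t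
    proof -
      have "p - t *\<^sub>R (p - w) \<in> interior D"
        using D w p t closure_subset by (intro mem_interior_closure_convex_shrink) (auto simp: region_score cell_def)
      then have "(1 - t) *\<^sub>R p + t *\<^sub>R w \<in> interior D" by (simp add: algebra_simps)
      moreover have "score a \<xi> j ((1 - t) *\<^sub>R p + t *\<^sub>R w) < score a \<xi> i ((1 - t) *\<^sub>R p + t *\<^sub>R w)" if "j \<noteq> i" for j
      proof -
        have "score a \<xi> j p \<le> score a \<xi> i p" "score a \<xi> j w < score a \<xi> i w"
          using p w that by (auto simp: region_score cell_def)
        then show ?thesis unfolding score_affine using t by (intro add_le_less_mono mult_left_mono) auto
      qed
      ultimately show ?thesis by (simp add: region_score)
    qed
    have "((\<lambda>t. (1 - t) *\<^sub>R p + t *\<^sub>R w) \<longlongrightarrow> (1 - 0) *\<^sub>R p + 0 *\<^sub>R w) (at_right 0)"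
      by (intro tendsto_intros)
    moreover have "\<forall>\<^sub>F t in at_right 0. (1 - t) *\<^sub>R p + t *\<^sub>R w \<in> closure (region a D \<xi> i)"
      using eventually_at_right_real[OF zero_less_one] 
      by eventually_elim (rule subsetD[OF closure_subset], rule in_reg, auto)
    ultimately show "p \<in> closure (region a D \<xi> i)"
      by (intro Lim_in_closed_set[of "closure (region a D \<xi> i)" _ "at_right (0::real)"]) auto
  qed
qed

section \<open>Edge weights as integrals over slices\<close>

text \<open>
  The density is taken to be continuous on the whole plane, so that its primitive along a slice exists
  on the entire line.
\<close>

locale sliced_diagram =
  fixes a :: "'n::finite \<Rightarrow> real^2" and D :: "(real^2) set" and \<rho> :: "real^2 \<Rightarrow> real" and m M :: real
  assumes convex_D: "convex D" and compact_D: "compact D"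
    and cont_\<rho>: "continuous_on UNIV \<rho>" and \<rho>_bound: "\<bar>\<rho> p\<bar> \<le> M"
    and \<rho>_nonneg: "p \<in> D \<Longrightarrow> 0 \<le> \<rho> p"
    and inj_slope: "inj (\<lambda>j. m * a j $ 1 + a j $ 2)"
begin

definition slope :: "'n \<Rightarrow> real" where "slope j = m * a j $ 1 + a j $ 2"

text \<open>
  The second coordinate at which the slice over \<open>x\<close> crosses the line where the scores of \<open>i\<close> and \<open>k\<close>
  agree. It is affine in \<open>x\<close> and in \<open>\<xi>\<close>.
\<close>

definition height :: "real^'n \<Rightarrow> 'n \<Rightarrow> 'n \<Rightarrow> real \<Rightarrow> real" where
  "height \<xi> i k x = (\<xi> $ i - \<xi> $ k - x * (a i $ 1 - a k $ 1)) / (slope i - slope k)"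

abbreviation wall :: "real^'n \<Rightarrow> 'n \<Rightarrow> 'n \<Rightarrow> real \<Rightarrow> real^2" where
  "wall \<xi> i k x \<equiv> pt m x (height \<xi> i k x)"

abbreviation "reg \<equiv> region a D"
abbreviation "clo \<equiv> cell a D"
abbreviation "sc \<equiv> score a"

text \<open>
  The wall between \<open>i\<close> and \<open>k\<close> crosses the slice over \<open>x\<close> in a point of their common edge. Both regions
  have to be nonempty: a third point \<open>a j\<close> collinear with \<open>a i\<close> and \<open>a k\<close> may have an empty region
  and still tie along the whole edge.
\<close>

definition neighbour :: "real^'n \<Rightarrow> 'n \<Rightarrow> 'n \<Rightarrow> real \<Rightarrow> bool" where
  "neighbour \<xi> i k x \<longleftrightarrow> k \<noteq> i \<and> reg \<xi> i \<noteq> {} \<and> reg \<xi> k \<noteq> {} \<and> wall \<xi> i k x \<in> clo \<xi> i"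

lemma slope_eq_iff [simp]: "slope i = slope k \<longleftrightarrow> i = k"
  using inj_slope by (auto simp: slope_def inj_def)

lemma M_nonneg: "0 \<le> M" using \<rho>_bound[of 0] by linarith

lemma score_pt: "sc \<xi> j (pt m x y) = x * a j $ 1 + y * slope j - \<xi> $ j"
  by (simp add: score_def inner_vec_def UNIV_2 slope_def algebra_simps)

lemma score_diff: "i \<noteq> k \<Longrightarrow> sc \<xi> i (pt m x y) - sc \<xi> k (pt m x y) = (slope i - slope k) * (y - height \<xi> i k x)"
proof -
  assume "i \<noteq> k"
  then have "(slope i - slope k) * height \<xi> i k x = \<xi> $ i - \<xi> $ k - x * (a i $ 1 - a k $ 1)"
    by (simp add: height_def)
  then show ?thesis by (simp add: score_pt right_diff_distrib) (simp add: algebra_simps)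
qed

lemma height_increment: "height \<xi> i k x - height z i k x = ((\<xi> - z) $ i - (\<xi> - z) $ k) / (slope i - slope k)"
  by (simp add: height_def diff_divide_distrib[symmetric])

lemma pt_decompose: "p = pt m (p $ 1 - m * p $ 2) (p $ 2)"
  by (simp add: vec_eq_iff forall_2)

lemma height_affine: "height \<xi> i k x = height \<xi> i k 0 + x * height 0 i k 1"
proof -
  have *: "(X - x * A) / c = (X - 0 * A) / c + x * ((0 - 0 - 1 * A) / c)" for X A c :: real
    by (simp add: diff_divide_distrib)
  show ?thesis unfolding height_def zero_index by (rule *)
qed

text \<open>
  \<open>wall 0 i k 1\<close> serves as direction vector of the wall, because \<open>height 0 i k\<close> is the linear part of the height.
\<close>

lemma wall_affine: "wall \<xi> i k x = wall \<xi> i k 0 + x *\<^sub>R (wall 0 i k 1)"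
  using height_affine[of \<xi> i k x] by (simp add: vec_eq_iff forall_2 algebra_simps)

text \<open>
  The speed at which \<open>x\<close> traverses the wall. The factor \<open>|a k - a i|\<close> cancels the one in the edge weight.
\<close>

lemma norm_wall_direction:
  assumes "i \<noteq> k" shows "norm (wall 0 i k 1) = norm (a k - a i) / \<bar>slope i - slope k\<bar>"
proof -
  let ?c = "slope i - slope k"
  have c: "?c \<noteq> 0" using assms by simp
  have c': "?c = m * (a i $ 1 - a k $ 1) + (a i $ 2 - a k $ 2)" by (simp add: slope_def algebra_simps)
  have "?c *\<^sub>R wall 0 i k 1 = vector [a i $ 2 - a k $ 2, - (a i $ 1 - a k $ 1)]"
  proof -
    have h: "?c * height 0 i k 1 = - (a i $ 1 - a k $ 1)" using c by (simp add: height_def)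
    have "?c * (1 + m * height 0 i k 1) = ?c + m * (?c * height 0 i k 1)" by (simp add: algebra_simps)
    also have "\<dots> = a i $ 2 - a k $ 2" unfolding h by (simp add: c' algebra_simps)
    finally show ?thesis using h by (simp add: vec_eq_iff forall_2)
  qed
  then have "norm (?c *\<^sub>R wall 0 i k 1) = norm (vector [a i $ 2 - a k $ 2, - (a i $ 1 - a k $ 1)] :: real^2)" by simp
  also have "\<dots> = norm (a k - a i)"
    by (simp add: norm_vec_def L2_set_def UNIV_2 power2_commute add.commute)
  finally show ?thesis unfolding norm_scaleR using c by (simp add: field_simps)
qed

lemma in_common_iff:
  assumes "i \<noteq> k"
  shows "p \<in> clo \<xi> i \<inter> clo \<xi> k \<longleftrightarrow> (\<exists>x. p = wall \<xi> i k x \<and> wall \<xi> i k x \<in> clo \<xi> i)"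
proof
  assume p: "p \<in> clo \<xi> i \<inter> clo \<xi> k"
  let ?x = "p $ 1 - m * p $ 2"
  have "sc \<xi> i p = sc \<xi> k p" using p by (auto simp: cell_def intro: antisym)
  then have "(slope i - slope k) * (p $ 2 - height \<xi> i k ?x) = 0"
    using score_diff[OF assms, of \<xi> ?x "p $ 2"] pt_decompose[of p] by simp
  then have "p = wall \<xi> i k ?x" using pt_decompose[of p] assms by simp
  with p show "\<exists>x. p = wall \<xi> i k x \<and> wall \<xi> i k x \<in> clo \<xi> i" by auto
next
  assume "\<exists>x. p = wall \<xi> i k x \<and> wall \<xi> i k x \<in> clo \<xi> i"
  then obtain x where x: "p = wall \<xi> i k x" "p \<in> clo \<xi> i" by auto
  then have "sc \<xi> i p = sc \<xi> k p" using score_diff[OF assms, of \<xi> x "height \<xi> i k x"] by simp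
  with x show "p \<in> clo \<xi> i \<inter> clo \<xi> k" by (auto simp: cell_def)
qed

lemma pt_inj: "pt m x y = pt m x' y' \<longleftrightarrow> x = x' \<and> y = y'"
  by (auto simp: vec_eq_iff forall_2)

lemma closed_D: "closed D" using compact_D by (rule compact_imp_closed)

lemma common_edge_eq:
  assumes "i \<noteq> k" "reg \<xi> i \<noteq> {}" "reg \<xi> k \<noteq> {}"
  shows "common_edge a D \<xi> i k = clo \<xi> i \<inter> clo \<xi> k"
  using assms by (simp add: common_edge_def closure_region convex_D closed_D)

lemma continuous_wall: "continuous_on S (\<lambda>x. wall \<xi> i k x)"
proof (cases "i = k")
  case False then show ?thesis unfolding height_def by (intro continuous_intros) auto
next
  case True
  then show ?thesis unfolding height_def by (auto intro!: continuous_intros)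
qed

lemma closed_neighbour: "closed {x. neighbour \<xi> i k x}"
proof (cases "k \<noteq> i \<and> reg \<xi> i \<noteq> {} \<and> reg \<xi> k \<noteq> {}")
  case True
  then have eq: "{x. neighbour \<xi> i k x} = (\<lambda>x. wall \<xi> i k x) -` clo \<xi> i" by (auto simp: neighbour_def)
  show ?thesis unfolding eq by (rule closed_vimage[OF closed_cell[OF closed_D] continuous_wall])
next
  case False
  then have "{x. neighbour \<xi> i k x} = {}" by (auto simp: neighbour_def)
  then show ?thesis by simp
qed

text \<open>
  If the cells of \<open>i\<close> and \<open>k\<close> meet in at least two points, their intersection is a nondegenerate segment
  and the formula is the parametrisation of that segment by \<open>x\<close>. Otherwise at most one slice
  contributes to the right-hand side, and both sides vanish.
\<close>

lemma edge_weight_slices: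
  assumes ik: "i \<noteq> k"
  shows "edge_weight \<rho> a D \<xi> i k =
    (LINT x|lborel. (if neighbour \<xi> i k x then \<rho> (wall \<xi> i k x) else 0)) / \<bar>slope i - slope k\<bar>"
proof (cases "reg \<xi> i \<noteq> {} \<and> reg \<xi> k \<noteq> {}")
  case False
  then have "\<not> neighbour \<xi> i k x" for x by (auto simp: neighbour_def)
  moreover have "\<not> share_edge a D \<xi> i k" using False by (auto simp: share_edge_def)
  ultimately show ?thesis by (simp add: edge_weight_def)
next
  case True
  define E where "E = clo \<xi> i \<inter> clo \<xi> k"
  have E: "common_edge a D \<xi> i k = E" using common_edge_eq[OF ik] True by (simp add: E_def)
  have neigh: "neighbour \<xi> i k x \<longleftrightarrow> wall \<xi> i k x \<in> E" for x
    using True ik in_common_iff[OF ik, of "wall \<xi> i k x" \<xi>] by (auto simp: neighbour_def E_def pt_inj)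
  have onwall: "\<exists>x. p = wall \<xi> i k x" if "p \<in> E" for p
    using in_common_iff[OF ik, of p \<xi>] that by (auto simp: E_def)
  have clE: "closed E" "convex E"
    unfolding E_def using closed_D convex_D by (auto intro!: closed_Int closed_cell convex_Int convex_cell)
  have "compact E"
    unfolding compact_eq_bounded_closed
  proof
    show "bounded E" by (rule bounded_subset[OF compact_imp_bounded[OF compact_D]]) (auto simp: E_def cell_def)
  qed (rule clE)
  have "collinear E"
    unfolding collinear_def
  proof (intro exI[of _ "wall 0 i k 1"] ballI)
    fix p q assume "p \<in> E" "q \<in> E"
    then obtain x y where "p = wall \<xi> i k x" "q = wall \<xi> i k y" using onwall by blast
    then have "p - q = (x - y) *\<^sub>R wall 0 i k 1"
      using wall_affine[of x \<xi> i k] wall_affine[of y \<xi> i k] by (simp add: scaleR_diff_left)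
    then show "\<exists>c. p - q = c *\<^sub>R wall 0 i k 1" by blast
  qed
  show ?thesis
  proof (cases "\<exists>p\<in>E. \<exists>q\<in>E. p \<noteq> q")
    case two: True
    then have "E \<noteq> {}" by blast
    obtain p q where pq: "E = closed_segment p q"
      using compact_convex_collinear_segment[OF \<open>E \<noteq> {}\<close> \<open>compact E\<close> clE(2) \<open>collinear E\<close>] by blast
    with two have "p \<noteq> q" by auto
    then have share: "share_edge a D \<xi> i k" using True E pq by (auto simp: share_edge_def)
    let ?w = "wall 0 i k 1"
    have nw: "norm ?w = norm (a k - a i) / \<bar>slope i - slope k\<bar>" by (rule norm_wall_direction[OF ik])
    have ak: "a k \<noteq> a i" using ik slope_eq_iff[of i k] by (auto simp: slope_def simp del: slope_eq_iff)
    have w0: "?w \<noteq> 0" using nw ak ik by (metis divide_eq_0_iff eq_iff_diff_eq_0 norm_eq_zero abs_eq_0 slope_eq_iff)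
    have "(LINT x:E|hausdorff1. \<rho> x)
        = norm ?w * (LINT t|lborel. indicator E (wall \<xi> i k 0 + t *\<^sub>R ?w) * \<rho> (wall \<xi> i k 0 + t *\<^sub>R ?w))"
    proof (rule set_integral_hausdorff1_line[OF w0])
      show "E \<subseteq> range (\<lambda>t. wall \<xi> i k 0 + t *\<^sub>R ?w)"
      proof
        fix p assume "p \<in> E"
        then obtain x where "p = wall \<xi> i k x" using onwall by blast
        then have "p = wall \<xi> i k 0 + x *\<^sub>R ?w" using wall_affine[of x \<xi> i k] by simp
        then show "p \<in> range (\<lambda>t. wall \<xi> i k 0 + t *\<^sub>R ?w)" by (rule range_eqI)
      qed
      show "E \<in> sets borel" using clE by auto
      show "\<rho> \<in> borel_measurable borel" using cont_\<rho> by (rule borel_measurable_continuous_onI)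
    qed
    also have "(\<lambda>t. indicator E (wall \<xi> i k 0 + t *\<^sub>R ?w) * \<rho> (wall \<xi> i k 0 + t *\<^sub>R ?w))
        = (\<lambda>t. if neighbour \<xi> i k t then \<rho> (wall \<xi> i k t) else 0)"
      unfolding neigh wall_affine[where \<xi>=\<xi> and i=i and k=k, symmetric] by (auto simp: indicator_def)
    finally show ?thesis using share nw ak by (simp add: edge_weight_def E)
  next
    case False
    have "\<not> share_edge a D \<xi> i k"
    proof
      assume "share_edge a D \<xi> i k"
      then obtain p q where "p \<noteq> q" "E = closed_segment p q" using E by (auto simp: share_edge_def)
      with False show False by auto
    qed
    moreover have "(LINT x|lborel. (if neighbour \<xi> i k x then \<rho> (wall \<xi> i k x) else 0)) = 0"
    proof (rule integral_eq_zero_AE)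
      show "AE x in lborel. (if neighbour \<xi> i k x then \<rho> (wall \<xi> i k x) else 0) = 0"
      proof (cases "\<exists>x0. neighbour \<xi> i k x0")
        case True
        then obtain x0 where x0: "neighbour \<xi> i k x0" by blast
        have "\<not> neighbour \<xi> i k x" if "x \<noteq> x0" for x
          using False x0 that unfolding neigh by (metis pt_inj)
        then show ?thesis using AE_lborel_singleton[of x0] by (auto elim: eventually_mono)
      qed auto
    qed
    ultimately show ?thesis by (simp add: edge_weight_def)
  qed
qed

section \<open>True neighbours of a slice\<close>

text \<open>
  Slices to be discarded: those that touch the closure of the region but miss the region, and those through
  a vertex where two neighbours of \<open>i\<close> compete for the same endpoint. The positive product says that \<open>k\<close> and \<open>k'\<close> compete for
  the same end of the interval.
\<close>

definition exceptional :: "real^'n \<Rightarrow> 'n \<Rightarrow> real set" where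
  "exceptional \<xi> i =
     {x. (\<exists>k. neighbour \<xi> i k x) \<and> (\<forall>y. pt m x y \<notin> reg \<xi> i)} \<union>
     {x. \<exists>k k'. k \<noteq> k' \<and> neighbour \<xi> i k x \<and> neighbour \<xi> i k' x \<and> height \<xi> i k x = height \<xi> i k' x \<and>
        0 < (slope k - slope i) * (slope k' - slope i)}"

text \<open>
  Two walls of \<open>i\<close> whose heights agree over two slices coincide. Then \<open>a i\<close>, \<open>a k\<close>, \<open>a k'\<close> are
  collinear, and as \<open>k\<close> and \<open>k'\<close> lie on the same side of \<open>i\<close>, beyond the wall the score with the
  steeper growth beats the other one everywhere, so one of the two regions would be empty.
\<close>

lemma finite_neighbour_ties:
  "finite {x. \<exists>k k'. k \<noteq> k' \<and> neighbour \<xi> i k x \<and> neighbour \<xi> i k' x \<and> height \<xi> i k x = height \<xi> i k' x \<and>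
        0 < (slope k - slope i) * (slope k' - slope i)}"
proof -
  define T where "T = (\<lambda>(k, k'). {x. k \<noteq> k' \<and> neighbour \<xi> i k x \<and> neighbour \<xi> i k' x \<and>
      height \<xi> i k x = height \<xi> i k' x \<and> 0 < (slope k - slope i) * (slope k' - slope i)})"
  have "x1 = x2" if x1: "x1 \<in> T (k, k')" and x2: "x2 \<in> T (k, k')" for x1 x2 k k'
  proof (rule ccontr)
    assume "x1 \<noteq> x2"
    let ?B = "height 0 i k 1 - height 0 i k' 1"
    have "height \<xi> i k 0 - height \<xi> i k' 0 + x * ?B = 0" if "height \<xi> i k x = height \<xi> i k' x" for x
      using that height_affine[of \<xi> i k x] height_affine[of \<xi> i k' x] by (simp add: algebra_simps)
    then have e: "height \<xi> i k 0 - height \<xi> i k' 0 + x1 * ?B = 0" "height \<xi> i k 0 - height \<xi> i k' 0 + x2 * ?B = 0"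
      using x1 x2 by (auto simp: T_def)
    then have "x1 * ?B = x2 * ?B" by linarith
    then have B: "?B = 0" using \<open>x1 \<noteq> x2\<close> by simp
    then have same: "height \<xi> i k' x = height \<xi> i k x" for x
      using e(1) height_affine[of \<xi> i k x] height_affine[of \<xi> i k' x] by simp
    from x1 have kk: "k \<noteq> k'" "k \<noteq> i" "k' \<noteq> i" "reg \<xi> k \<noteq> {}" "reg \<xi> k' \<noteq> {}"
      and cc: "0 < (slope k - slope i) * (slope k' - slope i)" by (auto simp: T_def neighbour_def)
    let ?c = "slope k - slope i" and ?c' = "slope k' - slope i"
    obtain p where p: "p \<in> reg \<xi> k" using kk by blast
    define u where "u = p $ 2 - height \<xi> i k (p $ 1 - m * p $ 2)"
    have 1: "sc \<xi> k p - sc \<xi> i p = ?c * u"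
      using score_diff[of i k \<xi> "p $ 1 - m * p $ 2" "p $ 2"] kk pt_decompose[of p] by (simp add: u_def algebra_simps)
    have 2: "sc \<xi> k' p - sc \<xi> i p = ?c' * u"
      using score_diff[of i k' \<xi> "p $ 1 - m * p $ 2" "p $ 2"] kk pt_decompose[of p] same by (simp add: u_def algebra_simps)
    \<comment> \<open>the region of \<open>k\<close> is nonempty: at one of its points \<open>k\<close> beats both \<open>i\<close> and \<open>k'\<close>\<close>
    have U: "0 < ?c * u" "?c' * u < ?c * u" using p kk 1 2 by (auto simp: region_score)
    obtain q where q: "q \<in> reg \<xi> k'" using kk by blast
    define v where "v = q $ 2 - height \<xi> i k (q $ 1 - m * q $ 2)"
    have 3: "sc \<xi> k q - sc \<xi> i q = ?c * v"
      using score_diff[of i k \<xi> "q $ 1 - m * q $ 2" "q $ 2"] kk pt_decompose[of q] by (simp add: v_def algebra_simps)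
    have 4: "sc \<xi> k' q - sc \<xi> i q = ?c' * v"
      using score_diff[of i k' \<xi> "q $ 1 - m * q $ 2" "q $ 2"] kk pt_decompose[of q] same by (simp add: v_def algebra_simps)
    \<comment> \<open>the same for \<open>k'\<close>, which contradicts the previous comparison\<close>
    have V: "0 < ?c' * v" "?c * v < ?c' * v" using q kk 3 4 by (auto simp: region_score)
    have "(?c' - ?c) * u < 0" "(?c' - ?c) * v > 0" using U V by (simp_all add: left_diff_distrib)
    with U(1) V(1) cc show False
      by (cases "0 < ?c") (auto simp: zero_less_mult_iff mult_less_0_iff)
  qed
  then have "finite (T kk)" for kk
    by (cases kk) (metis finite.emptyI finite_insert finite_subset insertI1 subsetI subset_empty all_not_in_conv)
  then have "finite (\<Union>kk. T kk)" by simp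
  then show ?thesis by (rule rev_finite_subset) (auto simp: T_def)
qed

text \<open>
  The projection of the region along the slices is a convex open set \<open>P\<close> of reals; a slice that touches the closure
  of the region but misses the region itself sits over the frontier of \<open>P\<close>, a null set.
\<close>

lemma AE_not_exceptional: "AE x in lborel. x \<notin> exceptional \<xi> i"
proof -
  define P where "P = (\<lambda>p. p $ 1 - m * p $ 2) ` reg \<xi> i"
  have "AE x in lborel. \<not> ((\<exists>k. neighbour \<xi> i k x) \<and> (\<forall>y. pt m x y \<notin> reg \<xi> i))"
  proof -
    have lin: "linear (\<lambda>p::real^2. p $ 1 - m * p $ 2)"
      by (auto simp: linear_iff algebra_simps)
    have cx: "convex P" unfolding P_def by (intro convex_linear_image lin convex_region convex_D)
    have mem: "x \<in> P \<longleftrightarrow> (\<exists>y. pt m x y \<in> reg \<xi> i)" for x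
    proof
      assume "x \<in> P"
      then obtain p where "p \<in> reg \<xi> i" "x = p $ 1 - m * p $ 2" by (auto simp: P_def)
      then have "pt m x (p $ 2) \<in> reg \<xi> i" using pt_decompose[of p] by simp
      then show "\<exists>y. pt m x y \<in> reg \<xi> i" ..
    next
      assume "\<exists>y. pt m x y \<in> reg \<xi> i"
      then obtain y where "pt m x y \<in> reg \<xi> i" ..
      then show "x \<in> P" unfolding P_def by (rule rev_image_eqI) simp
    qed
    have "open P"
      unfolding open_dist
    proof
      fix x assume "x \<in> P"
      then obtain y where y: "pt m x y \<in> reg \<xi> i" using mem by blast
      have "open ((\<lambda>x. pt m x y) -` reg \<xi> i)" by (intro open_vimage open_region continuous_intros)
      moreover have "x \<in> (\<lambda>x. pt m x y) -` reg \<xi> i" using y by simp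
      ultimately obtain e where e: "e > 0" "\<forall>x'. dist x' x < e \<longrightarrow> x' \<in> (\<lambda>x. pt m x y) -` reg \<xi> i"
        unfolding open_dist by blast
      then have "\<forall>x'. dist x' x < e \<longrightarrow> x' \<in> P" using mem by auto
      with e(1) show "\<exists>e>0. \<forall>x'. dist x' x < e \<longrightarrow> x' \<in> P" by blast
    qed
    have "x \<in> frontier P" if "neighbour \<xi> i k x" "\<forall>y. pt m x y \<notin> reg \<xi> i" for k x
    proof -
      have "wall \<xi> i k x \<in> closure (reg \<xi> i)"
        using that closure_region[OF convex_D closed_D, of a \<xi> i] by (simp add: neighbour_def)
      then have "(\<lambda>p. p $ 1 - m * p $ 2) (wall \<xi> i k x) \<in> (\<lambda>p. p $ 1 - m * p $ 2) ` closure (reg \<xi> i)" by blast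
      also have "\<dots> \<subseteq> closure P"
        unfolding P_def by (rule image_closure_subset) (auto intro!: continuous_intros closure_subset[THEN subsetD])
      finally have "x \<in> closure P" by simp
      moreover have "x \<notin> P" using that mem by blast
      ultimately show ?thesis using \<open>open P\<close> by (simp add: frontier_def interior_open)
    qed
    moreover have "AE x in lebesgue. x \<notin> frontier P"
      using negligible_convex_frontier[OF cx] unfolding negligible_iff_null_sets by (rule AE_not_in)
    then have "AE x in lborel. x \<notin> frontier P" by (simp add: AE_completion_iff)
    ultimately show ?thesis by (auto elim!: eventually_mono)
  qed
  moreover have "AE x in lborel. x \<notin> {x. \<exists>k k'. k \<noteq> k' \<and> neighbour \<xi> i k x \<and> neighbour \<xi> i k' x \<and>
      height \<xi> i k x = height \<xi> i k' x \<and> 0 < (slope k - slope i) * (slope k' - slope i)}"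
    using finite_imp_null_set_lborel[OF finite_neighbour_ties] by (rule AE_not_in)
  ultimately show ?thesis by eventually_elim (auto simp: exceptional_def)
qed

text \<open>
  Leaving the cell of \<open>i\<close> at \<open>p\<close> in the direction \<open>\<sigma> (m, 1)\<close>, the scores tied at \<open>p\<close> separate because
  all slopes are distinct, and the steepest of them wins immediately. Its region is therefore
  nonempty and touches \<open>p\<close>.
\<close>

lemma exists_neighbour_beyond:
  assumes \<sigma>: "\<sigma> = 1 \<or> \<sigma> = - 1" and p: "pt m x t \<in> interior D" "pt m x t \<in> clo \<xi> i"
    and ne: "reg \<xi> i \<noteq> {}" and k0: "0 < \<sigma> * (slope k0 - slope i)" "height \<xi> i k0 x = t"
  shows "\<exists>k. 0 < \<sigma> * (slope k - slope i) \<and> neighbour \<xi> i k x \<and> height \<xi> i k x = t"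
proof -
  let ?p = "pt m x t"
  define Act where "Act = {j. sc \<xi> j ?p = sc \<xi> i ?p}"
  have hact: "height \<xi> i j x = t" if "j \<in> Act" "j \<noteq> i" for j
    using score_diff[of i j \<xi> x t] that by (auto simp: Act_def)
  have k0i: "k0 \<noteq> i" using k0 by auto
  then have k0A: "k0 \<in> Act" using score_diff[of i k0 \<xi> x t] k0 by (simp add: Act_def)
  have "Max ((\<lambda>j. \<sigma> * slope j) ` Act) \<in> (\<lambda>j. \<sigma> * slope j) ` Act" using k0A by (intro Max_in) auto
  then obtain k where k: "k \<in> Act" "\<sigma> * slope k = Max ((\<lambda>j. \<sigma> * slope j) ` Act)" by auto
  have kmax: "\<sigma> * slope j < \<sigma> * slope k" if "j \<in> Act" "j \<noteq> k" for j
  proof -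
    have "\<sigma> * slope j \<le> \<sigma> * slope k" unfolding k(2) using that by (intro Max_ge) auto
    moreover have "\<sigma> * slope j \<noteq> \<sigma> * slope k" using that \<sigma> by auto
    ultimately show ?thesis by (rule le_neq_trans)
  qed
  have "\<sigma> * slope k0 \<le> \<sigma> * slope k" using kmax[OF k0A] by (cases "k0 = k") auto
  with k0 have pos: "0 < \<sigma> * (slope k - slope i)" by (simp add: right_diff_distrib)
  then have ki: "k \<noteq> i" by auto
  have lim: "((\<lambda>\<epsilon>. pt m x (t + \<sigma> * \<epsilon>)) \<longlongrightarrow> pt m x (t + \<sigma> * 0)) (at_right 0)"
  proof -
    have "continuous_on UNIV (\<lambda>\<epsilon>. pt m x (t + \<sigma> * \<epsilon>))" by (intro continuous_intros)
    then have "((\<lambda>\<epsilon>. pt m x (t + \<sigma> * \<epsilon>)) \<longlongrightarrow> pt m x (t + \<sigma> * 0)) (at 0 within UNIV)"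
      unfolding continuous_on_def by (rule bspec) simp
    then show ?thesis by (rule tendsto_within_subset) simp
  qed
  have "\<forall>\<^sub>F \<epsilon> in at_right 0. pt m x (t + \<sigma> * \<epsilon>) \<in> interior D"
    using topological_tendstoD[OF lim open_interior] p by simp
  moreover have "\<forall>\<^sub>F \<epsilon> in at_right 0. \<forall>j\<in>UNIV - {k}. sc \<xi> j (pt m x (t + \<sigma> * \<epsilon>)) < sc \<xi> k (pt m x (t + \<sigma> * \<epsilon>))"
  proof (rule eventually_ball_finite, simp, rule ballI)
    fix j assume j: "j \<in> UNIV - {k}"
    show "\<forall>\<^sub>F \<epsilon> in at_right 0. sc \<xi> j (pt m x (t + \<sigma> * \<epsilon>)) < sc \<xi> k (pt m x (t + \<sigma> * \<epsilon>))"
    proof (cases "j \<in> Act")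
      case True
      have "sc \<xi> j (pt m x (t + \<sigma> * \<epsilon>)) < sc \<xi> k (pt m x (t + \<sigma> * \<epsilon>))" if "\<epsilon> > 0" for \<epsilon>
      proof -
        have "\<epsilon> * (\<sigma> * slope j) < \<epsilon> * (\<sigma> * slope k)" using kmax[OF True] j that by simp
        moreover have "sc \<xi> j ?p = sc \<xi> k ?p" using True k by (simp add: Act_def)
        ultimately show ?thesis by (simp add: score_pt algebra_simps)
      qed
      then show ?thesis using eventually_at_right_less[of "0::real"] by (auto elim: eventually_mono)
    next
      case False
      then have "sc \<xi> j ?p < sc \<xi> k ?p" using p(2) k by (auto simp: Act_def cell_def less_le)
      moreover have "((\<lambda>\<epsilon>. sc \<xi> l (pt m x (t + \<sigma> * \<epsilon>))) \<longlongrightarrow> sc \<xi> l (pt m x (t + \<sigma> * 0))) (at_right 0)" for l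
        unfolding score_def by (intro tendsto_intros lim)
      ultimately show ?thesis by (intro tendsto_eventually_less) auto
    qed
  qed
  ultimately have "\<forall>\<^sub>F \<epsilon> in at_right 0. pt m x (t + \<sigma> * \<epsilon>) \<in> reg \<xi> k"
    by eventually_elim (auto simp: region_score)
  then have "\<exists>\<epsilon>. pt m x (t + \<sigma> * \<epsilon>) \<in> reg \<xi> k"
    using eventually_happens trivial_limit_at_right_real by blast
  then have "reg \<xi> k \<noteq> {}" by blast
  then show ?thesis using pos ki hact[OF k(1) ki] ne p by (auto simp: neighbour_def)
qed

text \<open>
  The neighbours on one side of a nonexceptional slice number at most one, and there is exactly one if
  the endpoint \<open>t\<close> of the interval is not the endpoint \<open>T\<close> cut out by the domain. Here \<open>\<sigma>\<close> selects the upper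
  or lower side.
\<close>

lemma one_sided_sum:
  fixes w :: "'n \<Rightarrow> real"
  assumes \<sigma>: "\<sigma> = 1 \<or> \<sigma> = - 1" and x: "x \<notin> exceptional \<xi> i" and ne: "reg \<xi> i \<noteq> {}"
    and at: "\<And>k. 0 < \<sigma> * (slope k - slope i) \<Longrightarrow> neighbour \<xi> i k x \<Longrightarrow> height \<xi> i k x = t"
    and beyond: "t \<noteq> T \<Longrightarrow> pt m x t \<in> interior D \<and> pt m x t \<in> clo \<xi> i \<and>
        (\<exists>k. 0 < \<sigma> * (slope k - slope i) \<and> height \<xi> i k x = t)"
  defines "S \<equiv> \<Sum>k | 0 < \<sigma> * (slope k - slope i). if neighbour \<xi> i k x then \<rho> (wall \<xi> i k x) * w k else 0"
  obtains (interior) k where "0 < \<sigma> * (slope k - slope i)" "height \<xi> i k x = t" "S = \<rho> (pt m x t) * w k"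
    | (boundary) "t = T" "S = 0"
proof (cases "\<exists>k. 0 < \<sigma> * (slope k - slope i) \<and> neighbour \<xi> i k x")
  case True
  then obtain k where k: "0 < \<sigma> * (slope k - slope i)" "neighbour \<xi> i k x" by blast
  have "\<not> neighbour \<xi> i k' x" if "0 < \<sigma> * (slope k' - slope i)" "k' \<noteq> k" for k'
  proof
    assume n: "neighbour \<xi> i k' x"
    have "0 < (\<sigma> * (slope k - slope i)) * (\<sigma> * (slope k' - slope i))" using k that by simp
    then have "0 < (slope k - slope i) * (slope k' - slope i)" using \<sigma> by (auto simp: algebra_simps)
    moreover have "height \<xi> i k x = height \<xi> i k' x" using at k n that by simp
    ultimately have "x \<in> exceptional \<xi> i"
      unfolding exceptional_def using k(2) n that(2)
      by (intro UnI2 CollectI exI[of _ k] exI[of _ k'] conjI) auto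
    with x show False by blast
  qed
  then have "S = (\<Sum>k'\<in>{k}. if neighbour \<xi> i k' x then \<rho> (wall \<xi> i k' x) * w k' else 0)"
    unfolding S_def using k by (intro sum.mono_neutral_right) auto
  then show thesis using interior[of k] k at by simp
next
  case False
  then have "S = 0" unfolding S_def by (intro sum.neutral) auto
  moreover have "t = T"
    using beyond exists_neighbour_beyond[OF \<sigma> _ _ ne, of x t] False by blast
  ultimately show thesis using boundary by blast
qed

section \<open>Mass and rate of a slice\<close>

definition slice_mass :: "real^'n \<Rightarrow> 'n \<Rightarrow> real \<Rightarrow> real" where
  "slice_mass \<xi> i x = (LINT y|lborel. indicator (reg \<xi> i) (pt m x y) * \<rho> (pt m x y))"

text \<open>
  The derivative of \<open>slice_mass\<close> in direction \<open>h\<close> that the edge weights prescribe.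
\<close>

definition slice_rate :: "real^'n \<Rightarrow> 'n \<Rightarrow> real^'n \<Rightarrow> real \<Rightarrow> real" where
  "slice_rate \<xi> i h x = (\<Sum>k\<in>UNIV - {i}. if neighbour \<xi> i k x
      then \<rho> (wall \<xi> i k x) * ((h $ k - h $ i) / \<bar>slope i - slope k\<bar>) else 0)"

text \<open>
  A common Lipschitz constant, in \<open>\<xi>\<close>, of all heights over walls of \<open>i\<close>; the summand \<open>k = i\<close> is
  \<open>2 / 0 = 0\<close>.
\<close>

definition Lip :: "'n \<Rightarrow> real" where
  "Lip i = (\<Sum>k\<in>UNIV. 2 / \<bar>slope i - slope k\<bar>)"

text \<open>
  Upper endpoint of the interval that the region cuts out of a slice. The index \<open>i\<close> itself, which has no wall
  with \<open>i\<close>, is made to stand for the upper end \<open>B\<close> of the slice of \<open>D\<close>, so that all constraints are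
  indexed uniformly.
\<close>

definition top_end :: "real \<Rightarrow> real^'n \<Rightarrow> 'n \<Rightarrow> real \<Rightarrow> real" where
  "top_end B \<xi> i x = Min ((\<lambda>k. if k = i then B else height \<xi> i k x) ` {k. slope i \<le> slope k})"

definition bot_end :: "real \<Rightarrow> real^'n \<Rightarrow> 'n \<Rightarrow> real \<Rightarrow> real" where
  "bot_end A \<xi> i x = Max ((\<lambda>k. if k = i then A else height \<xi> i k x) ` {k. slope k \<le> slope i})"

lemma Lip_nonneg: "0 \<le> Lip i" unfolding Lip_def by (intro sum_nonneg) auto

lemma component_diff_le: "\<bar>(h $ k - h $ i) / \<bar>slope i - slope k\<bar>\<bar> \<le> 2 / \<bar>slope i - slope k\<bar> * norm h"
proof -
  have "\<bar>h $ k - h $ i\<bar> \<le> 2 * norm h"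
    using component_le_norm_cart[of h k] component_le_norm_cart[of h i] by linarith
  then show ?thesis by (simp add: abs_divide divide_right_mono)
qed

lemma Lip_ge: "2 / \<bar>slope i - slope k\<bar> \<le> Lip i"
  unfolding Lip_def by (rule member_le_sum) auto

lemma height_Lipschitz: "\<bar>height \<xi> i k x - height z i k x\<bar> \<le> Lip i * norm (\<xi> - z)"
proof -
  have "\<bar>height \<xi> i k x - height z i k x\<bar> = \<bar>((\<xi> - z) $ k - (\<xi> - z) $ i) / \<bar>slope i - slope k\<bar>\<bar>"
    unfolding height_increment abs_divide by (simp add: abs_minus_commute)
  also have "\<dots> \<le> 2 / \<bar>slope i - slope k\<bar> * norm (\<xi> - z)" by (rule component_diff_le)
  also have "\<dots> \<le> Lip i * norm (\<xi> - z)" by (rule mult_right_mono[OF Lip_ge]) simp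
  finally show ?thesis .
qed

lemma top_end_Lipschitz: "\<bar>top_end B \<xi> i x - top_end B z i x\<bar> \<le> Lip i * norm (\<xi> - z)"
  unfolding top_end_def
  by (rule abs_Min_diff_le) (use height_Lipschitz Lip_nonneg in auto)

lemma bot_end_uminus: "bot_end A \<xi> i x = - Min ((\<lambda>k. - (if k = i then A else height \<xi> i k x)) ` {k. slope k \<le> slope i})"
  unfolding bot_end_def by (rule Max_image_uminus) auto

lemma bot_end_Lipschitz: "\<bar>bot_end A \<xi> i x - bot_end A z i x\<bar> \<le> Lip i * norm (\<xi> - z)"
proof -
  have "\<bar>Min ((\<lambda>k. - (if k = i then A else height \<xi> i k x)) ` {k. slope k \<le> slope i})
      - Min ((\<lambda>k. - (if k = i then A else height z i k x)) ` {k. slope k \<le> slope i})\<bar> \<le> Lip i * norm (\<xi> - z)"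
    by (rule abs_Min_diff_le) (use height_Lipschitz Lip_nonneg in \<open>auto simp: abs_minus_commute\<close>)
  then show ?thesis unfolding bot_end_uminus by linarith
qed

lemma slice_rate_bound: "\<bar>slice_rate \<xi> i h x\<bar> \<le> M * Lip i * norm h"
proof -
  have "\<bar>slice_rate \<xi> i h x\<bar> \<le> (\<Sum>k\<in>UNIV - {i}. M * (2 / \<bar>slope i - slope k\<bar> * norm h))"
    unfolding slice_rate_def
  proof (rule order_trans[OF sum_abs], rule sum_mono)
    fix k
    have "\<bar>\<rho> (wall \<xi> i k x) * ((h $ k - h $ i) / \<bar>slope i - slope k\<bar>)\<bar> \<le> M * (2 / \<bar>slope i - slope k\<bar> * norm h)"
      unfolding abs_mult using \<rho>_bound M_nonneg component_diff_le by (intro mult_mono) auto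
    then show "\<bar>if neighbour \<xi> i k x then \<rho> (wall \<xi> i k x) * ((h $ k - h $ i) / \<bar>slope i - slope k\<bar>) else 0\<bar>
        \<le> M * (2 / \<bar>slope i - slope k\<bar> * norm h)"
      using M_nonneg by auto
  qed
  also have "\<dots> \<le> (\<Sum>k\<in>UNIV. M * (2 / \<bar>slope i - slope k\<bar> * norm h))"
    using M_nonneg by (intro sum_mono2) auto
  also have "\<dots> = M * Lip i * norm h"
    by (simp add: Lip_def sum_distrib_left sum_distrib_right mult.assoc)
  finally show ?thesis .
qed

text \<open>
  The interior of \<open>D\<close> meets a slice in an open interval. The last clause extends this to \<open>D\<close>: a point of \<open>D\<close> is a limit,
  along the slice, of interior points.
\<close>

lemma interior_slice:
  assumes "pt m x y0 \<in> interior D"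
  obtains A B where "A < B" "{y. pt m x y \<in> interior D} = {A<..<B}" "\<And>y. pt m x y \<in> D \<Longrightarrow> A \<le> y \<and> y \<le> B"
proof -
  let ?S = "{y. pt m x y \<in> interior D}"
  have comb: "(1 - t) *\<^sub>R pt m x y + t *\<^sub>R pt m x y' = pt m x ((1 - t) * y + t * y')" for t y y'
    by (simp add: vec_eq_iff forall_2 algebra_simps)
  have "open ((\<lambda>y. pt m x y) -` interior D)" by (intro open_vimage continuous_intros open_interior)
  then have "open ?S" by (simp add: vimage_def)
  moreover have "convex ?S"
    unfolding convex_alt
  proof (intro ballI allI impI)
    fix y y' t :: real assume "y \<in> ?S" "y' \<in> ?S" "0 \<le> t \<and> t \<le> 1"
    then have "(1 - t) *\<^sub>R pt m x y + t *\<^sub>R pt m x y' \<in> interior D"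
      using convex_interior[OF convex_D] by (simp add: convex_alt)
    then show "(1 - t) *\<^sub>R y + t *\<^sub>R y' \<in> ?S" by (simp add: comb)
  qed
  moreover have "bounded ?S"
  proof -
    obtain R where R: "\<And>p. p \<in> D \<Longrightarrow> norm p \<le> R" using compact_imp_bounded[OF compact_D] by (auto simp: bounded_iff)
    have "\<bar>y\<bar> \<le> R" if "y \<in> ?S" for y
      using R[of "pt m x y"] component_le_norm_cart[of "pt m x y" 2] that interior_subset[of D] by auto
    then show ?thesis by (auto simp: bounded_iff)
  qed
  moreover have "?S \<noteq> {}" using assms by blast
  ultimately obtain A B where AB: "A < B" "?S = {A<..<B}" by (rule open_convex_bounded_real_interval)
  have "A \<le> y \<and> y \<le> B" if y: "pt m x y \<in> D" for y
  proof -
    have seg: "(1 - t) * y0 + t * y \<in> {A<..<B}" if t: "0 \<le> t" "t < 1" for t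
    proof -
      have "pt m x y - (1 - t) *\<^sub>R (pt m x y - pt m x y0) \<in> interior D"
        using convex_D assms y t closure_subset by (intro mem_interior_closure_convex_shrink) auto
      also have "pt m x y - (1 - t) *\<^sub>R (pt m x y - pt m x y0) = pt m x ((1 - t) * y0 + t * y)"
        by (simp add: vec_eq_iff forall_2 algebra_simps)
      finally show ?thesis using AB(2) by blast
    qed
    have lim: "((\<lambda>t. (1 - t) * y0 + t * y) \<longlongrightarrow> (1 - 1) * y0 + 1 * y) (at_left 1)" by (intro tendsto_intros)
    have ev: "\<forall>\<^sub>F t in at_left (1::real). t \<in> {0<..<1}" by (rule eventually_at_left_real) simp
    have "\<forall>\<^sub>F t in at_left 1. (1 - t) * y0 + t * y \<in> {A..B}"
      using ev
    proof eventually_elim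
      case (elim t)
      then show ?case using seg[of t] by auto
    qed
    then have "(1 - 1) * y0 + 1 * y \<in> {A..B}"
      by (rule Lim_in_closed_set[OF closed_atLeastAtMost _ _ lim]) simp
    then show ?thesis by simp
  qed
  with AB show thesis using that by blast
qed

lemma region_slice:
  assumes AB: "{y. pt m x y \<in> interior D} = {A<..<B}"
  shows "pt m x y \<in> reg \<xi> i \<longleftrightarrow> y \<in> {bot_end A \<xi> i x <..< top_end B \<xi> i x}"
proof -
  have up: "y < top_end B \<xi> i x \<longleftrightarrow> y < B \<and> (\<forall>k. slope i < slope k \<longrightarrow> y < height \<xi> i k x)"
    unfolding top_end_def by (subst Min_gr_iff) (auto simp: less_le)
  have lo: "bot_end A \<xi> i x < y \<longleftrightarrow> A < y \<and> (\<forall>k. slope k < slope i \<longrightarrow> height \<xi> i k x < y)"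
    unfolding bot_end_def by (subst Max_less_iff) (auto simp: less_le)
  have sc: "sc \<xi> k (pt m x y) < sc \<xi> i (pt m x y) \<longleftrightarrow>
      (if slope i < slope k then y < height \<xi> i k x else height \<xi> i k x < y)" if "k \<noteq> i" for k
  proof -
    have "slope i \<noteq> slope k" using that by simp
    moreover have "sc \<xi> k (pt m x y) < sc \<xi> i (pt m x y) \<longleftrightarrow> 0 < (slope i - slope k) * (y - height \<xi> i k x)"
      using score_diff[OF that[symmetric], of \<xi> x y] by linarith
    ultimately show ?thesis by (auto simp: zero_less_mult_iff)
  qed
  have "pt m x y \<in> interior D \<longleftrightarrow> A < y \<and> y < B" using AB by (metis greaterThanLessThan_iff mem_Collect_eq)
  then have "pt m x y \<in> reg \<xi> i \<longleftrightarrow> A < y \<and> y < B \<and>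
      (\<forall>k. k \<noteq> i \<longrightarrow> (if slope i < slope k then y < height \<xi> i k x else height \<xi> i k x < y))"
    using sc by (auto simp: region_score)
  also have "\<dots> \<longleftrightarrow> y \<in> {bot_end A \<xi> i x <..< top_end B \<xi> i x}"
    unfolding greaterThanLessThan_iff up lo
    by (auto split: if_splits) (metis less_irrefl linorder_neqE slope_eq_iff)+
  finally show ?thesis .
qed

lemma cell_slice_iff:
  "pt m x y \<in> clo \<xi> i \<longleftrightarrow> pt m x y \<in> D \<and> (\<forall>k. slope i < slope k \<longrightarrow> y \<le> height \<xi> i k x) \<and>
     (\<forall>k. slope k < slope i \<longrightarrow> height \<xi> i k x \<le> y)"
proof -
  have sc: "sc \<xi> k (pt m x y) \<le> sc \<xi> i (pt m x y) \<longleftrightarrow>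
      (if slope i < slope k then y \<le> height \<xi> i k x else height \<xi> i k x \<le> y)" if "k \<noteq> i" for k
  proof -
    have "slope i \<noteq> slope k" using that by simp
    moreover have "sc \<xi> k (pt m x y) \<le> sc \<xi> i (pt m x y) \<longleftrightarrow> 0 \<le> (slope i - slope k) * (y - height \<xi> i k x)"
      using score_diff[OF that[symmetric], of \<xi> x y] by linarith
    ultimately show ?thesis by (auto simp: zero_le_mult_iff)
  qed
  have "(\<forall>k. sc \<xi> k (pt m x y) \<le> sc \<xi> i (pt m x y)) \<longleftrightarrow>
      (\<forall>k. k \<noteq> i \<longrightarrow> (if slope i < slope k then y \<le> height \<xi> i k x else height \<xi> i k x \<le> y))"
    using sc by (metis order_refl)
  also have "\<dots> \<longleftrightarrow> (\<forall>k. slope i < slope k \<longrightarrow> y \<le> height \<xi> i k x) \<and> (\<forall>k. slope k < slope i \<longrightarrow> height \<xi> i k x \<le> y)"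
    by (metis less_asym less_irrefl linorder_neqE slope_eq_iff)
  finally show ?thesis by (auto simp: cell_def)
qed

text \<open>
  The two facts about the upper endpoint that \<open>one_sided_sum\<close> asks for; \<open>bot_side\<close> is the mirror image.
\<close>

lemma top_side:
  assumes AB: "{y. pt m x y \<in> interior D} = {A<..<B}" "\<And>y. pt m x y \<in> D \<Longrightarrow> A \<le> y \<and> y \<le> B"
    and lt: "bot_end A \<xi> i x < top_end B \<xi> i x"
  shows "slope i < slope k \<Longrightarrow> neighbour \<xi> i k x \<Longrightarrow> height \<xi> i k x = top_end B \<xi> i x"
    and "top_end B \<xi> i x \<noteq> B \<Longrightarrow> pt m x (top_end B \<xi> i x) \<in> interior D \<and> pt m x (top_end B \<xi> i x) \<in> clo \<xi> i \<and>
          (\<exists>k. slope i < slope k \<and> height \<xi> i k x = top_end B \<xi> i x)"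
proof -
  let ?t = "top_end B \<xi> i x"
  have tk: "?t \<le> height \<xi> i k x" if "slope i < slope k" for k
    unfolding top_end_def by (rule Min_le) (use that in \<open>auto intro!: rev_image_eqI[of k]\<close>)
  have tB: "?t \<le> B" unfolding top_end_def by (rule Min_le) (auto intro!: rev_image_eqI[of i])
  have bk: "height \<xi> i k x \<le> bot_end A \<xi> i x" if "slope k < slope i" for k
    unfolding bot_end_def by (rule Max_ge) (use that in \<open>auto intro!: rev_image_eqI[of k]\<close>)
  have bA: "A \<le> bot_end A \<xi> i x" unfolding bot_end_def by (rule Max_ge) (auto intro!: rev_image_eqI[of i])
  have tin: "?t \<in> (\<lambda>k. if k = i then B else height \<xi> i k x) ` {k. slope i \<le> slope k}"
    unfolding top_end_def by (rule Min_in) auto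
  show "height \<xi> i k x = ?t" if k: "slope i < slope k" and n: "neighbour \<xi> i k x"
  proof (rule antisym)
    have w: "wall \<xi> i k x \<in> clo \<xi> i" using n by (simp add: neighbour_def)
    from tin obtain j where j: "slope i \<le> slope j" "?t = (if j = i then B else height \<xi> i j x)"
      unfolding image_iff by blast
    show "height \<xi> i k x \<le> ?t"
    proof (cases "j = i")
      case True
      then show ?thesis using j w AB(2) by (simp add: cell_def)
    next
      case False
      then have "slope i < slope j" using j(1) by (simp add: less_le)
      then show ?thesis using w j(2) False by (simp add: cell_slice_iff)
    qed
  qed (rule tk[OF k])
  show "pt m x ?t \<in> interior D \<and> pt m x ?t \<in> clo \<xi> i \<and> (\<exists>k. slope i < slope k \<and> height \<xi> i k x = ?t)"
    if ne: "?t \<noteq> B"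
  proof (intro conjI)
    have "?t \<in> {A<..<B}" using lt bA tB ne by auto
    then show int: "pt m x ?t \<in> interior D" unfolding AB(1)[symmetric] by simp
    have "height \<xi> i k x \<le> ?t" if "slope k < slope i" for k using bk[OF that] lt by linarith
    then show "pt m x ?t \<in> clo \<xi> i" using tk int interior_subset by (auto simp: cell_slice_iff)
    from tin obtain j where j: "slope i \<le> slope j" "?t = (if j = i then B else height \<xi> i j x)"
      unfolding image_iff by blast
    then have "j \<noteq> i" using ne by auto
    then show "\<exists>k. slope i < slope k \<and> height \<xi> i k x = ?t"
      using j by (intro exI[of _ j]) (simp add: less_le)
  qed
qed

lemma bot_side:
  assumes AB: "{y. pt m x y \<in> interior D} = {A<..<B}" "\<And>y. pt m x y \<in> D \<Longrightarrow> A \<le> y \<and> y \<le> B"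
    and lt: "bot_end A \<xi> i x < top_end B \<xi> i x"
  shows "slope k < slope i \<Longrightarrow> neighbour \<xi> i k x \<Longrightarrow> height \<xi> i k x = bot_end A \<xi> i x"
    and "bot_end A \<xi> i x \<noteq> A \<Longrightarrow> pt m x (bot_end A \<xi> i x) \<in> interior D \<and> pt m x (bot_end A \<xi> i x) \<in> clo \<xi> i \<and>
          (\<exists>k. slope k < slope i \<and> height \<xi> i k x = bot_end A \<xi> i x)"
proof -
  let ?t = "bot_end A \<xi> i x"
  have tk: "height \<xi> i k x \<le> ?t" if "slope k < slope i" for k
    unfolding bot_end_def by (rule Max_ge) (use that in \<open>auto intro!: rev_image_eqI[of k]\<close>)
  have tA: "A \<le> ?t" unfolding bot_end_def by (rule Max_ge) (auto intro!: rev_image_eqI[of i])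
  have bk: "top_end B \<xi> i x \<le> height \<xi> i k x" if "slope i < slope k" for k
    unfolding top_end_def by (rule Min_le) (use that in \<open>auto intro!: rev_image_eqI[of k]\<close>)
  have bB: "top_end B \<xi> i x \<le> B" unfolding top_end_def by (rule Min_le) (auto intro!: rev_image_eqI[of i])
  have tin: "?t \<in> (\<lambda>k. if k = i then A else height \<xi> i k x) ` {k. slope k \<le> slope i}"
    unfolding bot_end_def by (rule Max_in) auto
  show "height \<xi> i k x = ?t" if k: "slope k < slope i" and n: "neighbour \<xi> i k x"
  proof (rule antisym)
    have w: "wall \<xi> i k x \<in> clo \<xi> i" using n by (simp add: neighbour_def)
    from tin obtain j where j: "slope j \<le> slope i" "?t = (if j = i then A else height \<xi> i j x)"
      unfolding image_iff by blast
    show "?t \<le> height \<xi> i k x"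
    proof (cases "j = i")
      case True
      then show ?thesis using j w AB(2) by (simp add: cell_def)
    next
      case False
      then have "slope j < slope i" using j(1) by (simp add: less_le)
      then show ?thesis using w j(2) False by (simp add: cell_slice_iff)
    qed
  qed (rule tk[OF k])
  show "pt m x ?t \<in> interior D \<and> pt m x ?t \<in> clo \<xi> i \<and> (\<exists>k. slope k < slope i \<and> height \<xi> i k x = ?t)"
    if ne: "?t \<noteq> A"
  proof (intro conjI)
    have "?t \<in> {A<..<B}" using lt bB tA ne by auto
    then show int: "pt m x ?t \<in> interior D" unfolding AB(1)[symmetric] by simp
    have "?t \<le> height \<xi> i k x" if "slope i < slope k" for k using bk[OF that] lt by linarith
    then show "pt m x ?t \<in> clo \<xi> i" using tk int interior_subset by (auto simp: cell_slice_iff)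
    from tin obtain j where j: "slope j \<le> slope i" "?t = (if j = i then A else height \<xi> i j x)"
      unfolding image_iff by blast
    then have "j \<noteq> i" using ne by auto
    then show "\<exists>k. slope k < slope i \<and> height \<xi> i k x = ?t"
      using j by (intro exI[of _ j]) (simp add: less_le)
  qed
qed

lemma eventually_top_active:
  assumes X: "X \<longlonglongrightarrow> z"
  shows "\<forall>\<^sub>F n in sequentially. (\<forall>k. slope i < slope k \<longrightarrow> height (X n) i k x = top_end B (X n) i x \<longrightarrow>
      height z i k x = top_end B z i x) \<and> (top_end B (X n) i x = B \<longrightarrow> top_end B z i x = B)"
proof -
  have lim: "(\<lambda>n. if k = i then B else height (X n) i k x) \<longlonglongrightarrow> (if k = i then B else height z i k x)" for k
    using X unfolding height_def divide_inverse by (auto intro!: tendsto_intros)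
  have "\<forall>\<^sub>F n in sequentially. \<forall>k\<in>{k. slope i \<le> slope k}.
      (if k = i then B else height (X n) i k x) = top_end B (X n) i x \<longrightarrow>
      (if k = i then B else height z i k x) = top_end B z i x"
    unfolding top_end_def by (rule eventually_Min_active) (use lim in auto)
  then show ?thesis
  proof eventually_elim
    case (elim n)
    show ?case
    proof (intro conjI allI impI)
      fix k assume "slope i < slope k" "height (X n) i k x = top_end B (X n) i x"
      then show "height z i k x = top_end B z i x" using bspec[OF elim, of k] by (auto split: if_splits)
    next
      assume "top_end B (X n) i x = B"
      then show "top_end B z i x = B" using bspec[OF elim, of i] by simp
    qed
  qed
qed

lemma eventually_bot_active:
  assumes X: "X \<longlonglongrightarrow> z"
  shows "\<forall>\<^sub>F n in sequentially. (\<forall>k. slope k < slope i \<longrightarrow> height (X n) i k x = bot_end A (X n) i x \<longrightarrow>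
      height z i k x = bot_end A z i x) \<and> (bot_end A (X n) i x = A \<longrightarrow> bot_end A z i x = A)"
proof -
  have lim: "(\<lambda>n. - (if k = i then A else height (X n) i k x)) \<longlonglongrightarrow> - (if k = i then A else height z i k x)" for k
    using X unfolding height_def divide_inverse by (auto intro!: tendsto_intros)
  have "\<forall>\<^sub>F n in sequentially. \<forall>k\<in>{k. slope k \<le> slope i}.
      - (if k = i then A else height (X n) i k x) = - bot_end A (X n) i x \<longrightarrow>
      - (if k = i then A else height z i k x) = - bot_end A z i x"
    unfolding bot_end_uminus minus_minus by (rule eventually_Min_active) (use lim in auto)
  then show ?thesis
  proof eventually_elim
    case (elim n)
    show ?case
    proof (intro conjI allI impI)
      fix k assume "slope k < slope i" "height (X n) i k x = bot_end A (X n) i x"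
      then show "height z i k x = bot_end A z i x" using bspec[OF elim, of k] by (auto split: if_splits)
    next
      assume "bot_end A (X n) i x = A"
      then show "bot_end A z i x = A" using bspec[OF elim, of i] by simp
    qed
  qed
qed

text \<open>
  Walls move affinely with \<open>\<xi>\<close>, so each weight times increment is exactly the displacement of the wall, upwards
  counted positively on the upper side and negatively on the lower side.
\<close>

lemma slice_rate_eq:
  "slice_rate \<xi> i (\<xi> - z) x =
    (\<Sum>k | 0 < 1 * (slope k - slope i). if neighbour \<xi> i k x then \<rho> (wall \<xi> i k x) * (height \<xi> i k x - height z i k x) else 0) -
    (\<Sum>k | 0 < - 1 * (slope k - slope i). if neighbour \<xi> i k x then \<rho> (wall \<xi> i k x) * (height \<xi> i k x - height z i k x) else 0)"
    (is "_ = ?U - ?L")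
proof -
  let ?f = "\<lambda>k. if neighbour \<xi> i k x then \<rho> (wall \<xi> i k x) * (((\<xi> - z) $ k - (\<xi> - z) $ i) / \<bar>slope i - slope k\<bar>) else 0"
  have "UNIV - {i} = {k. slope i < slope k} \<union> {k. slope k < slope i}"
    using slope_eq_iff by (auto simp: neq_iff dest: less_imp_neq) (metis linorder_neqE slope_eq_iff)
  then have "slice_rate \<xi> i (\<xi> - z) x = sum ?f ({k. slope i < slope k} \<union> {k. slope k < slope i})"
    by (simp add: slice_rate_def)
  also have "\<dots> = sum ?f {k. slope i < slope k} + sum ?f {k. slope k < slope i}"
    by (intro sum.union_disjoint) auto
  also have "sum ?f {k. slope i < slope k} = ?U"
  proof (rule sum.cong)
    fix k assume "k \<in> {k. 0 < 1 * (slope k - slope i)}"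
    then have "((\<xi> - z) $ k - (\<xi> - z) $ i) / \<bar>slope i - slope k\<bar> = height \<xi> i k x - height z i k x"
      by (simp add: height_increment minus_divide_divide[symmetric, of "_ - _" "slope i - slope k"])
    then show "?f k = (if neighbour \<xi> i k x then \<rho> (wall \<xi> i k x) * (height \<xi> i k x - height z i k x) else 0)" by simp
  qed auto
  also have "sum ?f {k. slope k < slope i} = - ?L"
    unfolding sum_negf[symmetric]
  proof (rule sum.cong)
    fix k assume "k \<in> {k. 0 < - 1 * (slope k - slope i)}"
    then have "((\<xi> - z) $ k - (\<xi> - z) $ i) / \<bar>slope i - slope k\<bar> = - (height \<xi> i k x - height z i k x)"
      by (simp add: height_increment minus_divide_left)
    then show "?f k = - (if neighbour \<xi> i k x then \<rho> (wall \<xi> i k x) * (height \<xi> i k x - height z i k x) else 0)"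
      by (simp add: right_diff_distrib)
  qed auto
  finally show ?thesis by simp
qed

lemma slice_rate_empty:
  assumes "x \<notin> exceptional \<xi> i" "\<And>y. pt m x y \<notin> reg \<xi> i"
  shows "slice_rate \<xi> i h x = 0"
  using assms unfolding slice_rate_def exceptional_def by (intro sum.neutral) auto

lemma isCont_density_slice: "isCont (\<lambda>y. \<rho> (pt m x y)) y"
proof -
  have "continuous_on UNIV (\<lambda>y. \<rho> (pt m x y))"
    by (intro continuous_on_compose2[OF cont_\<rho>] continuous_intros) auto
  then show ?thesis by (simp add: continuous_on_eq_continuous_at)
qed

lemma slice_primitive:
  obtains F where "\<And>y. (F has_real_derivative \<rho> (pt m x y)) (at y)" "\<And>y y'. \<bar>F y - F y'\<bar> \<le> M * \<bar>y - y'\<bar>"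
proof -
  obtain F where F: "\<And>y. (F has_vector_derivative \<rho> (pt m x y)) (at y)"
    using einterval_antiderivative[of "-\<infinity>" "\<infinity>" "\<lambda>y. \<rho> (pt m x y)"] isCont_density_slice by auto
  then have F': "(F has_real_derivative \<rho> (pt m x y)) (at y)" for y
    by (simp add: has_real_derivative_iff_has_vector_derivative)
  have "\<bar>F y - F y'\<bar> \<le> M * \<bar>y - y'\<bar>" for y y'
    using field_differentiable_bound[of UNIV F "\<lambda>y. \<rho> (pt m x y)" M y y'] F' \<rho>_bound by auto
  with F' show thesis by (rule that)
qed

lemma slice_mass_primitive:
  assumes F: "\<And>y. (F has_real_derivative \<rho> (pt m x y)) (at y)"
    and AB: "{y. pt m x y \<in> interior D} = {A<..<B}"
  shows "slice_mass \<xi> i x = F (max (bot_end A \<xi> i x) (top_end B \<xi> i x)) - F (bot_end A \<xi> i x)"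
proof -
  from lborel_integral_open_interval_FTC[OF F isCont_density_slice]
  have "(LINT y|lborel. indicator {bot_end A \<xi> i x <..< top_end B \<xi> i x} y * \<rho> (pt m x y))
      = F (max (bot_end A \<xi> i x) (top_end B \<xi> i x)) - F (bot_end A \<xi> i x)" .
  moreover have "indicator {bot_end A \<xi> i x <..< top_end B \<xi> i x} y = (indicator (reg \<xi> i) (pt m x y) :: real)" for y
    using region_slice[OF AB, of y \<xi> i] by (simp add: indicator_def)
  ultimately show ?thesis by (simp add: slice_mass_def)
qed

lemma slice_mass_empty: "(\<And>y. pt m x y \<notin> interior D) \<Longrightarrow> slice_mass \<xi> i x = 0"
  by (simp add: slice_mass_def region_score)

text \<open>
  This uniform bound supplies both the dominating function for the remainders and Lipschitz continuity of the mass
  vector.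
\<close>

lemma slice_mass_diff_bound: "\<bar>slice_mass \<xi> i x - slice_mass z i x\<bar> \<le> 2 * M * Lip i * norm (\<xi> - z)"
proof (cases "\<exists>y. pt m x y \<in> interior D")
  case True
  then obtain y0 where y0: "pt m x y0 \<in> interior D" ..
  obtain A B where "A < B" and AB: "{y. pt m x y \<in> interior D} = {A<..<B}"
    and "\<And>y. pt m x y \<in> D \<Longrightarrow> A \<le> y \<and> y \<le> B"
    by (rule interior_slice[OF y0], rule that)
  obtain F where F: "\<And>y. (F has_real_derivative \<rho> (pt m x y)) (at y)" "\<And>y y'. \<bar>F y - F y'\<bar> \<le> M * \<bar>y - y'\<bar>"
    by (rule slice_primitive[of x], rule that)
  let ?hi = "top_end B \<xi> i x" and ?hi' = "top_end B z i x" and ?lo = "bot_end A \<xi> i x" and ?lo' = "bot_end A z i x"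
  have 1: "\<bar>?hi - ?hi'\<bar> \<le> Lip i * norm (\<xi> - z)" "\<bar>?lo - ?lo'\<bar> \<le> Lip i * norm (\<xi> - z)"
    by (rule top_end_Lipschitz bot_end_Lipschitz)+
  then have 2: "\<bar>max ?lo ?hi - max ?lo' ?hi'\<bar> \<le> Lip i * norm (\<xi> - z)" by (auto simp: max_def abs_le_iff)
  have "\<bar>F (max ?lo ?hi) - F (max ?lo' ?hi')\<bar> \<le> M * (Lip i * norm (\<xi> - z))"
    using F(2) mult_left_mono[OF 2 M_nonneg] by (rule order_trans)
  moreover have "\<bar>F ?lo - F ?lo'\<bar> \<le> M * (Lip i * norm (\<xi> - z))"
    using F(2) mult_left_mono[OF 1(2) M_nonneg] by (rule order_trans)
  ultimately show ?thesis unfolding slice_mass_primitive[OF F(1) AB] by (simp add: abs_le_iff)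
next
  case False
  then show ?thesis using slice_mass_empty M_nonneg Lip_nonneg by simp
qed

text \<open>
  For large \<open>n\<close> an active wall of \<open>X n\<close> is active at \<open>z\<close>, so its displacement is the displacement of
  the endpoint of the interval; likewise, an endpoint on the boundary of \<open>D\<close> was there at \<open>z\<close>
  and has not moved. Hence \<open>slice_rate\<close> is density times displacement at both ends.
\<close>

lemma slice_semismooth:
  assumes X: "X \<longlonglongrightarrow> z" and x: "\<And>n. x \<notin> exceptional (X n) i"
  shows "(\<lambda>n. (slice_mass (X n) i x - slice_mass z i x - slice_rate (X n) i (X n - z) x) / norm (X n - z)) \<longlonglongrightarrow> 0"
proof (cases "\<exists>y. pt m x y \<in> interior D")
  case False
  then have "\<And>y n. pt m x y \<notin> reg (X n) i" by (auto simp: region_score)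
  then have "slice_rate (X n) i (X n - z) x = 0" for n using slice_rate_empty x by blast
  with False show ?thesis by (simp add: slice_mass_empty)
next
  case True
  then obtain y0 where y0: "pt m x y0 \<in> interior D" ..
  obtain A B where "A < B" and AB: "{y. pt m x y \<in> interior D} = {A<..<B}" "\<And>y. pt m x y \<in> D \<Longrightarrow> A \<le> y \<and> y \<le> B"
    by (rule interior_slice[OF y0], rule that)
  obtain F where F: "\<And>y. (F has_real_derivative \<rho> (pt m x y)) (at y)"
    and "\<And>y y'. \<bar>F y - F y'\<bar> \<le> M * \<bar>y - y'\<bar>"
    by (rule slice_primitive[of x], rule that)
  have null: "(\<lambda>n. Lip i * norm (X n - z)) \<longlonglongrightarrow> 0"
    using tendsto_mult_right_zero[OF tendsto_norm_zero[OF LIM_zero[OF X]]] .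
  have hi: "(\<lambda>n. top_end B (X n) i x) \<longlonglongrightarrow> top_end B z i x"
    by (rule LIM_zero_cancel, rule Lim_null_comparison[OF _ null]) (simp add: top_end_Lipschitz)
  have lo: "(\<lambda>n. bot_end A (X n) i x) \<longlonglongrightarrow> bot_end A z i x"
    by (rule LIM_zero_cancel, rule Lim_null_comparison[OF _ null]) (simp add: bot_end_Lipschitz)
  show ?thesis
    unfolding slice_mass_primitive[OF F AB(1)]
  proof (rule clipped_primitive_increment[OF F isCont_density_slice hi _ lo])
    show "\<bar>top_end B (X n) i x - top_end B z i x\<bar> \<le> Lip i * norm (X n - z)" for n by (rule top_end_Lipschitz)
    show "\<bar>bot_end A (X n) i x - bot_end A z i x\<bar> \<le> Lip i * norm (X n - z)" for n by (rule bot_end_Lipschitz)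
    show "0 \<le> Lip i" by (rule Lip_nonneg)
    show "slice_rate (X n) i (X n - z) x = 0" if "top_end B (X n) i x \<le> bot_end A (X n) i x" for n
      using that region_slice[OF AB(1), of _ "X n" i] by (intro slice_rate_empty x) auto
    show "\<forall>\<^sub>F n in sequentially. bot_end A (X n) i x < top_end B (X n) i x \<longrightarrow>
        slice_rate (X n) i (X n - z) x =
          \<rho> (pt m x (top_end B (X n) i x)) * (top_end B (X n) i x - top_end B z i x) -
          \<rho> (pt m x (bot_end A (X n) i x)) * (bot_end A (X n) i x - bot_end A z i x)"
      using eventually_top_active[OF X, of i x B] eventually_bot_active[OF X, of i x A]
    proof eventually_elim
      case (elim n)
      show ?case
      proof
        assume lt: "bot_end A (X n) i x < top_end B (X n) i x"
        then obtain y where "y \<in> {bot_end A (X n) i x <..< top_end B (X n) i x}" using dense by auto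
        then have ne: "reg (X n) i \<noteq> {}" using region_slice[OF AB(1), of y "X n" i] by blast
        let ?w = "\<lambda>k. height (X n) i k x - height z i k x"
        have up: "(\<Sum>k | 0 < 1 * (slope k - slope i). if neighbour (X n) i k x then \<rho> (wall (X n) i k x) * ?w k else 0)
            = \<rho> (pt m x (top_end B (X n) i x)) * (top_end B (X n) i x - top_end B z i x)"
        proof (rule one_sided_sum[of 1 x "X n" i "top_end B (X n) i x" B ?w])
          fix k assume "0 < 1 * (slope k - slope i)" "height (X n) i k x = top_end B (X n) i x"
            "(\<Sum>k | 0 < 1 * (slope k - slope i). if neighbour (X n) i k x then \<rho> (wall (X n) i k x) * ?w k else 0)
              = \<rho> (pt m x (top_end B (X n) i x)) * ?w k"
          then show ?thesis using elim(1) by simp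
        next
          assume "top_end B (X n) i x = B"
            "(\<Sum>k | 0 < 1 * (slope k - slope i). if neighbour (X n) i k x then \<rho> (wall (X n) i k x) * ?w k else 0) = 0"
          then show ?thesis using elim(1) by simp
        qed (use x ne top_side[OF AB lt] in auto)
        have dn: "(\<Sum>k | 0 < - 1 * (slope k - slope i). if neighbour (X n) i k x then \<rho> (wall (X n) i k x) * ?w k else 0)
            = \<rho> (pt m x (bot_end A (X n) i x)) * (bot_end A (X n) i x - bot_end A z i x)"
        proof (rule one_sided_sum[of "- 1" x "X n" i "bot_end A (X n) i x" A ?w])
          fix k assume "0 < - 1 * (slope k - slope i)" "height (X n) i k x = bot_end A (X n) i x"
            "(\<Sum>k | 0 < - 1 * (slope k - slope i). if neighbour (X n) i k x then \<rho> (wall (X n) i k x) * ?w k else 0)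
              = \<rho> (pt m x (bot_end A (X n) i x)) * ?w k"
          then show ?thesis using elim(2) by simp
        next
          assume "bot_end A (X n) i x = A"
            "(\<Sum>k | 0 < - 1 * (slope k - slope i). if neighbour (X n) i k x then \<rho> (wall (X n) i k x) * ?w k else 0) = 0"
          then show ?thesis using elim(2) by simp
        qed (use x ne bot_side[OF AB lt] in auto)
        show "slice_rate (X n) i (X n - z) x =
          \<rho> (pt m x (top_end B (X n) i x)) * (top_end B (X n) i x - top_end B z i x) -
          \<rho> (pt m x (bot_end A (X n) i x)) * (bot_end A (X n) i x - bot_end A z i x)"
          unfolding slice_rate_eq up dn ..
      qed
    qed
  qed simp
qed

section \<open>The mass vector and its generalised derivative\<close>

definition ud :: "(real^2) measure" where
  "ud = density (restrict_space lborel D) (\<lambda>x. ennreal (\<rho> x))"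

lemma D_borel: "D \<in> sets borel" using closed_D by auto

lemma region_subset_D: "reg \<xi> i \<subseteq> D" using interior_subset by (auto simp: region_score)

lemma integrable_region: "integrable lborel (\<lambda>p. indicator (reg \<xi> i) p * \<rho> p)"
proof (rule Bochner_Integration.integrable_bound)
  have "emeasure lborel D < \<infinity>" using compact_D by (intro emeasure_bounded_finite compact_imp_bounded)
  then show "integrable lborel (\<lambda>p. M * indicator D p :: real)"
    using D_borel by (intro integrable_mult_right integrable_real_indicator) auto
  have "\<rho> \<in> borel_measurable borel" using cont_\<rho> by (rule borel_measurable_continuous_onI)
  moreover have "reg \<xi> i \<in> sets borel" by (rule borel_open[OF open_region])
  ultimately show "(\<lambda>p. indicator (reg \<xi> i) p * \<rho> p) \<in> borel_measurable lborel" by measurable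
  show "AE p in lborel. norm (indicator (reg \<xi> i) p * \<rho> p) \<le> norm (M * indicator D p)"
    using \<rho>_bound M_nonneg region_subset_D by (intro AE_I2) (auto simp: indicator_def)
qed

lemma measure_region: "measure ud (reg \<xi> i) = (LINT p|lborel. indicator (reg \<xi> i) p * \<rho> p)"
proof -
  have \<rho>m: "\<rho> \<in> borel_measurable borel" using cont_\<rho> by (rule borel_measurable_continuous_onI)
  have "reg \<xi> i \<in> sets borel" by (rule borel_open[OF open_region])
  then have sets: "reg \<xi> i \<in> sets (restrict_space lborel D)"
    using D_borel region_subset_D by (subst sets_restrict_space_iff) auto
  have nn: "0 \<le> indicator (reg \<xi> i) p * \<rho> p" for p
    using \<rho>_nonneg region_subset_D by (auto simp: indicator_def)
  have "emeasure ud (reg \<xi> i) = (\<integral>\<^sup>+ p. ennreal (\<rho> p) * indicator (reg \<xi> i) p \<partial>restrict_space lborel D)"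
    unfolding ud_def using \<rho>m by (intro emeasure_density sets measurable_restrict_space1) auto
  also have "\<dots> = (\<integral>\<^sup>+ p. ennreal (\<rho> p) * indicator (reg \<xi> i) p * indicator D p \<partial>lborel)"
    using D_borel by (intro nn_integral_restrict_space) auto
  also have "\<dots> = (\<integral>\<^sup>+ p. ennreal (indicator (reg \<xi> i) p * \<rho> p) \<partial>lborel)"
    using region_subset_D by (intro nn_integral_cong) (auto simp: indicator_def)
  also have "\<dots> = ennreal (LINT p|lborel. indicator (reg \<xi> i) p * \<rho> p)"
    using nn by (intro nn_integral_eq_integral integrable_region) auto
  finally show ?thesis using nn by (simp add: measure_def integral_nonneg)
qed

lemma integrable_slice_mass: "integrable lborel (slice_mass \<xi> i)"
  and measure_region_slices: "measure ud (reg \<xi> i) = (LINT x|lborel. slice_mass \<xi> i x)"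
  using integral_slices[OF integrable_region[of \<xi> i], of m] unfolding measure_region slice_mass_def[abs_def] by simp_all

lemma slice_range: obtains R where "0 \<le> R" "\<forall>x y. pt m x y \<in> D \<longrightarrow> \<bar>x\<bar> \<le> R"
proof -
  have "compact ((\<lambda>p. p $ 1 - m * p $ 2) ` D)"
    by (intro compact_continuous_image continuous_intros compact_D)
  then obtain R where R: "\<And>p. p \<in> D \<Longrightarrow> \<bar>p $ 1 - m * p $ 2\<bar> \<le> R"
    using compact_imp_bounded by (force simp: bounded_iff)
  have "\<bar>x\<bar> \<le> max R 0" if "pt m x y \<in> D" for x y using R[OF that] by simp
  then show thesis using that[of "max R 0"] by auto
qed

text \<open>
  A continuous nonnegative density with vanishing integral over an open set vanishes on that set and on
  its closure, which contains the edges. So setting the rows of massless regions to zero, as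
  \<open>Theta\<close> does, changes nothing, and \<open>Theta\<close> is symmetric.
\<close>

lemma edge_weight_zero:
  assumes "measure ud (reg \<xi> i) = 0" shows "edge_weight \<rho> a D \<xi> i k = 0"
proof -
  have nn: "0 \<le> indicator (reg \<xi> i) p * \<rho> p" for p
    using \<rho>_nonneg region_subset_D by (auto simp: indicator_def)
  have "AE p in lborel. indicator (reg \<xi> i) p * \<rho> p = 0"
    using integral_nonneg_eq_0_iff_AE[OF integrable_region] nn assms unfolding measure_region by auto
  then have "AE p in lebesgue. indicator (reg \<xi> i) p * \<rho> p = 0" by (simp add: AE_completion_iff)
  moreover define N where "N = {p \<in> reg \<xi> i. \<rho> p \<noteq> 0}"
  ultimately have "AE p in lebesgue. p \<notin> N" by (auto elim!: eventually_mono)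
  moreover have oN: "open N"
  proof -
    have "N = reg \<xi> i \<inter> \<rho> -` (- {0})" by (auto simp: N_def)
    then show ?thesis using cont_\<rho> open_region by (auto intro!: open_Int open_vimage)
  qed
  ultimately have "negligible N"
    unfolding negligible_iff_null_sets by (subst AE_iff_null_sets) auto
  then have "N = {}" using oN open_not_negligible by blast
  then have "reg \<xi> i \<subseteq> \<rho> -` {0}" by (auto simp: N_def)
  moreover have "closed (\<rho> -` {0})" using cont_\<rho> by (intro closed_vimage) auto
  ultimately have "closure (reg \<xi> i) \<subseteq> \<rho> -` {0}" by (rule closure_minimal)
  then have "\<rho> p = 0" if "p \<in> common_edge a D \<xi> i k" for p using that by (auto simp: common_edge_def)
  then have "(LINT p:common_edge a D \<xi> i k|hausdorff1. \<rho> p) = 0"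
    unfolding set_lebesgue_integral_def
    by (intro integral_eq_zero_AE AE_I2) (auto simp: indicator_def)
  then show ?thesis by (simp add: edge_weight_def)
qed

lemma Theta_mult: "(Theta ud \<rho> a D \<xi> *v h) $ i = (\<Sum>k\<in>UNIV - {i}. edge_weight \<rho> a D \<xi> i k * (h $ k - h $ i))"
proof (cases "measure ud (reg \<xi> i) > 0")
  case True
  let ?w = "edge_weight \<rho> a D \<xi> i"
  have "(Theta ud \<rho> a D \<xi> *v h) $ i = (\<Sum>j\<in>UNIV. (if j = i then - sum ?w (UNIV - {i}) else ?w j) * h $ j)"
    using True by (simp add: matrix_vector_mult_def Theta_def)
  also have "\<dots> = - sum ?w (UNIV - {i}) * h $ i + (\<Sum>j\<in>UNIV - {i}. ?w j * h $ j)"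
    by (subst sum.remove[of _ i]) auto
  also have "\<dots> = (\<Sum>k\<in>UNIV - {i}. ?w k * (h $ k - h $ i))"
    by (simp add: right_diff_distrib sum_subtractf sum_distrib_right)
  finally show ?thesis .
next
  case False
  then have "measure ud (reg \<xi> i) = 0" using measure_nonneg[of ud "reg \<xi> i"] by linarith
  then show ?thesis using edge_weight_zero False by (simp add: matrix_vector_mult_def Theta_def)
qed

lemma neighbour_in_D: "neighbour \<xi> i k x \<Longrightarrow> wall \<xi> i k x \<in> D"
  by (simp add: neighbour_def cell_def)

lemma integrable_edge: "integrable lborel (\<lambda>x. if neighbour \<xi> i k x then \<rho> (wall \<xi> i k x) else 0)"
proof -
  obtain R where R: "\<forall>x y. pt m x y \<in> D \<longrightarrow> \<bar>x\<bar> \<le> R" by (rule slice_range)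
  then have "{x. neighbour \<xi> i k x} \<subseteq> {- R..R}" using neighbour_in_D by (fastforce simp: abs_le_iff)
  then have "bounded {x. neighbour \<xi> i k x}" using bounded_subset bounded_closed_interval by blast
  then have "compact {x. neighbour \<xi> i k x}" using closed_neighbour by (simp add: compact_eq_bounded_closed)
  moreover have "continuous_on {x. neighbour \<xi> i k x} (\<lambda>x. \<rho> (wall \<xi> i k x))"
    by (intro continuous_on_compose2[OF cont_\<rho>] continuous_wall) auto
  ultimately have "integrable lborel (\<lambda>x. indicator {x. neighbour \<xi> i k x} x *\<^sub>R \<rho> (wall \<xi> i k x))"
    by (rule borel_integrable_compact)
  then show ?thesis by (rule Bochner_Integration.integrable_cong[THEN iffD1, rotated -1]) (auto simp: indicator_def)
qed

lemma integrable_slice_rate: "integrable lborel (slice_rate \<xi> i h)"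
  and Theta_slices: "(Theta ud \<rho> a D \<xi> *v h) $ i = (LINT x|lborel. slice_rate \<xi> i h x)"
proof -
  have eq: "slice_rate \<xi> i h = (\<lambda>x. \<Sum>k\<in>UNIV - {i}. (if neighbour \<xi> i k x then \<rho> (wall \<xi> i k x) else 0) *
      ((h $ k - h $ i) / \<bar>slope i - slope k\<bar>))"
    unfolding slice_rate_def by (intro ext sum.cong) auto
  show "integrable lborel (slice_rate \<xi> i h)"
    unfolding eq by (intro Bochner_Integration.integrable_sum integrable_mult_left integrable_edge)
  have "(LINT x|lborel. slice_rate \<xi> i h x) = (\<Sum>k\<in>UNIV - {i}.
      (LINT x|lborel. (if neighbour \<xi> i k x then \<rho> (wall \<xi> i k x) else 0)) * ((h $ k - h $ i) / \<bar>slope i - slope k\<bar>))"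
    unfolding eq by (subst Bochner_Integration.integral_sum) (auto intro!: integrable_mult_left integrable_edge)
  also have "\<dots> = (\<Sum>k\<in>UNIV - {i}. edge_weight \<rho> a D \<xi> i k * (h $ k - h $ i))"
    by (intro sum.cong refl) (auto simp: edge_weight_slices)
  finally show "(Theta ud \<rho> a D \<xi> *v h) $ i = (LINT x|lborel. slice_rate \<xi> i h x)"
    unfolding Theta_mult by simp
qed

lemma edge_weight_commute: "edge_weight \<rho> a D \<xi> i k = edge_weight \<rho> a D \<xi> k i"
  by (auto simp: edge_weight_def share_edge_def common_edge_def Int_commute norm_minus_commute)

lemma edge_weight_bounded: "\<exists>K. \<forall>\<xi> i k. i \<noteq> k \<longrightarrow> 0 \<le> edge_weight \<rho> a D \<xi> i k \<and> edge_weight \<rho> a D \<xi> i k \<le> K"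
proof -
  obtain R where R: "0 \<le> R" "\<forall>x y. pt m x y \<in> D \<longrightarrow> \<bar>x\<bar> \<le> R" by (rule slice_range)
  have "0 \<le> edge_weight \<rho> a D \<xi> i k \<and> edge_weight \<rho> a D \<xi> i k \<le> M * (2 * R) * (\<Sum>i\<in>UNIV. Lip i)" if ik: "i \<noteq> k" for \<xi> i k
  proof
    let ?f = "\<lambda>x. if neighbour \<xi> i k x then \<rho> (wall \<xi> i k x) else 0"
    have "0 \<le> ?f x" for x using neighbour_in_D \<rho>_nonneg by auto
    then show "0 \<le> edge_weight \<rho> a D \<xi> i k" unfolding edge_weight_slices[OF ik]
      by (intro divide_nonneg_nonneg integral_nonneg) auto
    have "integral\<^sup>L lborel ?f \<le> (LINT x|lborel. M * indicator {- R..R} x)"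
    proof (rule integral_mono[OF integrable_edge])
      show "integrable lborel (\<lambda>x. M * indicator {- R..R} x)"
        using R(1) by (intro integrable_mult_right integrable_real_indicator) auto
      fix x
      have "\<rho> (wall \<xi> i k x) \<le> M" using \<rho>_bound[of "wall \<xi> i k x"] by simp
      then show "?f x \<le> M * indicator {- R..R} x"
        using neighbour_in_D[of \<xi> i k x] R(2) M_nonneg by (force simp: indicator_def abs_le_iff)
    qed
    also have "\<dots> = M * (2 * R)" using R(1) by simp
    finally have "edge_weight \<rho> a D \<xi> i k \<le> M * (2 * R) * (1 / \<bar>slope i - slope k\<bar>)"
      unfolding edge_weight_slices[OF ik] by (simp add: divide_right_mono)
    also have "1 / \<bar>slope i - slope k\<bar> \<le> 2 / \<bar>slope i - slope k\<bar>" by (simp add: divide_right_mono)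
    also have "\<dots> \<le> Lip i" by (rule Lip_ge)
    also have "Lip i \<le> (\<Sum>i\<in>UNIV. Lip i)" by (rule member_le_sum) (auto simp: Lip_nonneg)
    finally show "edge_weight \<rho> a D \<xi> i k \<le> M * (2 * R) * (\<Sum>i\<in>UNIV. Lip i)"
      using M_nonneg R(1) by (simp add: mult_left_mono)
  qed
  then show ?thesis by blast
qed

lemma u_tilde_Lipschitz: "\<exists>C. \<forall>\<xi> z. norm (u_tilde ud a D \<xi> - u_tilde ud a D z) \<le> C * norm (\<xi> - z)"
proof -
  obtain R where R: "0 \<le> R" "\<forall>x y. pt m x y \<in> D \<longrightarrow> \<bar>x\<bar> \<le> R" by (rule slice_range)
  have outside: "slice_mass \<xi> i x = 0" if "x \<notin> {- R..R}" for \<xi> i x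
    using that R(2) interior_subset[of D] by (intro slice_mass_empty) (force simp: abs_le_iff)
  have comp: "\<bar>measure ud (reg \<xi> i) - measure ud (reg z i)\<bar> \<le> 4 * M * Lip i * R * norm (\<xi> - z)" for \<xi> z i
  proof -
    have "\<bar>measure ud (reg \<xi> i) - measure ud (reg z i)\<bar> = \<bar>LINT x|lborel. slice_mass \<xi> i x - slice_mass z i x\<bar>"
      unfolding measure_region_slices by (simp add: integrable_slice_mass)
    also have "\<dots> \<le> (LINT x|lborel. \<bar>slice_mass \<xi> i x - slice_mass z i x\<bar>)" by (rule integral_abs_bound)
    also have "\<dots> \<le> (LINT x|lborel. 2 * M * Lip i * norm (\<xi> - z) * indicator {- R..R} x)"
    proof (rule integral_mono)
      show "integrable lborel (\<lambda>x. 2 * M * Lip i * norm (\<xi> - z) * indicator {- R..R} x)"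
        using R(1) by (intro integrable_mult_right integrable_real_indicator) auto
      show "\<bar>slice_mass \<xi> i x - slice_mass z i x\<bar> \<le> 2 * M * Lip i * norm (\<xi> - z) * indicator {- R..R} x" for x
        using slice_mass_diff_bound[of \<xi> i x z] outside[of x \<xi> i] outside[of x z i] by (auto simp: indicator_def)
    qed (auto intro!: integrable_slice_mass)
    also have "\<dots> = 4 * M * Lip i * R * norm (\<xi> - z)" using R(1) by simp
    finally show ?thesis .
  qed
  have "norm (u_tilde ud a D \<xi> - u_tilde ud a D z) \<le> (\<Sum>i\<in>UNIV. 4 * M * Lip i * R) * norm (\<xi> - z)" for \<xi> z
  proof -
    have "norm (u_tilde ud a D \<xi> - u_tilde ud a D z) \<le> (\<Sum>i\<in>UNIV. \<bar>(u_tilde ud a D \<xi> - u_tilde ud a D z) $ i\<bar>)"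
      by (rule norm_le_l1_cart)
    also have "\<dots> \<le> (\<Sum>i\<in>UNIV. 4 * M * Lip i * R * norm (\<xi> - z))"
      by (intro sum_mono) (simp add: u_tilde_def comp)
    finally show ?thesis by (simp add: sum_distrib_right)
  qed
  then show ?thesis by blast
qed

lemma u_tilde_bounded: "\<exists>b. \<forall>\<xi>. norm (u_tilde ud a D \<xi>) \<le> b"
proof -
  have fin: "emeasure lborel D < \<infinity>" using compact_D by (intro emeasure_bounded_finite compact_imp_bounded)
  have "measure ud (reg \<xi> i) \<le> M * measure lborel D" for \<xi> i
  proof -
    have "measure ud (reg \<xi> i) \<le> (LINT p|lborel. M * indicator D p)"
      unfolding measure_region
    proof (rule integral_mono[OF integrable_region])
      show "integrable lborel (\<lambda>p. M * indicator D p :: real)"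
        using D_borel fin by (intro integrable_mult_right integrable_real_indicator) auto
      fix p
      have "\<rho> p \<le> M" using \<rho>_bound[of p] by simp
      then show "indicator (reg \<xi> i) p * \<rho> p \<le> M * indicator D p"
        using region_subset_D[of \<xi> i] M_nonneg by (auto simp: indicator_def)
    qed
    then show ?thesis using D_borel by simp
  qed
  then have "norm (u_tilde ud a D \<xi>) \<le> (\<Sum>i\<in>(UNIV::'n set). M * measure lborel D)" for \<xi>
    by (intro order_trans[OF norm_le_l1_cart] sum_mono) (simp add: u_tilde_def)
  then show ?thesis by blast
qed

text \<open>
  The slicewise remainders divided by \<open>|X n - z|\<close> tend to zero for almost every \<open>x\<close> and are bounded
  by a constant on a fixed interval. As the exceptional set depends on \<open>\<xi>\<close>, the limit is taken along sequences,
  for which countably many null sets are discarded.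
\<close>

lemma u_tilde_newton_differentiable:
  "((\<lambda>\<xi>. norm (u_tilde ud a D \<xi> - u_tilde ud a D z - Theta ud \<rho> a D \<xi> *v (\<xi> - z)) / norm (\<xi> - z)) \<longlongrightarrow> 0) (at z)"
  unfolding tendsto_at_iff_sequentially
proof (intro allI impI)
  fix X assume "\<forall>n. X n \<in> UNIV - {z}" and X: "X \<longlonglongrightarrow> z"
  obtain R where R: "0 \<le> R" "\<forall>x y. pt m x y \<in> D \<longrightarrow> \<bar>x\<bar> \<le> R" by (rule slice_range)
  let ?U = "u_tilde ud a D" and ?T = "Theta ud \<rho> a D"
  define q where "q i n x = (slice_mass (X n) i x - slice_mass z i x - slice_rate (X n) i (X n - z) x) / norm (X n - z)" for i n x
  have int: "integrable lborel (q i n)" for i n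
    unfolding q_def[abs_def] by (intro integrable_divide_zero Bochner_Integration.integrable_diff integrable_slice_mass integrable_slice_rate)
  have comp: "(?U (X n) - ?U z - ?T (X n) *v (X n - z)) $ i / norm (X n - z) = (LINT x|lborel. q i n x)" for i n
    unfolding q_def
    by (simp add: integrable_slice_mass integrable_slice_rate u_tilde_def measure_region_slices Theta_slices)
  have bound: "norm (q i n x) \<le> 3 * M * Lip i * indicator {- R..R} x" for i n x
  proof (cases "x \<in> {- R..R}")
    case True
    have "\<bar>slice_mass (X n) i x - slice_mass z i x - slice_rate (X n) i (X n - z) x\<bar> \<le> 3 * M * Lip i * norm (X n - z)"
      using slice_mass_diff_bound[of "X n" i x z] slice_rate_bound[of "X n" i "X n - z" x] by linarith
    then have "norm (q i n x) \<le> 3 * M * Lip i"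
      using M_nonneg Lip_nonneg[of i] unfolding q_def
      by (cases "X n = z") (auto simp: abs_divide divide_le_eq)
    with True show ?thesis by simp
  next
    case False
    then have out: "pt m x y \<notin> D" for y using R(2) by (force simp: abs_le_iff)
    then have "\<not> neighbour (X n) i k x" for k using neighbour_in_D by blast
    moreover have "pt m x y \<notin> interior D" for y using out interior_subset by blast
    ultimately have "q i n x = 0" by (simp add: q_def slice_mass_empty slice_rate_def)
    then show ?thesis using M_nonneg Lip_nonneg by simp
  qed
  have lim: "(\<lambda>n. LINT x|lborel. q i n x) \<longlonglongrightarrow> (LINT x::real|lborel. (0::real))" for i
  proof (rule integral_dominated_convergence[where s="q i" and f="\<lambda>_. 0" and w="\<lambda>x. 3 * M * Lip i * indicator {- R..R} x"])
    show "integrable lborel (\<lambda>x. 3 * M * Lip i * indicator {- R..R} x)"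
      using R(1) by (intro integrable_mult_right integrable_real_indicator) auto
    have "AE x in lborel. \<forall>n. x \<notin> exceptional (X n) i"
      by (simp add: AE_all_countable AE_not_exceptional)
    then show "AE x in lborel. (\<lambda>n. q i n x) \<longlonglongrightarrow> 0"
      unfolding q_def by eventually_elim (rule slice_semismooth[OF X], blast)
    show "AE x in lborel. norm (q i n x) \<le> 3 * M * Lip i * indicator {- R..R} x" for n
      by (intro AE_I2 bound)
  qed (use int in auto)
  have "(\<lambda>n. (1 / norm (X n - z)) *\<^sub>R (?U (X n) - ?U z - ?T (X n) *v (X n - z))) \<longlonglongrightarrow> 0"
  proof (rule vec_tendstoI)
    fix i
    show "(\<lambda>n. ((1 / norm (X n - z)) *\<^sub>R (?U (X n) - ?U z - ?T (X n) *v (X n - z))) $ i) \<longlonglongrightarrow> 0 $ i"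
      using lim[of i] unfolding comp[symmetric] by simp
  qed
  from tendsto_norm[OF this]
  show "((\<lambda>\<xi>. norm (?U \<xi> - ?U z - ?T \<xi> *v (\<xi> - z)) / norm (\<xi> - z)) \<circ> X) \<longlonglongrightarrow> 0"
    by (simp add: comp_def)
qed

lemma Theta_dissipative:
  "\<exists>c\<ge>0. \<forall>\<xi> h. (norm (Theta ud \<rho> a D \<xi> *v h))\<^sup>2 \<le> c * (- (Theta ud \<rho> a D \<xi> *v h) \<bullet> h)"
proof -
  obtain K where K: "\<And>\<xi> i k. i \<noteq> k \<Longrightarrow> 0 \<le> edge_weight \<rho> a D \<xi> i k \<and> edge_weight \<rho> a D \<xi> i k \<le> K"
    using edge_weight_bounded by blast
  define K' where "K' = max K 0"
  have "(norm (Theta ud \<rho> a D \<xi> *v h))\<^sup>2 \<le> 2 * (CARD('n) * K') * (- (Theta ud \<rho> a D \<xi> *v h) \<bullet> h)" for \<xi> h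
  proof -
    \<comment> \<open>the Laplacian does not see the diagonal; zero there keeps all weights bounded\<close>
    define w where "w i k = (if i = k then 0 else edge_weight \<rho> a D \<xi> i k)" for i k
    have eq: "(\<chi> i. \<Sum>k\<in>UNIV. w i k * (h $ i - h $ k)) = - (Theta ud \<rho> a D \<xi> *v h)"
    proof (simp add: vec_eq_iff Theta_mult sum_negf[symmetric] del: sum_negf, intro allI)
      fix i
      show "(\<Sum>k\<in>UNIV. w i k * (h $ i - h $ k)) = (\<Sum>k\<in>UNIV - {i}. - (edge_weight \<rho> a D \<xi> i k * (h $ k - h $ i)))"
        by (rule sum.mono_neutral_cong_right) (auto simp: w_def algebra_simps)
    qed
    have "(norm (\<chi> i. \<Sum>k\<in>UNIV. w i k * (h $ i - h $ k)))\<^sup>2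
        \<le> 2 * (CARD('n) * K') * ((\<chi> i. \<Sum>k\<in>UNIV. w i k * (h $ i - h $ k)) \<bullet> h)"
    proof (rule laplacian_energy)
      show "w i k = w k i" for i k by (simp add: w_def edge_weight_commute)
      show "0 \<le> w i k" for i k using K by (simp add: w_def)
      show "w i k \<le> K'" for i k using K[of i k \<xi>] by (auto simp: w_def K'_def)
    qed
    then show ?thesis unfolding eq by simp
  qed
  then show ?thesis by (intro exI[of _ "2 * (CARD('n) * K')"]) (simp add: K'_def)
qed

end

section \<open>Convergence of the semismooth Newton iteration\<close>

theorem theorem4p8:
  fixes a :: "'n::finite \<Rightarrow> real^2"
    and D :: "(real^2) set"
    and u\<^sub>d :: "(real^2) measure"
    and \<rho> :: "real^2 \<Rightarrow> real"
    and \<alpha> :: real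
    and g :: "real^'n \<Rightarrow> real"
    and gradg :: "real^'n \<Rightarrow> real^'n"
    and hessg :: "real^'n \<Rightarrow> real^'n^'n"
    and \<xi>bar :: "real^'n"
  assumes "inj a"
    and "polytope D" and "interior D \<noteq> {}"
    and "continuous_on D \<rho>" and "\<forall>x\<in>D. 0 \<le> \<rho> x"
    and "u\<^sub>d = density (restrict_space lborel D) (\<lambda>x. ennreal (\<rho> x))"
    and "\<alpha> > 0"
    and "twice_cont_differentiable g gradg hessg"
    and "convex_on UNIV g"
    and "residual \<alpha> gradg u\<^sub>d a D \<xi>bar = 0"
  shows "\<exists>\<delta>>0. \<forall>\<xi> :: nat \<Rightarrow> real^'n.
    norm (\<xi> 0 - \<xi>bar) \<le> \<delta> \<longrightarrow>
    (\<forall>k. \<xi> (Suc k) = \<xi> k -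
       matrix_inv (Dresidual \<alpha> hessg u\<^sub>d \<rho> a D (\<xi> k)) *v residual \<alpha> gradg u\<^sub>d a D (\<xi> k)) \<longrightarrow>
    (\<forall>k. invertible (Dresidual \<alpha> hessg u\<^sub>d \<rho> a D (\<xi> k))) \<and> q_superlinear \<xi> \<xi>bar"
proof -
  have D: "convex D" "compact D" "closed D"
    using assms(2) by (auto simp: polytope_imp_convex polytope_imp_compact polytope_imp_closed)
  obtain m where m: "inj (\<lambda>j. m * a j $ 1 + a j $ 2)" using ex_distinct_slopes[OF assms(1)] .
  obtain M where M: "0 \<le> M" "\<And>p. p \<in> D \<Longrightarrow> norm (\<rho> p) \<le> M"
  proof -
    have "bounded (\<rho> ` D)" using D assms(4) by (intro compact_imp_bounded compact_continuous_image)
    then obtain M where "\<And>p. p \<in> D \<Longrightarrow> norm (\<rho> p) \<le> M" by (auto simp: bounded_iff)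
    then show thesis using that[of "max M 0"] by (meson max.coboundedI1 max.cobounded2)
  qed
  \<comment> \<open>extend the density continuously, so that it is defined on whole slices\<close>
  obtain \<rho>' where \<rho>': "continuous_on UNIV \<rho>'" "\<And>p. p \<in> D \<Longrightarrow> \<rho>' p = \<rho> p" "\<And>p. p \<in> UNIV \<Longrightarrow> norm (\<rho>' p) \<le> M"
    using Tietze[OF assms(4) _ M(1) M(2), of UNIV] D(3) by auto
  interpret sliced_diagram a D \<rho>' m M
    by unfold_locales (use D \<rho>' m assms(5) in auto)
  have ud: "u\<^sub>d = ud"
    unfolding assms(6) ud_def
  proof (rule density_cong)
    show "AE x in restrict_space lborel D. ennreal (\<rho> x) = ennreal (\<rho>' x)"
      by (rule AE_I2) (simp add: space_restrict_space \<rho>'(2))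
    have b: "(\<lambda>x. ennreal (\<rho>' x)) \<in> borel_measurable (restrict_space lborel D)"
      using borel_measurable_continuous_onI[OF \<rho>'(1)] by (intro measurable_restrict_space1) auto
    then show "(\<lambda>x. ennreal (\<rho>' x)) \<in> borel_measurable (restrict_space lborel D)" .
    show "(\<lambda>x. ennreal (\<rho> x)) \<in> borel_measurable (restrict_space lborel D)"
      by (rule measurable_cong[THEN iffD2, OF _ b]) (simp add: space_restrict_space \<rho>'(2))
  qed
  have edge: "edge_weight \<rho> a D \<xi> i k = edge_weight \<rho>' a D \<xi> i k" for \<xi> i k
  proof -
    have "common_edge a D \<xi> i k \<subseteq> closure (region a D \<xi> i)" by (simp add: common_edge_def)
    also have "\<dots> \<subseteq> D" using region_subset_D D(3) by (rule closure_minimal)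
    finally have "(LINT x:common_edge a D \<xi> i k|hausdorff1. \<rho> x) = (LINT x:common_edge a D \<xi> i k|hausdorff1. \<rho>' x)"
      unfolding set_lebesgue_integral_def using \<rho>'(2)
      by (intro Bochner_Integration.integral_cong) (auto simp: indicator_def)
    then show ?thesis by (simp add: edge_weight_def)
  qed
  then have Theta: "Theta u\<^sub>d \<rho> a D = Theta ud \<rho>' a D" 
    by (simp add: fun_eq_iff Theta_def ud vec_eq_iff)
  let ?U = "u_tilde ud a D" and ?T = "Theta ud \<rho>' a D"
  let ?r = "residual \<alpha> gradg u\<^sub>d a D" and ?Dr = "Dresidual \<alpha> hessg u\<^sub>d \<rho> a D"
  have grad: "(gradg has_derivative (\<lambda>h. hessg v *v h)) (at v)" for v
    using assms(8) by (simp add: twice_cont_differentiable_def)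
  have hess: "continuous_on UNIV hessg" using assms(8) by (simp add: twice_cont_differentiable_def)
  have Dr_mult: "?Dr \<xi> *v x = (1 / \<alpha>) *\<^sub>R (hessg (?U \<xi>) *v (?T \<xi> *v x)) - x" for \<xi> x
    by (simp add: Dresidual_def Theta ud[symmetric] matrix_vector_mult_diff_rdistrib matrix_vector_mul_assoc
        scaleR_matrix_vector_assoc[symmetric])
  obtain b where b: "\<And>\<xi>. norm (?U \<xi>) \<le> b" using u_tilde_bounded by blast
  obtain B where B: "0 \<le> B" "\<And>\<xi>. norm (hessg (?U \<xi>)) \<le> B"
  proof -
    have "bounded (hessg ` cball 0 b)"
      using hess by (intro compact_imp_bounded compact_continuous_image) (auto intro: continuous_on_subset)
    then obtain B where "\<forall>A\<in>hessg ` cball 0 b. norm A \<le> B" unfolding bounded_iff by blast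
    then have "norm (hessg (?U \<xi>)) \<le> B" for \<xi> using b[of \<xi>] by simp
    moreover from this[of 0] have "0 \<le> B" by (rule order_trans[OF norm_ge_zero])
    ultimately show thesis using that by blast
  qed
  obtain c where c: "0 \<le> c" "\<And>\<xi> h. (norm (?T \<xi> *v h))\<^sup>2 \<le> c * (- (?T \<xi> *v h) \<bullet> h)"
    using Theta_dissipative by blast
  define B' where "B' = CARD('n) * B / \<alpha>"
  have B': "0 \<le> B'" using B(1) assms(7) by (simp add: B'_def)
  have stable: "norm x \<le> (1 + B' * c) * norm (?Dr \<xi> *v x)" for \<xi> x
  proof -
    let ?l = "- (?T \<xi> *v x)" and ?H = "hessg (?U \<xi>)"
    have "norm x \<le> (1 + B' * c) * norm (- (?Dr \<xi> *v x))"
    proof (rule psd_perturbation_bound[where l = ?l and z = "(1 / \<alpha>) *\<^sub>R (?H *v ?l)"])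
      show "- (?Dr \<xi> *v x) = x + (1 / \<alpha>) *\<^sub>R (?H *v ?l)"
        using matrix_vector_mult_diff_distrib[of ?H 0 "?T \<xi> *v x"] by (simp add: Dr_mult)
      show "(norm ?l)\<^sup>2 \<le> c * (?l \<bullet> x)" using c(2)[of \<xi> x] by simp
      show "0 \<le> ?l \<bullet> ((1 / \<alpha>) *\<^sub>R (?H *v ?l))"
        using convex_imp_Hessian_nonneg[OF assms(8,9), of ?l "?U \<xi>"] assms(7)
        by (simp add: divide_nonpos_pos)
      have "norm (?H *v ?l) \<le> CARD('n) * norm ?H * norm ?l" by (rule norm_matrix_vector_mult_le)
      also have "\<dots> \<le> CARD('n) * B * norm ?l" using B(2) by (intro mult_right_mono mult_left_mono) auto
      finally show "norm ((1 / \<alpha>) *\<^sub>R (?H *v ?l)) \<le> B' * norm ?l"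
        using assms(7) by (simp add: B'_def divide_right_mono)
    qed (rule c(1), rule B')
    then show ?thesis by simp
  qed
  obtain C where C: "\<And>\<xi>. norm (?U \<xi> - ?U \<xi>bar) \<le> C * norm (\<xi> - \<xi>bar)" using u_tilde_Lipschitz by blast
  have semi: "((\<lambda>z. norm (?r z - ?r \<xi>bar - ?Dr z *v (z - \<xi>bar)) / norm (z - \<xi>bar)) \<longlongrightarrow> 0) (at \<xi>bar)"
  proof -
    let ?e = "\<lambda>z. gradg (?U z) - gradg (?U \<xi>bar) - (hessg (?U z) ** ?T z) *v (z - \<xi>bar)"
    have "?r z - ?r \<xi>bar - ?Dr z *v (z - \<xi>bar) = (1 / \<alpha>) *\<^sub>R ?e z" for z
      by (simp add: Dr_mult residual_def ud[symmetric] matrix_vector_mul_assoc algebra_simps)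
    moreover have "((\<lambda>z. (1 / \<alpha>) * (norm (?e z) / norm (z - \<xi>bar))) \<longlongrightarrow> (1 / \<alpha>) * 0) (at \<xi>bar)"
      by (intro tendsto_intros newton_differentiable_compose[OF grad hess C u_tilde_newton_differentiable])
    ultimately show ?thesis using assms(7) by simp
  qed
  show ?thesis by (rule newton_q_superlinear[OF assms(10) stable semi])
qed

end
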